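(* Let $P(M,G)=(P,p,M,G)$ be a smooth principal $G$-bundle with $P$ and $M$ connected paracompact smooth manifolds and $G$ a Lie group acting smoothly on $P$ from the left, and let $\omega$ be a flat connection on $P(M,G)$ with holonomy homomorphism $h_\omega:\pi_1(M,p(x_o))\to G$, where $x_o\in P$ is a base point. Let $(\widehat M,q,M)$ be a regular (connected) covering manifold of $M$ with fundamental group $\pi_1(\widehat M)$, let $\widehat P(\widehat M,G)$ be the principal bundle induced by $q$, with the induced flat connection $\widehat\omega$, and let $\widehat x_o\in\widehat P$ be a base point over $x_o$. Then, regarding $\pi_1(\widehat M)$ as a subgroup of $\pi_1(M)$ via $q_\#$, $$\operatorname{Im}(h_{\widehat\omega})\cong \operatorname{Im}\bigl(h_\omega|_{\pi_1(\widehat M)}\bigr).$$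
   Context: The action of $G$ on $P$ is smooth, free and from the left, its orbits are the fibers of $p:P\to M$, and $M\cong G\backslash P$. A covering $(\widehat M,q,M)$ is regular if the image of $\pi_1(\widehat M)$ under $q_\#$ is a normal subgroup of $\pi_1(M)$. Induced bundle: $\widehat P=\{(\widehat m,x)\in\widehat M\times P: q(\widehat m)=p(x)\}$ with projections $\widehat p:\widehat P\to\widehat M$ and $\widehat q:\widehat P\to P$, and $G$ acting on the second factor; the induced connection is $\widehat\omega=\widehat q^{*}\omega$, which is again flat. The base point $\widehat x_o$ satisfies $\widehat q(\widehat x_o)=x_o$. Holonomy homomorphism: for a loop $r$ in $M$ at $p(x_o)$, let $\overline r$ be its $\omega$-horizontal lift to $P$ starting at $x_o$; there is a unique $g_r\in G$ with $\overline r(1)=g_r x_o$. Since $\omega$ is flat, $g_r$ depends only on the homotopy class $[r]$, and $h_\omega([r]):=g_r$ (with $r\cdot s$ meaning first $r$ then $s$, this is a group homomorphism $\pi_1(M,p(x_o))\to G$). The homomorphism $h_{\widehat\omega}:\pi_1(\widehat M,\widehat p(\widehat x_o))\to G$ is defined in the same way from $\widehat\omega$ and $\widehat x_o$. The group $\pi_1(\widehat M)=\pi_1(\widehat M,\widehat p(\widehat x_o))$ is identified with its image under the monomorphism $q_\#:\pi_1(\widehat M,\widehat p(\widehat x_o))\to\pi_1(M,p(x_o))$ induced by $q$. *)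

theory Defs
  imports "HOL-Analysis.Analysis" "HOL-Algebra.Coset"
begin

section \<open>Smooth functions on open subsets of Euclidean space\<close>

text \<open>
  The model space of dimension \<open>n\<close> is the library's \<^const>\<open>Euclidean_space\<close> \<open>n\<close>, whose points are
  the functions \<open>nat \<Rightarrow> real\<close> that vanish at all indices \<open>\<ge> n\<close>. Thus dimension \<open>0\<close> is allowed
  (discrete groups are Lie groups), and the space of dimension \<open>k \<le> n\<close> is literally a subset of the
  space of dimension \<open>n\<close>. A function is of class \<open>C\<^sup>k\<close> on an open set if its iterated partial
  derivatives of order \<open>\<le> k\<close> exist and are continuous there.
\<close>

fun Ck_on :: "nat \<Rightarrow> nat \<Rightarrow> (nat \<Rightarrow> real) set \<Rightarrow> ((nat \<Rightarrow> real) \<Rightarrow> real) \<Rightarrow> bool" where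
  "Ck_on 0 n U f \<longleftrightarrow> continuous_on U f"
| "Ck_on (Suc k) n U f \<longleftrightarrow> continuous_on U f \<and>
     (\<forall>i<n. \<exists>f'. (\<forall>x\<in>U. ((\<lambda>t. f (x(i := t))) has_real_derivative f' x) (at (x i))) \<and>
                 Ck_on k n U f')"

definition smooth_real_on :: "nat \<Rightarrow> (nat \<Rightarrow> real) set \<Rightarrow> ((nat \<Rightarrow> real) \<Rightarrow> real) \<Rightarrow> bool" where
  "smooth_real_on n U f \<longleftrightarrow> (\<forall>k. Ck_on k n U f)"


section \<open>Smooth manifolds and smooth maps\<close>

text \<open>
  A chart \<open>(U, \<phi>)\<close> consists of an open set \<open>U\<close> and a coordinate map \<open>\<phi>\<close>, whose values outside \<open>U\<close>
  are irrelevant.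
\<close>

type_synonym 'a chart = "'a set \<times> ('a \<Rightarrow> nat \<Rightarrow> real)"

record 'a manifold =
  pts :: "'a set"
  mdim :: nat
  atlas :: "'a chart set"

definition is_chart :: "nat \<Rightarrow> 'a::topological_space set \<Rightarrow> 'a chart \<Rightarrow> bool" where
  "is_chart n S c \<longleftrightarrow> (case c of (U, \<phi>) \<Rightarrow>
     openin (top_of_set S) U \<and> openin (Euclidean_space n) (\<phi> ` U) \<and>
     (\<exists>\<psi>. homeomorphism U (\<phi> ` U) \<phi> \<psi>))"

definition smooth_transition :: "nat \<Rightarrow> 'a chart \<Rightarrow> 'a chart \<Rightarrow> bool" where
  "smooth_transition n c d \<longleftrightarrow> (case (c, d) of ((U, \<phi>), (V, \<psi>)) \<Rightarrow>
     (\<forall>i<n. smooth_real_on n (\<phi> ` (U \<inter> V)) (\<lambda>y. \<psi> (inv_into U \<phi> y) i)))"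

definition smooth_manifold :: "'a::topological_space manifold \<Rightarrow> bool" where
  "smooth_manifold M \<longleftrightarrow>
     Hausdorff_space (top_of_set (pts M)) \<and>
     (\<forall>c\<in>atlas M. is_chart (mdim M) (pts M) c) \<and>
     (\<Union>c\<in>atlas M. fst c) = pts M \<and>
     (\<forall>c\<in>atlas M. \<forall>d\<in>atlas M. smooth_transition (mdim M) c d)"

definition maximal_atlas :: "'a::topological_space manifold \<Rightarrow> 'a chart set" where
  "maximal_atlas M = {c. is_chart (mdim M) (pts M) c \<and>
     (\<forall>d\<in>atlas M. smooth_transition (mdim M) c d \<and> smooth_transition (mdim M) d c)}"

definition paracompact_space :: "'a topology \<Rightarrow> bool" where
  "paracompact_space X \<longleftrightarrow>
     (\<forall>\<U>. (\<forall>U\<in>\<U>. openin X U) \<and> \<Union>\<U> = topspace X \<longrightarrow>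
        (\<exists>\<V>. (\<forall>V\<in>\<V>. openin X V \<and> (\<exists>U\<in>\<U>. V \<subseteq> U)) \<and> \<Union>\<V> = topspace X \<and>
             locally_finite_in X \<V>))"

definition smooth_map_on ::
  "'a::topological_space manifold \<Rightarrow> 'b::topological_space manifold \<Rightarrow> 'a set \<Rightarrow> ('a \<Rightarrow> 'b) \<Rightarrow> bool" where
  "smooth_map_on M N W f \<longleftrightarrow>
     openin (top_of_set (pts M)) W \<and> f ` W \<subseteq> pts N \<and> continuous_on W f \<and>
     (\<forall>(U, \<phi>)\<in>atlas M. \<forall>(V, \<psi>)\<in>atlas N. \<forall>j<mdim N.
        smooth_real_on (mdim M) (\<phi> ` (U \<inter> W \<inter> f -` V)) (\<lambda>y. \<psi> (f (inv_into U \<phi> y)) j))"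

abbreviation smooth_map ::
  "'a::topological_space manifold \<Rightarrow> 'b::topological_space manifold \<Rightarrow> ('a \<Rightarrow> 'b) \<Rightarrow> bool" where
  "smooth_map M N \<equiv> smooth_map_on M N (pts M)"

text \<open>\<open>f\<close> maps the open set \<open>W\<close> of \<open>M\<close> diffeomorphically onto an open set of \<open>N\<close>.\<close>

definition diffeo_on ::
  "'a::topological_space manifold \<Rightarrow> 'b::topological_space manifold \<Rightarrow> 'a set \<Rightarrow> ('a \<Rightarrow> 'b) \<Rightarrow> bool" where
  "diffeo_on M N W f \<longleftrightarrow>
     smooth_map_on M N W f \<and> inj_on f W \<and> smooth_map_on N M (f ` W) (inv_into W f)"

definition local_diffeo ::
  "'a::topological_space manifold \<Rightarrow> 'b::topological_space manifold \<Rightarrow> ('a \<Rightarrow> 'b) \<Rightarrow> bool" where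
  "local_diffeo M N f \<longleftrightarrow> (\<forall>x\<in>pts M. \<exists>W. x \<in> W \<and> diffeo_on M N W f)"

text \<open>The coordinates of a product chart are those of the first factor followed by those of the second.\<close>

definition prod_manifold :: "'a manifold \<Rightarrow> 'b manifold \<Rightarrow> ('a \<times> 'b) manifold" where
  "prod_manifold M N =
     \<lparr>pts = pts M \<times> pts N, mdim = mdim M + mdim N,
      atlas = {(U \<times> V, \<lambda>(x, y) i. if i < mdim M then \<phi> x i else \<psi> y (i - mdim M)) | U \<phi> V \<psi>.
                 (U, \<phi>) \<in> atlas M \<and> (V, \<psi>) \<in> atlas N}\<rparr>"

text \<open>
  The \<open>k\<close>-dimensional embedded submanifold on the subset \<open>S\<close>. Its charts are the restrictions of the
  slice charts of \<open>N\<close>: those of the maximal atlas in which \<open>S\<close> is given by the vanishing of all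
  coordinates of index \<open>\<ge> k\<close>.
\<close>

definition submanifold :: "'a::topological_space manifold \<Rightarrow> 'a set \<Rightarrow> nat \<Rightarrow> 'a manifold" where
  "submanifold N S k =
     \<lparr>pts = S, mdim = k,
      atlas = {(U \<inter> S, \<phi>) | U \<phi>. (U, \<phi>) \<in> maximal_atlas N \<and>
                 \<phi> ` (U \<inter> S) = \<phi> ` U \<inter> topspace (Euclidean_space k)}\<rparr>"


section \<open>Tangent vectors and vector fields\<close>

definition smooth_fun :: "'a::topological_space manifold \<Rightarrow> ('a \<Rightarrow> real) set" where
  "smooth_fun M =
     {f. \<forall>(U, \<phi>)\<in>atlas M. smooth_real_on (mdim M) (\<phi> ` U) (\<lambda>y. f (inv_into U \<phi> y))}"

text \<open>
  Tangent vectors are derivations of the algebra of smooth functions. Values of members of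
  \<open>smooth_fun M\<close> outside \<open>pts M\<close> are unconstrained, but irrelevant: the Leibniz rule forces a
  derivation at \<open>x \<in> pts M\<close> to vanish on functions that vanish on \<open>pts M\<close>.
\<close>

type_synonym 'a derivation = "('a \<Rightarrow> real) \<Rightarrow> real"

definition tangent_space :: "'a::topological_space manifold \<Rightarrow> 'a \<Rightarrow> 'a derivation set" where
  "tangent_space M x =
     {v. (\<forall>f. f \<notin> smooth_fun M \<longrightarrow> v f = 0) \<and>
         (\<forall>f\<in>smooth_fun M. \<forall>g\<in>smooth_fun M. \<forall>a b.
            v (\<lambda>y. a * f y + b * g y) = a * v f + b * v g) \<and>
         (\<forall>f\<in>smooth_fun M. \<forall>g\<in>smooth_fun M.
            v (\<lambda>y. f y * g y) = f x * v g + g x * v f)}"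

text \<open>The differential of a smooth map \<open>F\<close> into \<open>N\<close>, applied to a tangent vector \<open>v\<close>.\<close>

definition pushforward ::
  "'b::topological_space manifold \<Rightarrow> ('a \<Rightarrow> 'b) \<Rightarrow> 'a derivation \<Rightarrow> 'b derivation" where
  "pushforward N F v = (\<lambda>f. if f \<in> smooth_fun N then v (f \<circ> F) else 0)"

definition smooth_vector_field ::
  "'a::topological_space manifold \<Rightarrow> ('a \<Rightarrow> 'a derivation) \<Rightarrow> bool" where
  "smooth_vector_field M X \<longleftrightarrow>
     (\<forall>x\<in>pts M. X x \<in> tangent_space M x) \<and>
     (\<forall>f\<in>smooth_fun M. (\<lambda>x. X x f) \<in> smooth_fun M)"

definition lie_bracket ::
  "'a::topological_space manifold \<Rightarrow> ('a \<Rightarrow> 'a derivation) \<Rightarrow> ('a \<Rightarrow> 'a derivation) \<Rightarrow> 'a \<Rightarrow> 'a derivation" where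
  "lie_bracket M X Y x =
     (\<lambda>f. if f \<in> smooth_fun M then X x (\<lambda>y. Y y f) - Y x (\<lambda>y. X y f) else 0)"


section \<open>Principal bundles\<close>

record 'g lie_group = "'g monoid" +
  lie_manifold :: "'g manifold"

definition is_lie_group :: "'g::topological_space lie_group \<Rightarrow> bool" where
  "is_lie_group G \<longleftrightarrow>
     group G \<and> smooth_manifold (lie_manifold G) \<and> pts (lie_manifold G) = carrier G \<and>
     smooth_map (prod_manifold (lie_manifold G) (lie_manifold G)) (lie_manifold G)
       (\<lambda>(g, h). g \<otimes>\<^bsub>G\<^esub> h) \<and>
     smooth_map (lie_manifold G) (lie_manifold G) (\<lambda>g. inv\<^bsub>G\<^esub> g)"

record ('p, 'm, 'g) bundle_data =
  total :: "'p manifold"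
  proj :: "'p \<Rightarrow> 'm"
  base :: "'m manifold"
  str_group :: "'g lie_group"
  act :: "'g \<Rightarrow> 'p \<Rightarrow> 'p"

definition bundle_trivialization ::
  "('p::topological_space, 'm::topological_space, 'g::topological_space) bundle_data \<Rightarrow>
   'm set \<Rightarrow> ('p \<Rightarrow> 'm \<times> 'g) \<Rightarrow> bool" where
  "bundle_trivialization B U \<Theta> \<longleftrightarrow>
     openin (top_of_set (pts (base B))) U \<and>
     (let W = {x \<in> pts (total B). proj B x \<in> U} in
        diffeo_on (total B) (prod_manifold (base B) (lie_manifold (str_group B))) W \<Theta> \<and>
        \<Theta> ` W = U \<times> carrier (str_group B) \<and>
        (\<forall>x\<in>W. fst (\<Theta> x) = proj B x \<and>
           (\<forall>g\<in>carrier (str_group B). snd (\<Theta> (act B g x)) = g \<otimes>\<^bsub>str_group B\<^esub> snd (\<Theta> x))))"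

definition principal_bundle ::
  "('p::topological_space, 'm::topological_space, 'g::topological_space) bundle_data \<Rightarrow> bool" where
  "principal_bundle B \<longleftrightarrow>
     (let P = total B; p = proj B; M = base B; G = str_group B in
       smooth_manifold P \<and> smooth_manifold M \<and> is_lie_group G \<and>
       smooth_map P M p \<and> p ` pts P = pts M \<and>
       smooth_map (prod_manifold (lie_manifold G) P) P (\<lambda>(g, x). act B g x) \<and>
       (\<forall>x\<in>pts P. act B \<one>\<^bsub>G\<^esub> x = x) \<and>
       (\<forall>g\<in>carrier G. \<forall>h\<in>carrier G. \<forall>x\<in>pts P. act B (g \<otimes>\<^bsub>G\<^esub> h) x = act B g (act B h x)) \<and>
       (\<forall>g\<in>carrier G. \<forall>x\<in>pts P. act B g x = x \<longrightarrow> g = \<one>\<^bsub>G\<^esub>) \<and>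
       (\<forall>x\<in>pts P. \<forall>y\<in>pts P. p x = p y \<longleftrightarrow> (\<exists>g\<in>carrier G. y = act B g x)) \<and>
       (\<forall>m\<in>pts M. \<exists>U \<Theta>. m \<in> U \<and> bundle_trivialization B U \<Theta>))"

text \<open>
  The bundle induced by a smooth map \<open>q\<close> from \<open>N\<close> to the base: the fibre product, a submanifold of
  \<open>N \<times> P\<close> of dimension \<open>dim N + dim P - dim M\<close>.
\<close>

definition induced_bundle ::
  "('p::topological_space, 'm, 'g) bundle_data \<Rightarrow> 'n::topological_space manifold \<Rightarrow> ('n \<Rightarrow> 'm) \<Rightarrow>
   ('n \<times> 'p, 'n, 'g) bundle_data" where
  "induced_bundle B N q =
     \<lparr>total = submanifold (prod_manifold N (total B))
        {(n, x). n \<in> pts N \<and> x \<in> pts (total B) \<and> q n = proj B x}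
        (mdim N + mdim (total B) - mdim (base B)),
      proj = fst, base = N, str_group = str_group B,
      act = (\<lambda>g (n, x). (n, act B g x))\<rparr>"


section \<open>Connections and curvature\<close>

abbreviation lie_algebra :: "'g::topological_space lie_group \<Rightarrow> 'g derivation set" where
  "lie_algebra G \<equiv> tangent_space (lie_manifold G) \<one>\<^bsub>G\<^esub>"

definition Ad :: "'g::topological_space lie_group \<Rightarrow> 'g \<Rightarrow> 'g derivation \<Rightarrow> 'g derivation" where
  "Ad G g = pushforward (lie_manifold G) (\<lambda>h. g \<otimes>\<^bsub>G\<^esub> h \<otimes>\<^bsub>G\<^esub> inv\<^bsub>G\<^esub> g)"

text \<open>The fundamental vector field generated by the Lie algebra element \<open>A\<close>, at the point \<open>x\<close>.\<close>

definition fundamental ::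
  "('p::topological_space, 'm, 'g) bundle_data \<Rightarrow> 'g derivation \<Rightarrow> 'p \<Rightarrow> 'p derivation" where
  "fundamental B A x = pushforward (total B) (\<lambda>g. act B g x) A"

type_synonym ('p, 'g) lie_form = "'p \<Rightarrow> 'p derivation \<Rightarrow> 'g derivation"

text \<open>
  For a left action equivariance reads \<open>L\<^sub>g\<^sup>* \<omega> = Ad(g) \<omega>\<close>. Evaluation at smooth functions on
  the group spans the dual of the (finite-dimensional) Lie algebra, whence the form of the smoothness
  condition.
\<close>

definition connection_form ::
  "('p::topological_space, 'm, 'g::topological_space) bundle_data \<Rightarrow> ('p, 'g) lie_form \<Rightarrow> bool" where
  "connection_form B \<omega> \<longleftrightarrow>
     (let P = total B; G = str_group B in
       (\<forall>x\<in>pts P. \<forall>v\<in>tangent_space P x. \<omega> x v \<in> lie_algebra G) \<and>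
       (\<forall>x\<in>pts P. \<forall>v\<in>tangent_space P x. \<forall>w\<in>tangent_space P x. \<forall>a b.
          \<omega> x (\<lambda>f. a * v f + b * w f) = (\<lambda>f. a * \<omega> x v f + b * \<omega> x w f)) \<and>
       (\<forall>X. smooth_vector_field P X \<longrightarrow>
          (\<forall>f\<in>smooth_fun (lie_manifold G). (\<lambda>x. \<omega> x (X x) f) \<in> smooth_fun P)) \<and>
       (\<forall>x\<in>pts P. \<forall>A\<in>lie_algebra G. \<omega> x (fundamental B A x) = A) \<and>
       (\<forall>g\<in>carrier G. \<forall>x\<in>pts P. \<forall>v\<in>tangent_space P x.
          \<omega> (act B g x) (pushforward P (act B g) v) = Ad G g (\<omega> x v)))"

definition exterior_derivative ::
  "'p::topological_space manifold \<Rightarrow> ('p, 'g) lie_form \<Rightarrow>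
   ('p \<Rightarrow> 'p derivation) \<Rightarrow> ('p \<Rightarrow> 'p derivation) \<Rightarrow> 'p \<Rightarrow> 'g derivation" where
  "exterior_derivative P \<omega> X Y x =
     (\<lambda>f. X x (\<lambda>y. \<omega> y (Y y) f) - Y x (\<lambda>y. \<omega> y (X y) f) - \<omega> x (lie_bracket P X Y x) f)"

definition horizontal_part ::
  "('p::topological_space, 'm, 'g) bundle_data \<Rightarrow> ('p, 'g) lie_form \<Rightarrow>
   ('p \<Rightarrow> 'p derivation) \<Rightarrow> 'p \<Rightarrow> 'p derivation" where
  "horizontal_part B \<omega> X x = (\<lambda>f. X x f - fundamental B (\<omega> x (X x)) x f)"

text \<open>The curvature form is the exterior covariant derivative of the connection form.\<close>

definition curvature ::
  "('p::topological_space, 'm, 'g) bundle_data \<Rightarrow> ('p, 'g) lie_form \<Rightarrow>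
   ('p \<Rightarrow> 'p derivation) \<Rightarrow> ('p \<Rightarrow> 'p derivation) \<Rightarrow> 'p \<Rightarrow> 'g derivation" where
  "curvature B \<omega> X Y =
     exterior_derivative (total B) \<omega> (horizontal_part B \<omega> X) (horizontal_part B \<omega> Y)"

definition flat_connection ::
  "('p::topological_space, 'm, 'g::topological_space) bundle_data \<Rightarrow> ('p, 'g) lie_form \<Rightarrow> bool" where
  "flat_connection B \<omega> \<longleftrightarrow> connection_form B \<omega> \<and>
     (\<forall>X Y. smooth_vector_field (total B) X \<and> smooth_vector_field (total B) Y \<longrightarrow>
        (\<forall>x\<in>pts (total B). \<forall>f\<in>smooth_fun (lie_manifold (str_group B)). curvature B \<omega> X Y x f = 0))"

text \<open>The pullback of \<open>\<omega>\<close> along the second projection of the induced bundle.\<close>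

definition induced_form ::
  "('p::topological_space, 'm, 'g) bundle_data \<Rightarrow> ('p, 'g) lie_form \<Rightarrow> ('n \<times> 'p, 'g) lie_form" where
  "induced_form B \<omega> y v = \<omega> (snd y) (pushforward (total B) snd v)"


section \<open>Fundamental groups and coverings\<close>

definition path_class :: "'a::topological_space set \<Rightarrow> (real \<Rightarrow> 'a) \<Rightarrow> (real \<Rightarrow> 'a) set" where
  "path_class S r = {s. homotopic_paths S r s}"

definition fundamental_group :: "'a::topological_space set \<Rightarrow> 'a \<Rightarrow> (real \<Rightarrow> 'a) set monoid" where
  "fundamental_group S x =
     \<lparr>carrier = {path_class S r | r.
         path r \<and> path_image r \<subseteq> S \<and> pathstart r = x \<and> pathfinish r = x},
      monoid.mult = (\<lambda>c d. \<Union>r\<in>c. \<Union>s\<in>d. path_class S (r +++ s)),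
      one = path_class S (\<lambda>_. x)\<rparr>"

text \<open>The map of homotopy classes induced by a continuous map \<open>q\<close> into \<open>S\<close>.\<close>

definition induced_hom ::
  "'b::topological_space set \<Rightarrow> ('a \<Rightarrow> 'b) \<Rightarrow> (real \<Rightarrow> 'a) set \<Rightarrow> (real \<Rightarrow> 'b) set" where
  "induced_hom S q c = (\<Union>r\<in>c. path_class S (q \<circ> r))"

definition covering_manifold ::
  "'n::topological_space manifold \<Rightarrow> ('n \<Rightarrow> 'm) \<Rightarrow> 'm::topological_space manifold \<Rightarrow> bool" where
  "covering_manifold N q M \<longleftrightarrow>
     smooth_manifold N \<and> connected (pts N) \<and>
     covering_space (pts N) q (pts M) \<and> local_diffeo N M q"

definition regular_at ::
  "'n::topological_space manifold \<Rightarrow> ('n \<Rightarrow> 'm) \<Rightarrow> 'm::topological_space manifold \<Rightarrow> 'n \<Rightarrow> bool" where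
  "regular_at N q M n \<longleftrightarrow>
     induced_hom (pts M) q ` carrier (fundamental_group (pts N) n)
       \<lhd> fundamental_group (pts M) (q n)"


section \<open>Horizontal lifts and holonomy\<close>

text \<open>
  Curves of class \<open>C\<^sup>1\<close> on a compact interval, up to and including the end points, where derivatives
  are one-sided.
\<close>

definition C1_curve_on :: "'a::topological_space manifold \<Rightarrow> (real \<Rightarrow> 'a) \<Rightarrow> real \<Rightarrow> real \<Rightarrow> bool" where
  "C1_curve_on M \<gamma> a b \<longleftrightarrow>
     continuous_on {a..b} \<gamma> \<and> \<gamma> ` {a..b} \<subseteq> pts M \<and>
     (\<forall>(U, \<phi>)\<in>atlas M. \<forall>i<mdim M. \<exists>d.
        continuous_on ({a..b} \<inter> \<gamma> -` U) d \<and>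
        (\<forall>t\<in>{a..b} \<inter> \<gamma> -` U.
           ((\<lambda>s. \<phi> (\<gamma> s) i) has_real_derivative d t) (at t within {a..b})))"

definition velocity ::
  "'a::topological_space manifold \<Rightarrow> (real \<Rightarrow> 'a) \<Rightarrow> real \<Rightarrow> real \<Rightarrow> real \<Rightarrow> 'a derivation" where
  "velocity M \<gamma> a b t =
     (\<lambda>f. if f \<in> smooth_fun M then vector_derivative (f \<circ> \<gamma>) (at t within {a..b}) else 0)"

definition horizontal_path ::
  "('p::topological_space, 'm, 'g) bundle_data \<Rightarrow> ('p, 'g) lie_form \<Rightarrow> (real \<Rightarrow> 'p) \<Rightarrow> bool" where
  "horizontal_path B \<omega> \<gamma> \<longleftrightarrow>
     (\<exists>n (\<tau> :: nat \<Rightarrow> real). \<tau> 0 = 0 \<and> \<tau> n = 1 \<and>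
        (\<forall>i<n. \<tau> i < \<tau> (Suc i) \<and> C1_curve_on (total B) \<gamma> (\<tau> i) (\<tau> (Suc i)) \<and>
           (\<forall>t\<in>{\<tau> i..\<tau> (Suc i)}.
              \<omega> (\<gamma> t) (velocity (total B) \<gamma> (\<tau> i) (\<tau> (Suc i)) t) = (\<lambda>_. 0))))"

definition horizontal_lift ::
  "('p::topological_space, 'm, 'g) bundle_data \<Rightarrow> ('p, 'g) lie_form \<Rightarrow> 'p \<Rightarrow>
   (real \<Rightarrow> 'm) \<Rightarrow> (real \<Rightarrow> 'p) \<Rightarrow> bool" where
  "horizontal_lift B \<omega> x r \<gamma> \<longleftrightarrow>
     horizontal_path B \<omega> \<gamma> \<and> \<gamma> 0 = x \<and> (\<forall>t\<in>{0..1}. proj B (\<gamma> t) = r t)"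

text \<open>
  The holonomy of a homotopy class of loops at the image of \<open>x\<close>, computed from its
  representatives that admit a horizontal lift, i.e. the piecewise \<open>C\<^sup>1\<close> ones. For a flat
  connection the result does not depend on the representative; the lift is unique, and so is the group
  element, since the action is free.
\<close>

definition holonomy ::
  "('p::topological_space, 'm, 'g) bundle_data \<Rightarrow> ('p, 'g) lie_form \<Rightarrow> 'p \<Rightarrow> (real \<Rightarrow> 'm) set \<Rightarrow> 'g" where
  "holonomy B \<omega> x c =
     (THE g. g \<in> carrier (str_group B) \<and>
        (\<exists>r\<in>c. \<exists>\<gamma>. horizontal_lift B \<omega> x r \<gamma> \<and> \<gamma> 1 = act B g x))"

end

theory Submission
  imports Defs "HOL-Homology.Invariance_of_Domain"
begin

text \<open>
  For a loop class \<open>c\<close> in the covering, \<open>c\<close> and \<open>q \<circ> c\<close> have the same holonomy, so the two images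
  coincide as subsets of the structure group. A horizontal path in the induced bundle projects to a
  horizontal path in \<open>P\<close>, because the induced form is the pullback of \<open>\<omega>\<close>. Conversely, let
  \<open>\<gamma>\<close> be a horizontal lift of a loop \<open>r\<close> homotopic to \<open>q \<circ> s\<close> with \<open>s \<in> c\<close>. Lifting the homotopy
  to the covering yields a loop \<open>r'\<close> over \<open>r\<close> in the class \<open>c\<close>, and \<open>(r', \<gamma>)\<close> is horizontal in the
  induced bundle. That differentiability of curves can be tested in the factors rests on the
  existence of slice charts around every point of the fibre product.
\<close>

section \<open>Calculus in the model spaces\<close>

text \<open>The obstacle is the total space of the induced bundle. The atlas of
  \<open>submanifold\<close> consists of the slice charts that happen to exist. Without one around
  every point, \<open>C1_curve_on\<close> would say too little about a curve in the fibre product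
  for its projection to \<open>P\<close> to be C^1. Slice charts are obtained by shearing product
  charts with a local inverse of \<open>q\<close>. Their dimension must be the declared one,
  \<open>mdim N + mdim P - mdim M\<close> with truncated subtraction; as \<open>diffeo_on\<close>
  does not mention dimensions, \<open>mdim N = mdim M\<close> comes from invariance of domain.
  Smoothness is phrased by iterated partial derivatives of functions on
  \<open>nat \<Rightarrow> real\<close>, so the chain rule, needed for compatibility of charts and
  for curves, is derived from the mean value theorem in one variable. Homotopies are lifted between
  arbitrary topological spaces by bisecting rectangles in both directions.\<close>

lemma Euclidean_space_eq_top_of_set:
  "Euclidean_space n = top_of_set {x. \<forall>i\<ge>n. x i = 0}"
  by (simp add: Euclidean_space_def euclidean_product_topology)

lemma openin_Euclidean_space_zero:
  assumes "openin (Euclidean_space n) U" "x \<in> U" "n \<le> i"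
  shows "x i = 0"
  using openin_subset[OF assms(1)] assms(2,3) by (auto simp: topspace_Euclidean_space)

text \<open>Basic neighbourhoods in the product topology bound each coordinate separately. Points of
  the model space all vanish from index \<open>n\<close> on, so finitely many radii remain and a
  single \<open>e\<close> serves for all of them.\<close>

lemma openin_Euclidean_space_box:
  assumes "openin (Euclidean_space n) U" "x \<in> U"
  obtains e where "0 < e"
    "\<forall>y. (\<forall>i\<ge>n. y i = 0) \<longrightarrow> (\<forall>i<n. \<bar>y i - x i\<bar> < e) \<longrightarrow> y \<in> U"
proof -
  obtain T where T: "open T" "U = {x. \<forall>i\<ge>n. x i = 0} \<inter> T"
    using assms(1) by (auto simp: Euclidean_space_eq_top_of_set openin_open)
  have "openin (product_topology (\<lambda>i. euclidean) UNIV) T"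
    using T(1) by (simp add: euclidean_product_topology)
  from product_topology_open_contains_basis[OF this, of x]
  obtain X where X: "x \<in> (\<Pi>\<^sub>E i\<in>UNIV. X i)" "\<And>i. open (X i)" "(\<Pi>\<^sub>E i\<in>UNIV. X i) \<subseteq> T"
    using assms(2) T(2) by auto
  have "\<exists>e>0. ball (x i) e \<subseteq> X i" for i
    using X(1,2) by (metis PiE_mem UNIV_I open_contains_ball)
  then obtain r where r: "\<And>i. 0 < r i" "\<And>i. ball (x i) (r i) \<subseteq> X i"
    by metis
  \<comment> \<open>Inserting 1 keeps \<open>Min\<close> meaningful when
    \<open>n = 0\<close>.\<close>
  define e where "e = Min (insert 1 (r ` {..<n}))"
  have e: "0 < e" "\<And>i. i < n \<Longrightarrow> e \<le> r i"
    using r(1) by (auto simp: e_def)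
  show thesis
  proof (intro that allI impI)
    fix y :: "nat \<Rightarrow> real"
    assume y': "\<forall>i\<ge>n. y i = 0" "\<forall>i<n. \<bar>y i - x i\<bar> < e"
    then have y: "\<And>i. n \<le> i \<Longrightarrow> y i = 0" "\<And>i. i < n \<Longrightarrow> \<bar>y i - x i\<bar> < e" by auto
    have "y i \<in> X i" for i
    proof (cases "i < n")
      case True
      then have "y i \<in> ball (x i) (r i)"
        using y(2)[OF True] e(2)[OF True] by (simp add: dist_real_def abs_minus_commute)
      then show ?thesis using r(2) by blast
    next
      case False
      then have "y i = x i"
        using y(1) openin_Euclidean_space_zero[OF assms] by simp
      then show ?thesis using X(1) by auto
    qed
    then show "y \<in> U"
      using X(3) y(1) T(2) by (auto simp: subset_iff PiE_iff)
  qed (rule e(1))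
qed

text \<open>Moving one coordinate slightly stays inside \<open>U\<close>; this is why partial
  derivatives at points of \<open>U\<close> depend only on the values in \<open>U\<close>.\<close>

lemma eventually_upd_in_openin:
  assumes "openin (Euclidean_space n) U" "x \<in> U" "i < n"
  shows "\<forall>\<^sub>F t in nhds (x i). x(i := t) \<in> U"
proof -
  obtain e where e: "0 < e"
    "\<forall>y. (\<forall>i\<ge>n. y i = 0) \<longrightarrow> (\<forall>i<n. \<bar>y i - x i\<bar> < e) \<longrightarrow> y \<in> U"
    using openin_Euclidean_space_box[OF assms(1,2)] .
  have "x(i := t) \<in> U" if "dist t (x i) < e" for t
    using that e openin_Euclidean_space_zero[OF assms(1,2)] assms(3)
    by (intro e(2)[rule_format]) (auto simp: dist_real_def)
  then show ?thesis
    using e(1) by (auto simp: eventually_nhds_metric)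
qed

lemma continuous_on_locally_openin:
  assumes "\<And>x. x \<in> U \<Longrightarrow> \<exists>V. openin (top_of_set U) V \<and> x \<in> V \<and> continuous_on V f"
  shows "continuous_on U f"
  unfolding continuous_on_def
proof
  fix x assume "x \<in> U"
  then obtain T where T: "open T" "x \<in> U \<inter> T" "continuous_on (U \<inter> T) f"
    using assms by (metis openin_open)
  have "at x within U = at x within (U \<inter> T)"
    using T by (intro at_within_nhd[of x T]) auto
  then show "(f \<longlongrightarrow> f x) (at x within U)"
    using T(2,3) by (simp add: continuous_on_def)
qed

section \<open>Functions of class C^k: monotonicity, congruence, locality\<close>

lemma Ck_on_imp_continuous_on: "Ck_on k n U f \<Longrightarrow> continuous_on U f"
  by (cases k) auto

lemma Ck_on_SucE:
  assumes "Ck_on (Suc k) n U f" "i < n"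
  obtains f' where "\<forall>x\<in>U. ((\<lambda>t. f (x(i := t))) has_real_derivative f' x) (at (x i))"
    "Ck_on k n U f'"
  using assms unfolding Ck_on.simps by blast

lemma Ck_on_mono:
  assumes "Ck_on k n U f" "V \<subseteq> U" "m \<le> n"
  shows "Ck_on k m V f"
  using assms(1)
proof (induction k arbitrary: f)
  case 0
  then show ?case using assms(2) continuous_on_subset by auto
next
  case (Suc k)
  have "\<exists>f'. (\<forall>x\<in>V. ((\<lambda>t. f (x(i := t))) has_real_derivative f' x) (at (x i))) \<and> Ck_on k m V f'"
    if "i < m" for i
  proof -
    obtain f' where "\<forall>x\<in>U. ((\<lambda>t. f (x(i := t))) has_real_derivative f' x) (at (x i))" "Ck_on k n U f'"
      using Ck_on_SucE[OF Suc.prems order_less_le_trans[OF \<open>i < m\<close> assms(3)]] .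
    then show ?thesis using assms(2) Suc.IH by blast
  qed
  moreover have "continuous_on V f"
    using Suc.prems assms(2) continuous_on_subset by auto
  ultimately show ?case by simp
qed

lemma Ck_on_Suc_imp: "Ck_on (Suc k) n U f \<Longrightarrow> Ck_on k n U f"
proof (induction k arbitrary: f)
  case (Suc k)
  have "\<exists>f'. (\<forall>x\<in>U. ((\<lambda>t. f (x(i := t))) has_real_derivative f' x) (at (x i))) \<and> Ck_on k n U f'"
    if "i < n" for i
    using Ck_on_SucE[OF Suc.prems that] Suc.IH by metis
  then show ?case using Ck_on_imp_continuous_on[OF Suc.prems] by simp
qed simp

lemma has_real_derivative_upd_cong:
  assumes "openin (Euclidean_space n) U" "\<And>x. x \<in> U \<Longrightarrow> f x = g x" "x \<in> U" "i < n"
  shows "((\<lambda>t. f (x(i := t))) has_real_derivative d) (at (x i)) \<longleftrightarrow>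
         ((\<lambda>t. g (x(i := t))) has_real_derivative d) (at (x i))"
proof (rule DERIV_cong_ev)
  show "\<forall>\<^sub>F t in nhds (x i). f (x(i := t)) = g (x(i := t))"
    using eventually_upd_in_openin[OF assms(1,3,4)] by eventually_elim (use assms(2) in auto)
qed auto

text \<open>Openness of \<open>U\<close> matters: the derivative at \<open>x i\<close> involves all
  nearby \<open>t\<close>, and \<open>x(i := t)\<close> has to lie where \<open>f\<close> and
  \<open>g\<close> agree.\<close>

lemma Ck_on_cong:
  assumes "openin (Euclidean_space n) U" "\<And>x. x \<in> U \<Longrightarrow> f x = g x"
  shows "Ck_on k n U f \<longleftrightarrow> Ck_on k n U g"
proof (cases k)
  case 0
  then show ?thesis using assms(2) by (simp cong: continuous_on_cong)
next
  case (Suc l)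
  have "continuous_on U f \<longleftrightarrow> continuous_on U g"
    using assms(2) by (simp cong: continuous_on_cong)
  moreover have "(\<forall>x\<in>U. ((\<lambda>t. f (x(i := t))) has_real_derivative f' x) (at (x i))) \<longleftrightarrow>
      (\<forall>x\<in>U. ((\<lambda>t. g (x(i := t))) has_real_derivative f' x) (at (x i)))" if "i < n" for i f'
    using has_real_derivative_upd_cong[of n U f g, OF assms _ that] by blast
  ultimately show ?thesis
    by (simp add: Suc)
qed

lemma smooth_real_on_eq:
  assumes "smooth_real_on n U f" "openin (Euclidean_space n) U" "\<And>x. x \<in> U \<Longrightarrow> f x = g x"
  shows "smooth_real_on n U g"
  using Ck_on_cong[of n U f g, OF assms(2,3)] assms(1) by (simp add: smooth_real_on_def)

lemma smooth_real_on_mono: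
  "smooth_real_on n U f \<Longrightarrow> V \<subseteq> U \<Longrightarrow> m \<le> n \<Longrightarrow> smooth_real_on m V f"
  unfolding smooth_real_on_def using Ck_on_mono by blast

lemma continuous_on_locally_Euclidean_space:
  assumes loc: "\<And>x. x \<in> U \<Longrightarrow>
    \<exists>V. openin (Euclidean_space n) V \<and> x \<in> V \<and> V \<subseteq> U \<and> continuous_on V f"
  shows "continuous_on U f"
proof (rule continuous_on_locally_openin)
  fix x assume "x \<in> U"
  then obtain V where V: "openin (Euclidean_space n) V" "x \<in> V" "V \<subseteq> U" "continuous_on V f"
    using loc by blast
  obtain T where T: "open T" "V = {x. \<forall>i\<ge>n. x i = 0} \<inter> T"
    using V(1) by (auto simp: Euclidean_space_eq_top_of_set openin_open)
  have "x i = 0" if "x \<in> U" "n \<le> i" for x i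
    using loc[OF that(1)] openin_Euclidean_space_zero[OF _ _ that(2)] by metis
  then have "V = U \<inter> T" using T V(3) by auto
  then show "\<exists>V. openin (top_of_set U) V \<and> x \<in> V \<and> continuous_on V f"
    using V T(1) openin_open_Int by blast
qed

lemma Ck_on_locally:
  assumes "\<And>x. x \<in> U \<Longrightarrow> \<exists>V. openin (Euclidean_space n) V \<and> x \<in> V \<and> V \<subseteq> U \<and> Ck_on k n V f"
  shows "Ck_on k n U f"
  using assms
proof (induction k arbitrary: f)
  case 0
  then show ?case
    unfolding Ck_on.simps by (rule continuous_on_locally_Euclidean_space)
next
  case (Suc k)
  have "\<exists>f'. (\<forall>x\<in>U. ((\<lambda>t. f (x(i := t))) has_real_derivative f' x) (at (x i))) \<and> Ck_on k n U f'"
    if i: "i < n" for i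
  proof -
    \<comment> \<open>The derivatives given on different neighbourhoods are unrelated choices;
      \<open>deriv\<close> is one function that agrees with each of them on its own neighbourhood,
      by uniqueness of derivatives.\<close>
    define f' where "f' x = deriv (\<lambda>t. f (x(i := t))) (x i)" for x
    have loc: "\<exists>V. openin (Euclidean_space n) V \<and> x \<in> V \<and> V \<subseteq> U \<and>
        (\<forall>x\<in>V. ((\<lambda>t. f (x(i := t))) has_real_derivative f' x) (at (x i))) \<and> Ck_on k n V f'"
      if "x \<in> U" for x
    proof -
      obtain V where V: "openin (Euclidean_space n) V" "x \<in> V" "V \<subseteq> U" "Ck_on (Suc k) n V f"
        using Suc.prems \<open>x \<in> U\<close> by blast
      then obtain g where
        g: "\<forall>x\<in>V. ((\<lambda>t. f (x(i := t))) has_real_derivative g x) (at (x i))" "Ck_on k n V g"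
        using i by auto
      have "f' x = g x" if "x \<in> V" for x
        using g(1) that by (auto simp: f'_def intro!: DERIV_imp_deriv)
      then show ?thesis
        using V(1-3) g Ck_on_cong[OF V(1), of f' g] by auto
    qed
    have "Ck_on k n U f'" by (rule Suc.IH) (use loc in metis)
    moreover have "\<forall>x\<in>U. ((\<lambda>t. f (x(i := t))) has_real_derivative f' x) (at (x i))"
      using loc by metis
    ultimately show ?thesis by metis
  qed
  moreover have "continuous_on U f"
    by (rule continuous_on_locally_Euclidean_space[where n = n])
      (use Suc.prems Ck_on_imp_continuous_on in metis)
  ultimately show ?case by simp
qed

lemma smooth_real_on_locally:
  assumes "\<And>x. x \<in> U \<Longrightarrow>
    \<exists>V. openin (Euclidean_space n) V \<and> x \<in> V \<and> V \<subseteq> U \<and> smooth_real_on n V f"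
  shows "smooth_real_on n U f"
  unfolding smooth_real_on_def
proof
  fix k show "Ck_on k n U f"
    using assms by (intro Ck_on_locally) (metis smooth_real_on_def)
qed

section \<open>Sums and products of C^k functions\<close>

lemma Ck_on_const: "Ck_on k n U (\<lambda>_. c)"
proof (induction k arbitrary: c)
  case (Suc k)
  then show ?case by (auto intro!: exI[of _ "\<lambda>_. 0"])
qed simp

lemma Ck_on_coord: "Ck_on k n U (\<lambda>x. x j)"
proof -
  have cont: "continuous_on U (\<lambda>x :: nat \<Rightarrow> real. x j)"
    by (rule continuous_on_subset[OF continuous_on_product_coordinates]) simp
  have "\<exists>f'. (\<forall>x\<in>U. ((\<lambda>t. (x(i := t)) j) has_real_derivative f' x) (at (x i))) \<and> Ck_on l n U f'" for i l
    using Ck_on_const[of l n U "if i = j then 1 else 0"]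
    by (intro exI[of _ "\<lambda>_. if i = j then 1 else 0"]) (auto intro!: derivative_eq_intros)
  then show ?thesis using cont by (cases k) simp_all
qed

lemma Ck_on_add: "Ck_on k n U f \<Longrightarrow> Ck_on k n U g \<Longrightarrow> Ck_on k n U (\<lambda>x. f x + g x)"
proof (induction k arbitrary: f g)
  case (Suc k)
  have "\<exists>h'. (\<forall>x\<in>U. ((\<lambda>t. f (x(i := t)) + g (x(i := t))) has_real_derivative h' x) (at (x i))) \<and>
          Ck_on k n U h'" if i: "i < n" for i
  proof -
    obtain f' where
      "\<forall>x\<in>U. ((\<lambda>t. f (x(i := t))) has_real_derivative f' x) (at (x i))" "Ck_on k n U f'"
      using Ck_on_SucE[OF Suc.prems(1) i] by blast
    moreover obtain g' where
      "\<forall>x\<in>U. ((\<lambda>t. g (x(i := t))) has_real_derivative g' x) (at (x i))" "Ck_on k n U g'"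
      using Ck_on_SucE[OF Suc.prems(2) i] by blast
    ultimately show ?thesis
      using Suc.IH by (intro exI[of _ "\<lambda>x. f' x + g' x"]) (auto intro: derivative_intros)
  qed
  then show ?case using Suc.prems by (auto intro: continuous_intros)
qed (auto intro: continuous_intros)

lemma Ck_on_mult: "Ck_on k n U f \<Longrightarrow> Ck_on k n U g \<Longrightarrow> Ck_on k n U (\<lambda>x. f x * g x)"
proof (induction k arbitrary: f g)
  case (Suc k)
  have "\<exists>h'. (\<forall>x\<in>U. ((\<lambda>t. f (x(i := t)) * g (x(i := t))) has_real_derivative h' x) (at (x i))) \<and>
          Ck_on k n U h'" if i: "i < n" for i
  proof -
    obtain f' where
      f': "\<forall>x\<in>U. ((\<lambda>t. f (x(i := t))) has_real_derivative f' x) (at (x i))" "Ck_on k n U f'"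
      using Ck_on_SucE[OF Suc.prems(1) i] by blast
    obtain g' where
      g': "\<forall>x\<in>U. ((\<lambda>t. g (x(i := t))) has_real_derivative g' x) (at (x i))" "Ck_on k n U g'"
      using Ck_on_SucE[OF Suc.prems(2) i] by blast
    \<comment> \<open>The undifferentiated factors are used at order \<open>k\<close> only, so the
      induction hypothesis applies to both products.\<close>
    have "Ck_on k n U (\<lambda>x. f' x * g x + f x * g' x)"
      by (intro Ck_on_add Suc.IH f'(2) g'(2) Suc.prems[THEN Ck_on_Suc_imp])
    moreover have "((\<lambda>t. f (x(i := t)) * g (x(i := t))) has_real_derivative f' x * g x + f x * g' x) (at (x i))"
      if "x \<in> U" for x
      using DERIV_mult[OF f'(1)[rule_format, OF that] g'(1)[rule_format, OF that]]
      by (simp add: algebra_simps)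
    ultimately show ?thesis by (intro exI conjI ballI) assumption+
  qed
  then show ?case using Suc.prems by (auto intro: continuous_intros)
qed (auto intro: continuous_intros)

lemma Ck_on_sum:
  "(\<And>i. i \<in> I \<Longrightarrow> Ck_on k n U (f i)) \<Longrightarrow> Ck_on k n U (\<lambda>x. \<Sum>i\<in>I. f i x)"
  by (induction I rule: infinite_finite_induct) (auto simp: Ck_on_const intro!: Ck_on_add)

text \<open>Both orientations and \<open>a = b\<close> are covered, since a coordinate of a curve
  may increase, decrease or stand still between two times.\<close>

lemma MVT_between:
  fixes \<phi> :: "real \<Rightarrow> real"
  assumes "\<And>u. \<bar>u - a\<bar> \<le> \<bar>b - a\<bar> \<Longrightarrow> (\<phi> has_real_derivative \<phi>' u) (at u)"
  obtains u where "\<bar>u - a\<bar> \<le> \<bar>b - a\<bar>" "\<phi> b - \<phi> a = (b - a) * \<phi>' u"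
proof (cases a b rule: linorder_cases)
  case less
  then have "\<exists>z>a. z < b \<and> \<phi> b - \<phi> a = (b - a) * \<phi>' z"
    using assms by (intro MVT2) auto
  then show ?thesis using that by force
next
  case greater
  then have "\<exists>z>b. z < a \<and> \<phi> a - \<phi> b = (a - b) * \<phi>' z"
    using assms by (intro MVT2) auto
  then obtain z where "b < z" "z < a" "\<phi> a - \<phi> b = (a - b) * \<phi>' z" by blast
  then show ?thesis by (intro that[of z]) (auto simp: algebra_simps)
qed (use that[of a] in simp)

text \<open>
  Both the chain rule for curves and the one for partial derivatives of a composition are instances
  of the following lemma. The increment of \<open>f\<close> is telescoped along a path that changes one
  coordinate at a time, and the mean value theorem is applied to each step.
\<close>

lemma has_real_derivative_chain_coords:
  assumes U: "openin (Euclidean_space n) U"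
    and f: "\<And>i x. i < n \<Longrightarrow> x \<in> U \<Longrightarrow> ((\<lambda>t. f (x(i := t))) has_real_derivative f' i x) (at (x i))"
    and f': "\<And>i. i < n \<Longrightarrow> continuous_on U (f' i)"
    and c: "\<And>i. i < n \<Longrightarrow> ((\<lambda>s. c s i) has_real_derivative c' i) (at t within S)"
    and ct: "c t \<in> U" and c0: "\<And>s i. s \<in> S \<Longrightarrow> n \<le> i \<Longrightarrow> c s i = 0"
  shows "((\<lambda>s. f (c s)) has_real_derivative (\<Sum>i<n. f' i (c t) * c' i)) (at t within S)"
proof -
  define F where "F = at t within S"
  define x where "x = c t"
  have xU: "x \<in> U" using ct by (simp add: x_def)
  have x0: "n \<le> i \<Longrightarrow> x i = 0" for i
    using openin_Euclidean_space_zero[OF U xU] .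
  have S: "\<forall>\<^sub>F s in F. s \<in> S"
    by (simp add: F_def eventually_at_filter)
  have close: "\<forall>\<^sub>F s in F. \<forall>i<n. \<bar>c s i - x i\<bar> < e" if "0 < e" for e
  proof -
    have "\<forall>\<^sub>F s in F. \<bar>c s i - x i\<bar> < e" if "i < n" for i
    proof -
      have "((\<lambda>s. c s i) \<longlongrightarrow> x i) F"
        using DERIV_continuous[OF c[OF that]] by (simp add: continuous_within F_def x_def)
      from tendstoD[OF this \<open>0 < e\<close>] show ?thesis by (simp add: dist_real_def)
    qed
    then have "\<forall>\<^sub>F s in F. \<forall>i\<in>{..<n}. \<bar>c s i - x i\<bar> < e"
      by (intro eventually_ball_finite) auto
    then show ?thesis by (rule eventually_mono) auto
  qed
  obtain e where e: "0 < e"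
    "\<forall>y. (\<forall>i\<ge>n. y i = 0) \<longrightarrow> (\<forall>i<n. \<bar>y i - x i\<bar> < e) \<longrightarrow> y \<in> U"
    using openin_Euclidean_space_box[OF U xU] .
  \<comment> \<open>\<open>w s k\<close> has moved its first \<open>k\<close> coordinates from
    \<open>x\<close> to \<open>c s\<close>. Thus \<open>w s 0 = x\<close> and, as all entries from
    \<open>n\<close> on vanish, \<open>w s n = c s\<close>.\<close>
  define w where "w s k = (\<lambda>i. if i < k then c s i else x i)" for s k
  have step: "\<exists>z. (\<forall>i. \<bar>z i - x i\<bar> \<le> \<bar>c s i - x i\<bar>) \<and> (\<forall>i\<ge>n. z i = 0) \<and>
      f (w s (Suc k)) - f (w s k) = (c s k - x k) * f' k z"
    if s: "s \<in> S" "\<forall>i<n. \<bar>c s i - x i\<bar> < e" and k: "k < n" for s k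
  proof -
    have wS: "w s (Suc k) = (w s k)(k := c s k)" and wk: "w s k = (w s k)(k := x k)"
      by (auto simp: w_def fun_eq_iff less_Suc_eq)
    have in_box: "\<bar>((w s k)(k := u)) i - x i\<bar> \<le> \<bar>c s i - x i\<bar>" "n \<le> j \<Longrightarrow> ((w s k)(k := u)) j = 0"
      if "\<bar>u - x k\<bar> \<le> \<bar>c s k - x k\<bar>" for u i j
      using that k x0 c0[OF s(1)] by (auto simp: w_def)
    have in_U: "(w s k)(k := u) \<in> U" if "\<bar>u - x k\<bar> \<le> \<bar>c s k - x k\<bar>" for u
    proof (intro e(2)[rule_format])
      show "\<bar>((w s k)(k := u)) i - x i\<bar> < e" if "i < n" for i
        using in_box(1)[OF \<open>\<bar>u - x k\<bar> \<le> \<bar>c s k - x k\<bar>\<close>, of i] s(2) that by (meson le_less_trans)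
    qed (rule in_box(2)[OF that])
    have der: "((\<lambda>u. f ((w s k)(k := u))) has_real_derivative f' k ((w s k)(k := u))) (at u)"
      if "\<bar>u - x k\<bar> \<le> \<bar>c s k - x k\<bar>" for u
      using f[OF k in_U[OF that]] by simp
    obtain u where u: "\<bar>u - x k\<bar> \<le> \<bar>c s k - x k\<bar>"
        "f ((w s k)(k := c s k)) - f ((w s k)(k := x k)) = (c s k - x k) * f' k ((w s k)(k := u))"
      using MVT_between[OF der] .
    show ?thesis
    proof (intro exI conjI allI impI)
      show "f (w s (Suc k)) - f (w s k) = (c s k - x k) * f' k ((w s k)(k := u))"
        using u(2) by (simp only: wS flip: wk)
    qed (use in_box[OF u(1)] in blast)+
  qed
  \<comment> \<open>The mean value points are chosen once for each \<open>s\<close>, to be followed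
    as \<open>s\<close> tends to \<open>t\<close>: near \<open>t\<close> they are coordinatewise no
    farther from \<open>x\<close> than \<open>c s\<close>, and hence converge to
    \<open>x\<close>.\<close>
  define z where "z s k = (SOME z. (\<forall>i. \<bar>z i - x i\<bar> \<le> \<bar>c s i - x i\<bar>) \<and> (\<forall>i\<ge>n. z i = 0) \<and>
      f (w s (Suc k)) - f (w s k) = (c s k - x k) * f' k z)" for s k
  have z: "(\<forall>i. \<bar>z s k i - x i\<bar> \<le> \<bar>c s i - x i\<bar>) \<and> (\<forall>i\<ge>n. z s k i = 0) \<and>
      f (w s (Suc k)) - f (w s k) = (c s k - x k) * f' k (z s k)"
    if "s \<in> S" "\<forall>i<n. \<bar>c s i - x i\<bar> < e" "k < n" for s k
    unfolding z_def by (rule someI_ex[OF step[OF that]])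
  have lim: "((\<lambda>s. f' k (z s k)) \<longlongrightarrow> f' k x) F" if k: "k < n" for k
  proof (rule tendstoI)
    fix d :: real assume d: "0 < d"
    have "openin (top_of_set U) (U \<inter> f' k -` ball (f' k x) d)"
      using f'[OF k] by (simp add: continuous_openin_preimage_gen)
    then have "openin (Euclidean_space n) (U \<inter> f' k -` ball (f' k x) d)"
      using U by (metis Euclidean_space_eq_top_of_set openin_trans)
    moreover have "x \<in> U \<inter> f' k -` ball (f' k x) d"
      using xU d by simp
    ultimately obtain r where r: "0 < r"
      "\<forall>y. (\<forall>i\<ge>n. y i = 0) \<longrightarrow> (\<forall>i<n. \<bar>y i - x i\<bar> < r) \<longrightarrow>
          y \<in> U \<inter> f' k -` ball (f' k x) d"
      by (rule openin_Euclidean_space_box)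
    show "\<forall>\<^sub>F s in F. dist (f' k (z s k)) (f' k x) < d"
      using S close[OF e(1)] close[OF r(1)]
    proof eventually_elim
      case (elim s)
      note zs = z[OF elim(1,2) k]
      have "z s k \<in> U \<inter> f' k -` ball (f' k x) d"
      proof (intro r(2)[rule_format])
        show "\<bar>z s k i - x i\<bar> < r" if "i < n" for i
          using zs elim(3) that by (meson le_less_trans)
      qed (use zs in blast)
      then show ?case by (simp add: dist_commute)
    qed
  qed
  have quot: "((\<lambda>s. (c s i - x i) / (s - t)) \<longlongrightarrow> c' i) F" if "i < n" for i
    using c[OF that] by (simp add: has_field_derivative_iff F_def x_def)
  have "((\<lambda>s. \<Sum>k<n. f' k (z s k) * ((c s k - x k) / (s - t))) \<longlongrightarrow> (\<Sum>k<n. f' k x * c' k)) F"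
    using lim quot by (intro tendsto_sum tendsto_mult) auto
  moreover have "\<forall>\<^sub>F s in F.
      (\<Sum>k<n. f' k (z s k) * ((c s k - x k) / (s - t))) = (f (c s) - f (c t)) / (s - t)"
    using S close[OF e(1)]
  proof eventually_elim
    case (elim s)
    have "w s n = c s" "w s 0 = x"
      using c0[OF elim(1)] x0 by (auto simp: w_def fun_eq_iff)
    then have "f (c s) - f x = (\<Sum>k<n. f (w s (Suc k)) - f (w s k))"
      using sum_lessThan_telescope[of "\<lambda>k. f (w s k)" n] by simp
    also have "\<dots> = (\<Sum>k<n. f' k (z s k) * (c s k - x k))"
      using z[OF elim] by (intro sum.cong) (simp_all add: mult.commute)
    finally show ?case by (simp add: sum_divide_distrib x_def)
  qed
  ultimately show ?thesis
    unfolding has_field_derivative_iff F_def x_def by (rule Lim_transform_eventually)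
qed

text \<open>Induction on \<open>k\<close> with \<open>f\<close> arbitrary: the chain rule expresses
  a partial derivative of the composition through partial derivatives of \<open>f\<close> composed
  with \<open>g\<close>, and these are again covered by the hypothesis. Assuming \<open>f\<close>
  smooth, rather than C^k, makes the assumption stable under differentiation.\<close>

lemma Ck_on_compose:
  assumes V: "openin (Euclidean_space n) V" and U: "openin (Euclidean_space m) U" and "g ` U \<subseteq> V"
    and f: "smooth_real_on n V f" and g: "\<And>i. i < n \<Longrightarrow> smooth_real_on m U (\<lambda>x. g x i)"
  shows "Ck_on k m U (\<lambda>x. f (g x))"
  using f
proof (induction k arbitrary: f)
  have g0: "g x i = 0" if "x \<in> U" "n \<le> i" for x i
    using openin_Euclidean_space_zero[OF V] assms(3) that by blast
  have contg: "continuous_on U g"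
  proof (rule continuous_on_coordinatewise_then_product)
    fix i
    show "continuous_on U (\<lambda>x. g x i)"
    proof (cases "i < n")
      case True
      then show ?thesis
        using g[OF True] Ck_on_imp_continuous_on unfolding smooth_real_on_def by blast
    next
      case False
      then show ?thesis using g0 by (simp cong: continuous_on_cong)
    qed
  qed
  have cont: "continuous_on U (\<lambda>x. f (g x))" if "smooth_real_on n V f" for f
    using that Ck_on_imp_continuous_on assms(3) contg continuous_on_compose2
    by (metis smooth_real_on_def)
  {
    case 0
    then show ?case using cont by simp
  next
    case (Suc k)
    have "\<exists>f'. (\<forall>x\<in>V. ((\<lambda>t. f (x(i := t))) has_real_derivative f' x) (at (x i))) \<and>
        smooth_real_on n V f'" if i: "i < n" for i
    proof -
      \<comment> \<open>Each order \<open>k\<close> supplies its own partial derivative of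
        \<open>f\<close>; \<open>deriv\<close> is one function that serves all orders.\<close>
      define f' where "f' x = deriv (\<lambda>t. f (x(i := t))) (x i)" for x
      have "(\<forall>x\<in>V. ((\<lambda>t. f (x(i := t))) has_real_derivative f' x) (at (x i))) \<and> Ck_on k n V f'" for k
      proof -
        have "Ck_on (Suc k) n V f" using Suc.prems by (simp add: smooth_real_on_def del: Ck_on.simps)
        then obtain h where
          h: "\<forall>x\<in>V. ((\<lambda>t. f (x(i := t))) has_real_derivative h x) (at (x i))" "Ck_on k n V h"
          using i by auto
        then have "f' x = h x" if "x \<in> V" for x
          using that by (auto simp: f'_def intro!: DERIV_imp_deriv)
        then show ?thesis using h Ck_on_cong[OF V, of f' h] by auto
      qed
      then show ?thesis unfolding smooth_real_on_def by blast
    qed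
    then obtain f' where f':
      "\<And>i x. i < n \<Longrightarrow> x \<in> V \<Longrightarrow> ((\<lambda>t. f (x(i := t))) has_real_derivative f' i x) (at (x i))"
      "\<And>i. i < n \<Longrightarrow> smooth_real_on n V (f' i)"
      by metis
    have "\<exists>h'. (\<forall>x\<in>U. ((\<lambda>t. f (g (x(j := t)))) has_real_derivative h' x) (at (x j))) \<and>
          Ck_on k m U h'" if j: "j < m" for j
    proof -
      have "\<exists>h. (\<forall>x\<in>U. ((\<lambda>t. g (x(j := t)) i) has_real_derivative h x) (at (x j))) \<and> Ck_on k m U h"
        if "i < n" for i
      proof -
        have "Ck_on (Suc k) m U (\<lambda>x. g x i)"
          using g[OF that] by (simp add: smooth_real_on_def del: Ck_on.simps)
        then show ?thesis using j by auto
      qed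
      then obtain g' where g':
        "\<And>i x. i < n \<Longrightarrow> x \<in> U \<Longrightarrow> ((\<lambda>t. g (x(j := t)) i) has_real_derivative g' i x) (at (x j))"
        "\<And>i. i < n \<Longrightarrow> Ck_on k m U (g' i)"
        by metis
      have "((\<lambda>t. f (g (x(j := t)))) has_real_derivative (\<Sum>i<n. f' i (g x) * g' i x)) (at (x j))"
        if x: "x \<in> U" for x
      proof -
        \<comment> \<open>\<open>has_real_derivative_chain_coords\<close> wants the entries of the
          curve from \<open>n\<close> on to vanish throughout the parameter set. This is known only
          while \<open>x(j := t)\<close> remains in \<open>U\<close>, hence the restriction to an
          open \<open>A\<close> around \<open>x j\<close>.\<close>
        define S where "S = {t. x(j := t) \<in> U}"
        obtain A where A: "open A" "x j \<in> A" "A \<subseteq> S"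
          using eventually_upd_in_openin[OF U x j] by (auto simp: eventually_nhds S_def)
        have "((\<lambda>t. f (g (x(j := t)))) has_real_derivative
            (\<Sum>i<n. f' i (g (x(j := x j))) * g' i x)) (at (x j) within A)"
        proof (rule has_real_derivative_chain_coords[OF V f'(1)])
          show "continuous_on V (f' i)" if "i < n" for i
            using f'(2)[OF that] Ck_on_imp_continuous_on unfolding smooth_real_on_def by blast
          show "((\<lambda>t. g (x(j := t)) i) has_real_derivative g' i x) (at (x j) within A)" if "i < n" for i
            using g'(1)[OF that x] by (rule has_field_derivative_at_within)
        qed (use A x assms(3) g0 in \<open>auto simp: S_def\<close>)
        then show ?thesis
          unfolding at_within_open[OF A(2,1)] fun_upd_triv .
      qed
      moreover have "Ck_on k m U (\<lambda>x. \<Sum>i<n. f' i (g x) * g' i x)"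
        using Suc.IH f'(2) g'(2) by (intro Ck_on_sum Ck_on_mult) auto
      ultimately show ?thesis by (intro exI conjI ballI) assumption+
    qed
    then show ?case using cont[OF Suc.prems] by simp
  }
qed

lemma smooth_real_on_compose:
  assumes "openin (Euclidean_space n) V" "openin (Euclidean_space m) U" "g ` U \<subseteq> V"
    "smooth_real_on n V f" "\<And>i. i < n \<Longrightarrow> smooth_real_on m U (\<lambda>x. g x i)"
  shows "smooth_real_on m U (\<lambda>x. f (g x))"
  unfolding smooth_real_on_def using Ck_on_compose[OF assms] by blast

lemma smooth_real_on_coord: "smooth_real_on n U (\<lambda>x. x j)"
  by (simp add: smooth_real_on_def Ck_on_coord)

lemma smooth_real_on_add:
  "smooth_real_on n U f \<Longrightarrow> smooth_real_on n U g \<Longrightarrow> smooth_real_on n U (\<lambda>x. f x + g x)"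
  by (simp add: smooth_real_on_def Ck_on_add)

lemma smooth_real_on_diff:
  assumes "smooth_real_on n U f" "smooth_real_on n U g"
  shows "smooth_real_on n U (\<lambda>x. f x - g x)"
proof -
  have "smooth_real_on n U (\<lambda>x. f x + (-1) * g x)"
    unfolding smooth_real_on_def
  proof
    fix k show "Ck_on k n U (\<lambda>x. f x + (-1) * g x)"
      using assms unfolding smooth_real_on_def by (intro Ck_on_add Ck_on_mult Ck_on_const) auto
  qed
  then show ?thesis by simp
qed

section \<open>Smooth functions on manifolds\<close>

lemma is_chartD:
  assumes "is_chart n S (U, \<phi>)"
  shows "openin (top_of_set S) U" "openin (Euclidean_space n) (\<phi> ` U)" "inj_on \<phi> U"
    "continuous_on U \<phi>" "continuous_on (\<phi> ` U) (inv_into U \<phi>)"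
proof -
  obtain \<psi> where \<psi>: "homeomorphism U (\<phi> ` U) \<phi> \<psi>"
    using assms by (auto simp: is_chart_def)
  show inj: "inj_on \<phi> U"
    using \<psi> by (metis homeomorphism_apply1 inj_onI)
  have "inv_into U \<phi> y = \<psi> y" if "y \<in> \<phi> ` U" for y
    using that inj homeomorphism_apply1[OF \<psi>] by auto
  then show "continuous_on (\<phi> ` U) (inv_into U \<phi>)"
    using homeomorphism_cont2[OF \<psi>] by (simp cong: continuous_on_cong)
  show "continuous_on U \<phi>"
    using homeomorphism_cont1[OF \<psi>] .
qed (use assms in \<open>auto simp: is_chart_def\<close>)

lemma is_chartI:
  assumes "openin (top_of_set S) U" "openin (Euclidean_space n) (\<phi> ` U)"
    "continuous_on U \<phi>" "continuous_on (\<phi> ` U) \<psi>" "\<And>x. x \<in> U \<Longrightarrow> \<psi> (\<phi> x) = x"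
  shows "is_chart n S (U, \<phi>)"
  using assms by (auto simp: is_chart_def homeomorphism_def image_image intro!: exI[of _ \<psi>])

lemma is_chart_open_image:
  assumes "is_chart n S (U, \<phi>)" "openin (top_of_set S) A" "A \<subseteq> U"
  shows "openin (Euclidean_space n) (\<phi> ` A)"
proof -
  obtain \<psi> where \<psi>: "homeomorphism U (\<phi> ` U) \<phi> \<psi>"
    using assms by (auto simp: is_chart_def)
  have "openin (top_of_set U) A"
    using openin_subset_trans[OF assms(2,3) openin_imp_subset[OF is_chartD(1)[OF assms(1)]]] .
  then have "openin (top_of_set (\<phi> ` U)) (\<phi> ` A)"
    using homeomorphism_imp_open_map[OF \<psi>] by blast
  then show ?thesis
    using is_chartD(2)[OF assms(1)] unfolding Euclidean_space_eq_top_of_set by (rule openin_trans)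
qed

lemma openin_preimage:
  assumes "openin (top_of_set S) W" "continuous_on W f" "f ` W \<subseteq> T" "openin (top_of_set T) V"
  shows "openin (top_of_set S) (W \<inter> f -` V)"
proof -
  have "openin (top_of_set W) (W \<inter> f -` V)"
    using assms(2-4) by (intro continuous_openin_preimage) auto
  then show ?thesis using assms(1) by (rule openin_trans)
qed

text \<open>The covering by charts alone. This is the property established for the product and for
  the fibre product, and the one on which arguments inside a chart rely.\<close>

definition charted :: "'a::topological_space manifold \<Rightarrow> bool" where
  "charted M \<longleftrightarrow> (\<forall>c\<in>atlas M. is_chart (mdim M) (pts M) c) \<and> (\<Union>c\<in>atlas M. fst c) = pts M"

lemma smooth_manifold_imp_charted: "smooth_manifold M \<Longrightarrow> charted M"
  by (simp add: smooth_manifold_def charted_def)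

lemma chartedD: "charted M \<Longrightarrow> (U, \<phi>) \<in> atlas M \<Longrightarrow> is_chart (mdim M) (pts M) (U, \<phi>)"
  by (auto simp: charted_def)

lemma charted_coverE:
  assumes "charted M" "x \<in> pts M"
  obtains U \<phi> where "(U, \<phi>) \<in> atlas M" "x \<in> U"
  using assms unfolding charted_def by fastforce

text \<open>A local version of \<open>smooth_fun\<close>, so that chart coordinates, meaningful only
  on the chart domain, can be handled like smooth functions.\<close>

definition smooth_fun_on :: "'a::topological_space manifold \<Rightarrow> 'a set \<Rightarrow> ('a \<Rightarrow> real) \<Rightarrow> bool" where
  "smooth_fun_on M W h \<longleftrightarrow>
     (\<forall>(U, \<phi>)\<in>atlas M. smooth_real_on (mdim M) (\<phi> ` (U \<inter> W)) (\<lambda>y. h (inv_into U \<phi> y)))"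

lemma smooth_fun_onD:
  "smooth_fun_on M W h \<Longrightarrow> (U, \<phi>) \<in> atlas M \<Longrightarrow>
    smooth_real_on (mdim M) (\<phi> ` (U \<inter> W)) (\<lambda>y. h (inv_into U \<phi> y))"
  by (auto simp: smooth_fun_on_def)

lemma smooth_fun_on_subset:
  assumes "smooth_fun_on M W h" "V \<subseteq> W"
  shows "smooth_fun_on M V h"
  unfolding smooth_fun_on_def
proof clarify
  fix U \<phi> assume "(U, \<phi>) \<in> atlas M"
  from smooth_fun_onD[OF assms(1) this]
  show "smooth_real_on (mdim M) (\<phi> ` (U \<inter> V)) (\<lambda>y. h (inv_into U \<phi> y))"
    by (rule smooth_real_on_mono) (use assms(2) in auto)
qed

lemma smooth_fun_on_diff:
  "smooth_fun_on M W f \<Longrightarrow> smooth_fun_on M W g \<Longrightarrow> smooth_fun_on M W (\<lambda>x. f x - g x)"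
  unfolding smooth_fun_on_def by (auto intro!: smooth_real_on_diff)

lemma smooth_fun_eq_smooth_fun_on:
  assumes "charted M"
  shows "f \<in> smooth_fun M \<longleftrightarrow> smooth_fun_on M (pts M) f"
proof -
  have *: "U \<inter> pts M = U" if "(U, \<phi>) \<in> atlas M" for U \<phi>
    using is_chartD(1)[OF chartedD[OF assms that]] openin_imp_subset by blast
  show ?thesis
    unfolding smooth_fun_def smooth_fun_on_def mem_Collect_eq
  proof (intro ball_cong refl, clarify)
    fix U \<phi> assume "(U, \<phi>) \<in> atlas M"
    from *[OF this]
    show "smooth_real_on (mdim M) (\<phi> ` U) (\<lambda>y. f (inv_into U \<phi> y)) \<longleftrightarrow>
        smooth_real_on (mdim M) (\<phi> ` (U \<inter> pts M)) (\<lambda>y. f (inv_into U \<phi> y))"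
      by simp
  qed
qed

lemma smooth_fun_on_chart_coord:
  assumes "smooth_manifold M" "(U, \<phi>) \<in> atlas M" "i < mdim M"
  shows "smooth_fun_on M U (\<lambda>x. \<phi> x i)"
  unfolding smooth_fun_on_def
proof clarify
  fix V \<psi> assume "(V, \<psi>) \<in> atlas M"
  then have "smooth_transition (mdim M) (V, \<psi>) (U, \<phi>)"
    using assms unfolding smooth_manifold_def by blast
  then show "smooth_real_on (mdim M) (\<psi> ` (V \<inter> U)) (\<lambda>y. \<phi> (inv_into V \<psi> y) i)"
    using assms(3) by (simp add: smooth_transition_def)
qed

lemma smooth_fun_on_map_coord:
  assumes "smooth_map_on M N W f" "(V, \<psi>) \<in> atlas N" "j < mdim N"
  shows "smooth_fun_on M (W \<inter> f -` V) (\<lambda>x. \<psi> (f x) j)"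
  unfolding smooth_fun_on_def
proof clarify
  fix U \<phi> assume "(U, \<phi>) \<in> atlas M"
  then have "smooth_real_on (mdim M) (\<phi> ` (U \<inter> W \<inter> f -` V)) (\<lambda>y. \<psi> (f (inv_into U \<phi> y)) j)"
    using assms unfolding smooth_map_on_def by blast
  then show "smooth_real_on (mdim M) (\<phi> ` (U \<inter> (W \<inter> f -` V))) (\<lambda>y. \<psi> (f (inv_into U \<phi> y)) j)"
    by (simp add: Int_assoc)
qed

text \<open>Insert \<open>inv_into V \<psi> \<circ> \<psi>\<close> between \<open>h\<close> and
  \<open>f\<close>: as \<open>f\<close> maps \<open>A\<close> into the domain of a single chart, the
  coordinate expression of \<open>h \<circ> f\<close> is a composition of two smooth coordinate
  expressions.\<close>

lemma smooth_real_on_through_chart: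
  assumes c: "is_chart m S (U, \<phi>)" and d: "is_chart n T (V, \<psi>)"
    and A: "openin (top_of_set S) A" "A \<subseteq> U" and D: "openin (top_of_set T) D" "D \<subseteq> V"
    and f: "f ` A \<subseteq> D" "\<And>i. i < n \<Longrightarrow> smooth_real_on m (\<phi> ` A) (\<lambda>y. \<psi> (f (inv_into U \<phi> y)) i)"
    and h: "smooth_real_on n (\<psi> ` D) (\<lambda>z. h (inv_into V \<psi> z))"
  shows "smooth_real_on m (\<phi> ` A) (\<lambda>y. h (f (inv_into U \<phi> y)))"
proof -
  have inv: "inv_into U \<phi> (\<phi> x) = x" if "x \<in> A" for x
    using that A is_chartD(3)[OF c] by auto
  have smooth: "smooth_real_on m (\<phi> ` A) (\<lambda>y. h (inv_into V \<psi> (\<psi> (f (inv_into U \<phi> y)))))"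
  proof (rule smooth_real_on_compose[where g = "\<lambda>y. \<psi> (f (inv_into U \<phi> y))"])
    show "openin (Euclidean_space n) (\<psi> ` D)" "openin (Euclidean_space m) (\<phi> ` A)"
      using is_chart_open_image c d A D by blast+
    show "(\<lambda>y. \<psi> (f (inv_into U \<phi> y))) ` \<phi> ` A \<subseteq> \<psi> ` D"
      using inv f(1) by auto
  qed (use f h in auto)
  have eq: "inv_into V \<psi> (\<psi> (f (inv_into U \<phi> y))) = f (inv_into U \<phi> y)" if "y \<in> \<phi> ` A" for y
  proof -
    obtain x where "x \<in> A" "y = \<phi> x" using \<open>y \<in> \<phi> ` A\<close> by blast
    then show ?thesis
      using inv[of x] f(1) D(2) inv_into_f_f[OF is_chartD(3)[OF d], of "f x"] by (simp add: image_subset_iff subset_iff)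
  qed
  show ?thesis
    by (rule smooth_real_on_eq[OF smooth is_chart_open_image[OF c A]]) (simp only: eq)
qed

lemma smooth_real_on_chart_locally:
  assumes "is_chart n S (U, \<phi>)" "A \<subseteq> U"
    "\<And>x. x \<in> A \<Longrightarrow> \<exists>B. openin (top_of_set S) B \<and> x \<in> B \<and> B \<subseteq> A \<and> smooth_real_on n (\<phi> ` B) F"
  shows "smooth_real_on n (\<phi> ` A) F"
proof (rule smooth_real_on_locally)
  fix y assume "y \<in> \<phi> ` A"
  then obtain x B where "y = \<phi> x" "openin (top_of_set S) B" "x \<in> B" "B \<subseteq> A" "smooth_real_on n (\<phi> ` B) F"
    using assms(3) by blast
  then show "\<exists>V. openin (Euclidean_space n) V \<and> y \<in> V \<and> V \<subseteq> \<phi> ` A \<and> smooth_real_on n V F"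
    using is_chart_open_image[OF assms(1)] assms(2) by (intro exI[of _ "\<phi> ` B"]) auto
qed

text \<open>The image of a chart domain under \<open>f\<close> may meet many charts of
  \<open>N\<close>, so each point is treated in the part of \<open>U\<close> that \<open>f\<close>
  sends into one of them.\<close>

lemma smooth_fun_on_compose:
  assumes M: "charted M" and N: "charted N" and f: "smooth_map_on M N W f"
    and D: "openin (top_of_set (pts N)) D" and h: "smooth_fun_on N D h"
  shows "smooth_fun_on M (W \<inter> f -` D) (\<lambda>x. h (f x))"
  unfolding smooth_fun_on_def
proof clarify
  fix U \<phi> assume U: "(U, \<phi>) \<in> atlas M"
  note c = chartedD[OF M U]
  have W: "openin (top_of_set (pts M)) W" "continuous_on W f" "f ` W \<subseteq> pts N"
    using f by (auto simp: smooth_map_on_def)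
  show "smooth_real_on (mdim M) (\<phi> ` (U \<inter> (W \<inter> f -` D))) (\<lambda>y. h (f (inv_into U \<phi> y)))"
  proof (rule smooth_real_on_chart_locally[OF c])
    fix x assume x: "x \<in> U \<inter> (W \<inter> f -` D)"
    then obtain V \<psi> where V: "(V, \<psi>) \<in> atlas N" "f x \<in> V"
      using charted_coverE[OF N] W(3) by blast
    note d = chartedD[OF N V(1)]
    define B where "B = U \<inter> (W \<inter> f -` (V \<inter> D))"
    have VD: "openin (top_of_set (pts N)) (V \<inter> D)"
      using is_chartD(1)[OF d] D by (rule openin_Int)
    have B: "openin (top_of_set (pts M)) B"
      unfolding B_def using is_chartD(1)[OF c] openin_preimage[OF W VD] by (rule openin_Int)
    have "smooth_real_on (mdim M) (\<phi> ` B) (\<lambda>y. h (f (inv_into U \<phi> y)))"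
    proof (rule smooth_real_on_through_chart[where f = f and h = h, OF c d B _ VD])
      show "smooth_real_on (mdim M) (\<phi> ` B) (\<lambda>y. \<psi> (f (inv_into U \<phi> y)) i)" if "i < mdim N" for i
        using smooth_fun_onD[OF smooth_fun_on_map_coord[OF f V(1) that] U]
        by (rule smooth_real_on_mono) (auto simp: B_def)
      show "smooth_real_on (mdim N) (\<psi> ` (V \<inter> D)) (\<lambda>z. h (inv_into V \<psi> z))"
        by (rule smooth_fun_onD[OF h V(1)])
    qed (auto simp: B_def)
    then show "\<exists>B. openin (top_of_set (pts M)) B \<and> x \<in> B \<and> B \<subseteq> U \<inter> (W \<inter> f -` D) \<and>
        smooth_real_on (mdim M) (\<phi> ` B) (\<lambda>y. h (f (inv_into U \<phi> y)))"
      using B x V(2) by (intro exI[of _ B]) (auto simp: B_def)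
  qed auto
qed

text \<open>Slice charts lie in the maximal atlas but need not lie in the atlas, whereas
  \<open>smooth_fun_on\<close> tests atlas charts. The change of charts is
  \<open>smooth_real_on_through_chart\<close> with \<open>f = id\<close>.\<close>

lemma smooth_fun_on_maximal_atlas:
  assumes M: "charted M" and c: "(U, \<phi>) \<in> maximal_atlas M"
    and D: "openin (top_of_set (pts M)) D" and h: "smooth_fun_on M D h"
  shows "smooth_real_on (mdim M) (\<phi> ` (U \<inter> D)) (\<lambda>y. h (inv_into U \<phi> y))"
proof -
  have U: "is_chart (mdim M) (pts M) (U, \<phi>)"
    using c by (simp add: maximal_atlas_def)
  show ?thesis
  proof (rule smooth_real_on_chart_locally[OF U])
    fix x assume x: "x \<in> U \<inter> D"
    then obtain V \<psi> where V: "(V, \<psi>) \<in> atlas M" "x \<in> V"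
      using charted_coverE[OF M] D openin_imp_subset by (metis IntD2 subsetD)
    note d = chartedD[OF M V(1)]
    have B: "openin (top_of_set (pts M)) (U \<inter> V \<inter> D)" "openin (top_of_set (pts M)) (V \<inter> D)"
      using is_chartD(1)[OF U] is_chartD(1)[OF d] D by (auto intro: openin_Int)
    have "smooth_real_on (mdim M) (\<phi> ` (U \<inter> V \<inter> D)) (\<lambda>y. h (id (inv_into U \<phi> y)))"
    proof (rule smooth_real_on_through_chart[where f = id and h = h, OF U d B(1) _ B(2)])
      fix i assume "i < mdim M"
      then have "smooth_real_on (mdim M) (\<phi> ` (U \<inter> V)) (\<lambda>y. \<psi> (inv_into U \<phi> y) i)"
        using c V(1) by (auto simp: maximal_atlas_def smooth_transition_def)
      then show "smooth_real_on (mdim M) (\<phi> ` (U \<inter> V \<inter> D)) (\<lambda>y. \<psi> (id (inv_into U \<phi> y)) i)"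
        unfolding id_apply by (rule smooth_real_on_mono) auto
    next
      show "smooth_real_on (mdim M) (\<psi> ` (V \<inter> D)) (\<lambda>z. h (inv_into V \<psi> z))"
        by (rule smooth_fun_onD[OF h V(1)])
    qed auto
    then show "\<exists>B. openin (top_of_set (pts M)) B \<and> x \<in> B \<and> B \<subseteq> U \<inter> D \<and>
        smooth_real_on (mdim M) (\<phi> ` B) (\<lambda>y. h (inv_into U \<phi> y))"
      using B x V(2) by (intro exI[of _ "U \<inter> V \<inter> D"]) auto
  qed auto
qed


section \<open>Curves of class \<open>C\<^sup>1\<close>\<close>

text \<open>The derivative is demanded at the points of \<open>T\<close> but taken within all of
  \<open>{a..b}\<close>, as in \<open>C1_curve_on\<close>, where \<open>T\<close> is the set of
  times that the curve spends in a chart.\<close>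

definition C1_fun_on :: "real \<Rightarrow> real \<Rightarrow> real set \<Rightarrow> (real \<Rightarrow> real) \<Rightarrow> bool" where
  "C1_fun_on a b T u \<longleftrightarrow>
     (\<exists>d. continuous_on T d \<and> (\<forall>t\<in>T. (u has_real_derivative d t) (at t within {a..b})))"

lemma C1_curve_on_alt:
  "C1_curve_on M \<gamma> a b \<longleftrightarrow>
     continuous_on {a..b} \<gamma> \<and> \<gamma> ` {a..b} \<subseteq> pts M \<and>
     (\<forall>(U, \<phi>)\<in>atlas M. \<forall>i<mdim M. C1_fun_on a b ({a..b} \<inter> \<gamma> -` U) (\<lambda>s. \<phi> (\<gamma> s) i))"
  by (simp add: C1_curve_on_def C1_fun_on_def)

lemma C1_fun_on_subset: "C1_fun_on a b T u \<Longrightarrow> S \<subseteq> T \<Longrightarrow> C1_fun_on a b S u"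
  unfolding C1_fun_on_def by (meson continuous_on_subset subsetD)

lemma C1_fun_on_cong:
  assumes A: "openin (top_of_set {a..b}) A" and eq: "\<And>t. t \<in> A \<Longrightarrow> u t = v t" and u: "C1_fun_on a b A u"
  shows "C1_fun_on a b A v"
proof -
  obtain X where X: "open X" "A = {a..b} \<inter> X"
    using A by (auto simp: openin_open)
  obtain d where d: "continuous_on A d" "\<forall>t\<in>A. (u has_real_derivative d t) (at t within {a..b})"
    using u by (auto simp: C1_fun_on_def)
  have "(v has_real_derivative d t) (at t within {a..b})" if t: "t \<in> A" for t
  proof -
    have at: "at t within A = at t within {a..b}"
      using X t by (intro at_within_nhd[of t X]) auto
    have "(u has_real_derivative d t) (at t within A)"
      using d(2) t by (simp add: at)
    from has_field_derivative_transform_within[OF this zero_less_one t eq]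
    show ?thesis by (simp add: at)
  qed
  then show ?thesis using d(1) unfolding C1_fun_on_def by blast
qed

lemma C1_fun_on_locally:
  assumes "a < b" "T \<subseteq> {a..b}"
    and loc: "\<And>t. t \<in> T \<Longrightarrow>
      \<exists>A. openin (top_of_set {a..b}) A \<and> t \<in> A \<and> A \<subseteq> T \<and> C1_fun_on a b A u"
  shows "C1_fun_on a b T u"
proof -
  \<comment> \<open>Since \<open>a < b\<close>, derivatives within \<open>{a..b}\<close> are unique,
    so this single function agrees with every locally given derivative.\<close>
  define d where "d t = vector_derivative u (at t within {a..b})" for t
  have *: "\<exists>A. openin (top_of_set T) A \<and> t \<in> A \<and> continuous_on A d \<and>
      (u has_real_derivative d t) (at t within {a..b})" if "t \<in> T" for t
  proof -
    obtain A e where A: "openin (top_of_set {a..b}) A" "t \<in> A" "A \<subseteq> T" "continuous_on A e"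
      "\<forall>t\<in>A. (u has_real_derivative e t) (at t within {a..b})"
      using loc[OF \<open>t \<in> T\<close>] unfolding C1_fun_on_def by blast
    have de: "d s = e s" if "s \<in> A" for s
      unfolding d_def using A(3,5) that assms
      by (intro vector_derivative_within_closed_interval)
        (auto simp flip: has_real_derivative_iff_has_vector_derivative)
    then have "continuous_on A d"
      using A(4) by (simp cong: continuous_on_cong)
    moreover have "openin (top_of_set T) A"
      using A(1,3) assms(2) openin_subset_trans by blast
    ultimately show ?thesis
      using A(2,5) de[OF A(2)] by auto
  qed
  then have "continuous_on T d"
    by (intro continuous_on_locally_openin) blast
  then show ?thesis
    unfolding C1_fun_on_def using * by blast
qed

text \<open>The chain rule yields more than differentiability: its formula is a sum of products of
  functions continuous on \<open>T\<close>, which is the continuity required of the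
  derivative.\<close>

lemma C1_fun_on_through_chart:
  assumes c: "is_chart n S (V, \<psi>)" and D: "openin (top_of_set S) D" "D \<subseteq> V"
    and h: "smooth_real_on n (\<psi> ` D) (\<lambda>z. h (inv_into V \<psi> z))"
    and T: "openin (top_of_set {a..b}) T" "continuous_on T \<gamma>" "\<gamma> ` T \<subseteq> D"
    and \<gamma>: "\<And>i. i < n \<Longrightarrow> C1_fun_on a b T (\<lambda>s. \<psi> (\<gamma> s) i)"
  shows "C1_fun_on a b T (\<lambda>s. h (\<gamma> s))"
proof -
  define F where "F z = h (inv_into V \<psi> z)" for z
  have D': "openin (Euclidean_space n) (\<psi> ` D)"
    by (rule is_chart_open_image[OF c D])
  have "\<exists>F'. (\<forall>x\<in>\<psi> ` D. ((\<lambda>t. F (x(i := t))) has_real_derivative F' x) (at (x i))) \<and>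
      continuous_on (\<psi> ` D) F'" if "i < n" for i
  proof -
    have "Ck_on (Suc 0) n (\<psi> ` D) F"
      using h unfolding smooth_real_on_def F_def by blast
    then show ?thesis using that by (auto elim: Ck_on_SucE)
  qed
  then obtain F' where F':
    "\<And>i x. i < n \<Longrightarrow> x \<in> \<psi> ` D \<Longrightarrow> ((\<lambda>t. F (x(i := t))) has_real_derivative F' i x) (at (x i))"
    "\<And>i. i < n \<Longrightarrow> continuous_on (\<psi> ` D) (F' i)"
    by metis
  obtain c' where c':
    "\<And>i. i < n \<Longrightarrow> continuous_on T (c' i)"
    "\<And>i t. i < n \<Longrightarrow> t \<in> T \<Longrightarrow> ((\<lambda>s. \<psi> (\<gamma> s) i) has_real_derivative c' i t) (at t within {a..b})"
    using \<gamma> unfolding C1_fun_on_def by metis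
  have cont: "continuous_on T (\<lambda>t. \<psi> (\<gamma> t))"
    using T(2,3) D(2) is_chartD(4)[OF c] by (intro continuous_on_compose2[of V \<psi> T \<gamma>]) auto
  have "continuous_on T (\<lambda>t. \<Sum>i<n. F' i (\<psi> (\<gamma> t)) * c' i t)"
    using T(3) by (intro continuous_on_sum continuous_on_mult c'(1) continuous_on_compose2[OF F'(2) cont])
      auto
  moreover have "((\<lambda>s. h (\<gamma> s)) has_real_derivative (\<Sum>i<n. F' i (\<psi> (\<gamma> t)) * c' i t)) (at t within {a..b})"
    if t: "t \<in> T" for t
  proof -
    obtain A where A: "open A" "T = {a..b} \<inter> A"
      using T(1) by (auto simp: openin_open)
    have at: "at t within T = at t within {a..b}"
      using A t by (intro at_within_nhd[of t A]) auto
    have der: "((\<lambda>s. F (\<psi> (\<gamma> s))) has_real_derivative (\<Sum>i<n. F' i (\<psi> (\<gamma> t)) * c' i t)) (at t within T)"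
    proof (rule has_real_derivative_chain_coords[OF D' F'])
      show "((\<lambda>s. \<psi> (\<gamma> s) i) has_real_derivative c' i t) (at t within T)" if "i < n" for i
        unfolding at by (rule c'(2)[OF that t])
      show "\<psi> (\<gamma> s) i = 0" if "s \<in> T" "n \<le> i" for s i
        using openin_Euclidean_space_zero[OF D' _ that(2)] that(1) T(3) by blast
    qed (use t T(3) in auto)
    have eq: "F (\<psi> (\<gamma> s)) = h (\<gamma> s)" if "s \<in> T" for s
      unfolding F_def using that T(3) D(2) inv_into_f_f[OF is_chartD(3)[OF c]] by (metis imageI subsetD)
    have "((\<lambda>s. h (\<gamma> s)) has_real_derivative (\<Sum>i<n. F' i (\<psi> (\<gamma> t)) * c' i t)) (at t within T)"
      by (rule has_field_derivative_transform_within[OF der zero_less_one t eq])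
    then show ?thesis by (simp add: at)
  qed
  ultimately show ?thesis unfolding C1_fun_on_def by blast
qed

text \<open>\<open>C1_curve_on\<close> speaks of atlas coordinates; with this lemma any locally
  smooth function may be evaluated along the curve. Curves are moved to another manifold by applying
  it to coordinates of that manifold, pulled back to \<open>M\<close>.\<close>

lemma C1_curve_compose:
  assumes M: "charted M" and "a < b" and \<gamma>: "C1_curve_on M \<gamma> a b"
    and D: "openin (top_of_set (pts M)) D" and h: "smooth_fun_on M D h"
  shows "C1_fun_on a b ({a..b} \<inter> \<gamma> -` D) (\<lambda>s. h (\<gamma> s))"
proof (rule C1_fun_on_locally[OF \<open>a < b\<close>])
  have cont: "continuous_on {a..b} \<gamma>" and im: "\<gamma> ` {a..b} \<subseteq> pts M"
    using \<gamma> by (auto simp: C1_curve_on_def)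
  fix t assume t: "t \<in> {a..b} \<inter> \<gamma> -` D"
  then obtain V \<psi> where V: "(V, \<psi>) \<in> atlas M" "\<gamma> t \<in> V"
    using charted_coverE[OF M] im by blast
  note d = chartedD[OF M V(1)]
  have VD: "openin (top_of_set (pts M)) (V \<inter> D)"
    using is_chartD(1)[OF d] D by (rule openin_Int)
  define A where "A = {a..b} \<inter> \<gamma> -` (V \<inter> D)"
  have A: "openin (top_of_set {a..b}) A"
    unfolding A_def by (rule openin_preimage[OF _ cont im VD]) simp
  have "C1_fun_on a b A (\<lambda>s. h (\<gamma> s))"
  proof (rule C1_fun_on_through_chart[OF d VD _ smooth_fun_onD[OF h V(1)] A])
    show "C1_fun_on a b A (\<lambda>s. \<psi> (\<gamma> s) i)" if "i < mdim M" for i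
    proof (rule C1_fun_on_subset)
      show "C1_fun_on a b ({a..b} \<inter> \<gamma> -` V) (\<lambda>s. \<psi> (\<gamma> s) i)"
        using \<gamma> V(1) that unfolding C1_curve_on_alt by blast
    qed (auto simp: A_def)
    show "continuous_on A \<gamma>"
      using cont by (rule continuous_on_subset) (auto simp: A_def)
  qed (auto simp: A_def)
  then show "\<exists>A. openin (top_of_set {a..b}) A \<and> t \<in> A \<and> A \<subseteq> {a..b} \<inter> \<gamma> -` D \<and>
      C1_fun_on a b A (\<lambda>s. h (\<gamma> s))"
    using A t V(2) by (intro exI[of _ A]) (auto simp: A_def)
qed auto

section \<open>Lifting homotopies to covering spaces\<close>

lemma covering_space_evenly_coveredE:
  assumes "covering_space C p S" "y \<in> S"
  obtains W \<V> where "y \<in> W" "openin (top_of_set S) W" "\<Union>\<V> = C \<inter> p -` W"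
    "\<And>u. u \<in> \<V> \<Longrightarrow> openin (top_of_set C) u" "pairwise disjnt \<V>"
    "\<And>u. u \<in> \<V> \<Longrightarrow> \<exists>q. homeomorphism u W p q"
proof -
  have "\<exists>W. y \<in> W \<and> openin (top_of_set S) W \<and> (\<exists>\<V>. \<Union>\<V> = C \<inter> p -` W \<and>
      (\<forall>u\<in>\<V>. openin (top_of_set C) u) \<and> pairwise disjnt \<V> \<and> (\<forall>u\<in>\<V>. \<exists>q. homeomorphism u W p q))"
    using assms unfolding covering_space_def by blast
  then show thesis using that by (elim exE conjE) simp
qed

text \<open>
  The library's \<open>covering_space_lift_unique\<close> and \<open>covering_space_lift_homotopy\<close> are restricted to
  subsets of normed spaces.
\<close>

lemma covering_space_lift_unique_topological:
  fixes p :: "'a::topological_space \<Rightarrow> 'b::topological_space"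
  assumes cov: "covering_space C p S" and "connected T"
    and g: "continuous_on T g" "g ` T \<subseteq> C" and h: "continuous_on T h" "h ` T \<subseteq> C"
    and eq: "\<And>x. x \<in> T \<Longrightarrow> p (g x) = p (h x)" and a: "a \<in> T" "g a = h a" and "x \<in> T"
  shows "g x = h x"
proof -
  have loc: "\<exists>A. openin (top_of_set T) A \<and> x \<in> A \<and> (\<forall>y\<in>A. g y = h y \<longleftrightarrow> g x = h x)"
    if x: "x \<in> T" for x
  proof -
    have "p (g x) \<in> S"
      using x g(2) covering_space_imp_surjective[OF cov] by blast
    then obtain W \<V> where W: "p (g x) \<in> W" "\<Union>\<V> = C \<inter> p -` W"
      "\<And>u. u \<in> \<V> \<Longrightarrow> openin (top_of_set C) u" "pairwise disjnt \<V>"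
      "\<And>u. u \<in> \<V> \<Longrightarrow> \<exists>q. homeomorphism u W p q"
      by (rule covering_space_evenly_coveredE[OF cov]) blast
    have "g x \<in> \<Union>\<V>" "h x \<in> \<Union>\<V>"
      using W(1,2) x g(2) h(2) eq[OF x] by auto
    then obtain u v where u: "u \<in> \<V>" "g x \<in> u" and v: "v \<in> \<V>" "h x \<in> v" by blast
    have inj: "c = d" if "c \<in> u" "d \<in> u" "p c = p d" for c d
      using W(5)[OF u(1)] that by (metis homeomorphism_apply1)
    have uv: "disjnt u v" if "u \<noteq> v"
      using W(4) u(1) v(1) that by (simp add: pairwise_def)
    \<comment> \<open>On \<open>A\<close> the map \<open>g\<close> stays in the sheet
      \<open>u\<close> and \<open>h\<close> in the sheet \<open>v\<close>. Distinct sheets are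
      disjoint and \<open>p\<close> is injective on each, so agreement at a point of
      \<open>A\<close> is decided by whether \<open>u = v\<close>. The set of agreement is therefore
      open and closed.\<close>
    define A where "A = (T \<inter> g -` u) \<inter> (T \<inter> h -` v)"
    have "openin (top_of_set T) A"
      unfolding A_def using W(3) u(1) v(1) g h
      by (intro openin_Int continuous_openin_preimage[of T _ C]) auto
    moreover have "x \<in> A" using x u v by (simp add: A_def)
    moreover have "g y = h y \<longleftrightarrow> u = v" if "y \<in> A" for y
    proof
      assume "g y = h y"
      then show "u = v" using that uv by (auto simp: A_def disjnt_iff)
    next
      assume "u = v"
      then show "g y = h y" using that inj eq by (auto simp: A_def)
    qed
    ultimately show ?thesis by blast
  qed
  define E where "E = {x \<in> T. g x = h x}"
  have "openin (top_of_set T) E"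
  proof (subst openin_subopen, intro ballI)
    fix x assume x: "x \<in> E"
    then obtain A where A: "openin (top_of_set T) A" "x \<in> A" "\<forall>y\<in>A. g y = h y"
      using loc[of x] by (auto simp: E_def)
    then show "\<exists>A. openin (top_of_set T) A \<and> x \<in> A \<and> A \<subseteq> E"
      using openin_imp_subset[OF A(1)] by (intro exI[of _ A]) (auto simp: E_def)
  qed
  moreover have "openin (top_of_set T) (T - E)"
  proof (subst openin_subopen, intro ballI)
    fix x assume x: "x \<in> T - E"
    then obtain A where A: "openin (top_of_set T) A" "x \<in> A" "\<forall>y\<in>A. g y \<noteq> h y"
      using loc[of x] by (auto simp: E_def)
    then show "\<exists>A. openin (top_of_set T) A \<and> x \<in> A \<and> A \<subseteq> T - E"
      using openin_imp_subset[OF A(1)] by (intro exI[of _ A]) (auto simp: E_def)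
  qed
  then have "closedin (top_of_set T) E"
    by (auto simp: closedin_def E_def)
  ultimately have "E = {} \<or> E = T"
    using \<open>connected T\<close> by (auto simp: connected_clopen)
  then show ?thesis using a \<open>x \<in> T\<close> by (auto simp: E_def)
qed

text \<open>A lift is demanded through every \<open>c\<close> over every point of \<open>R\<close>.
  This freedom permits gluing: a lift on one piece is continued from the value it takes in the
  overlap.\<close>

definition liftable_on ::
  "'b::topological_space set \<Rightarrow> ('b \<Rightarrow> 'c) \<Rightarrow> ('a::topological_space \<Rightarrow> 'c) \<Rightarrow> 'a set \<Rightarrow> bool" where
  "liftable_on C p h R \<longleftrightarrow> (\<forall>z\<in>R. \<forall>c\<in>C. p c = h z \<longrightarrow>
     (\<exists>k. continuous_on R k \<and> k ` R \<subseteq> C \<and> (\<forall>w\<in>R. p (k w) = h w) \<and> k z = c))"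

text \<open>Lifts that agree at one point of the connected overlap agree on all of it, and
  closedness of the two pieces makes the glued map continuous.\<close>

lemma liftable_on_Un:
  fixes p :: "'b::topological_space \<Rightarrow> 'c::topological_space"
  assumes cov: "covering_space C p S" and "closed P" "closed Q" "connected (P \<inter> Q)" "P \<inter> Q \<noteq> {}"
    and "liftable_on C p h P" "liftable_on C p h Q"
  shows "liftable_on C p h (P \<union> Q)"
proof -
  have *: "\<exists>k. continuous_on (P \<union> Q) k \<and> k ` (P \<union> Q) \<subseteq> C \<and> (\<forall>w\<in>P \<union> Q. p (k w) = h w) \<and> k z = c"
    if P: "closed P" and Q: "closed Q" and con: "connected (P \<inter> Q)" and ne: "P \<inter> Q \<noteq> {}"
      and lP: "liftable_on C p h P" and lQ: "liftable_on C p h Q"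
      and z: "z \<in> P" "c \<in> C" "p c = h z" for P Q :: "'a set" and z c
  proof -
    obtain k where k: "continuous_on P k" "k ` P \<subseteq> C" "\<forall>w\<in>P. p (k w) = h w" "k z = c"
      using lP z unfolding liftable_on_def by blast
    obtain y where y: "y \<in> P" "y \<in> Q" using ne by blast
    obtain l where l: "continuous_on Q l" "l ` Q \<subseteq> C" "\<forall>w\<in>Q. p (l w) = h w" "l y = k y"
      using lQ y k(2,3) unfolding liftable_on_def by (metis image_subset_iff)
    have "k x = l x" if "x \<in> P \<inter> Q" for x
    proof (rule covering_space_lift_unique_topological[OF cov con, where a = y])
      show "continuous_on (P \<inter> Q) k" "continuous_on (P \<inter> Q) l"
        using k(1) l(1) by (auto intro: continuous_on_subset)
    qed (use that k l y in auto)
    then have "continuous_on (P \<union> Q) (\<lambda>x. if x \<in> P then k x else l x)"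
      using P Q k(1) l(1) by (intro continuous_on_cases) auto
    then show ?thesis
      using k l z by (intro exI[of _ "\<lambda>x. if x \<in> P then k x else l x"]) auto
  qed
  show ?thesis
    unfolding liftable_on_def
  proof (intro ballI impI)
    fix z c assume z: "z \<in> P \<union> Q" and c: "c \<in> C" "p c = h z"
    show "\<exists>k. continuous_on (P \<union> Q) k \<and> k ` (P \<union> Q) \<subseteq> C \<and> (\<forall>w\<in>P \<union> Q. p (k w) = h w) \<and> k z = c"
    proof (cases "z \<in> P")
      case True
      then show ?thesis using *[of P Q z c] assms c by blast
    next
      case False
      then show ?thesis using *[of Q P z c] assms c z by (simp add: Un_commute Int_commute)
    qed
  qed
qed

text \<open>Near \<open>z\<close> all values of \<open>h\<close> lie in one evenly covered set, and
  the inverse of \<open>p\<close> on the sheet through the prescribed point gives the lift. It works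
  on every subset of the neighbourhood, in particular on small rectangles.\<close>

lemma liftable_on_locally:
  fixes p :: "'b::topological_space \<Rightarrow> 'c::topological_space"
  assumes cov: "covering_space C p S" and h: "continuous_on UNIV h" "range h \<subseteq> S"
  obtains A where "open A" "z \<in> A" "\<And>R. R \<subseteq> A \<Longrightarrow> liftable_on C p h R"
proof -
  have "h z \<in> S" using h(2) by blast
  then obtain W \<V> where W: "h z \<in> W" "openin (top_of_set S) W" "\<Union>\<V> = C \<inter> p -` W"
      "\<And>u. u \<in> \<V> \<Longrightarrow> \<exists>q. homeomorphism u W p q"
    by (rule covering_space_evenly_coveredE[OF cov]) blast
  have "openin (top_of_set UNIV) (UNIV \<inter> h -` W)"
    using h W(2) by (intro continuous_openin_preimage) auto
  then have "open (h -` W)" by simp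
  moreover have "liftable_on C p h R" if R: "R \<subseteq> h -` W" for R
    unfolding liftable_on_def
  proof (intro ballI impI)
    fix y c assume y: "y \<in> R" "c \<in> C" "p c = h y"
    then have "c \<in> \<Union>\<V>" using R W(3) by auto
    then obtain u q where u: "u \<in> \<V>" "c \<in> u" and q: "homeomorphism u W p q"
      using W(4) by blast
    have "continuous_on R (\<lambda>w. q (h w))"
      using R h(1) homeomorphism_cont2[OF q]
      by (intro continuous_on_compose2[of W q R h]) (auto intro: continuous_on_subset)
    moreover have "q (h w) \<in> C" "p (q (h w)) = h w" if "w \<in> R" for w
      using R that homeomorphism_image2[OF q] homeomorphism_apply2[OF q] u(1) W(3) by blast+
    moreover have "q (h y) = c"
      using homeomorphism_apply1[OF q u(2)] y(3) by simp
    ultimately show "\<exists>k. continuous_on R k \<and> k ` R \<subseteq> C \<and> (\<forall>w\<in>R. p (k w) = h w) \<and> k y = c"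
      by (intro exI[of _ "\<lambda>w. q (h w)"]) auto
  qed
  ultimately show thesis using W(1) that by blast
qed

text \<open>Two nested uses of the bisection principle \<open>Bolzano\<close>: adjacent rectangles
  are joined along a common side, which is connected, and small rectangles around a point are
  liftable by \<open>liftable_on_locally\<close>.\<close>

lemma liftable_on_rectangle:
  fixes p :: "'b::topological_space \<Rightarrow> 'c::topological_space" and h :: "real \<times> real \<Rightarrow> 'c"
  assumes cov: "covering_space C p S" and h: "continuous_on UNIV h" "range h \<subseteq> S"
    and "a \<le> b" "c \<le> d"
  shows "liftable_on C p h ({a..b} \<times> {c..d})"
  using \<open>a \<le> b\<close>
proof (induction a b rule: Bolzano)
  case (trans a b' b)
  have "liftable_on C p h ({a..b'} \<times> {c..d} \<union> {b'..b} \<times> {c..d})"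
  proof (rule liftable_on_Un[OF cov _ _ _ _ trans(1,2)])
    have "{a..b'} \<times> {c..d} \<inter> {b'..b} \<times> {c..d} = {b'} \<times> {c..d}"
      using trans by auto
    then show "connected ({a..b'} \<times> {c..d} \<inter> {b'..b} \<times> {c..d})" "{a..b'} \<times> {c..d} \<inter> {b'..b} \<times> {c..d} \<noteq> {}"
      using \<open>c \<le> d\<close> by (auto intro: connected_Times)
  qed (auto intro: closed_Times)
  moreover have "{a..b'} \<times> {c..d} \<union> {b'..b} \<times> {c..d} = {a..b} \<times> {c..d}"
    using trans by auto
  ultimately show ?case by simp
next
  \<comment> \<open>For fixed \<open>x\<close> the claim is that some positive width makes every
    narrower strip around \<open>x\<close>, over all of \<open>{c..d}\<close>, liftable. The inner
    bisection, in the second direction, joins two such families at the smaller of their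
    widths.\<close>
  case (local x)
  show ?case
    using \<open>c \<le> d\<close>
  proof (induction c d rule: Bolzano)
    case (trans c d' d)
    then obtain \<delta> \<epsilon> where \<delta>: "0 < \<delta>" "\<forall>a b. a \<le> x \<and> x \<le> b \<and> b - a < \<delta> \<longrightarrow> liftable_on C p h ({a..b} \<times> {c..d'})"
      and \<epsilon>: "0 < \<epsilon>" "\<forall>a b. a \<le> x \<and> x \<le> b \<and> b - a < \<epsilon> \<longrightarrow> liftable_on C p h ({a..b} \<times> {d'..d})"
      by blast
    have "liftable_on C p h ({a..b} \<times> {c..d})" if ab: "a \<le> x" "x \<le> b" "b - a < min \<delta> \<epsilon>" for a b
    proof -
      have "liftable_on C p h ({a..b} \<times> {c..d'} \<union> {a..b} \<times> {d'..d})"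
      proof (rule liftable_on_Un[OF cov])
        have "{a..b} \<times> {c..d'} \<inter> {a..b} \<times> {d'..d} = {a..b} \<times> {d'}"
          using trans by auto
        then show "connected ({a..b} \<times> {c..d'} \<inter> {a..b} \<times> {d'..d})" "{a..b} \<times> {c..d'} \<inter> {a..b} \<times> {d'..d} \<noteq> {}"
          using ab by (auto intro: connected_Times)
      qed (use \<delta> \<epsilon> ab in \<open>auto intro: closed_Times\<close>)
      moreover have "{a..b} \<times> {c..d'} \<union> {a..b} \<times> {d'..d} = {a..b} \<times> {c..d}"
        using trans by auto
      ultimately show ?thesis by simp
    qed
    then show ?case using \<delta>(1) \<epsilon>(1) by (intro exI[of _ "min \<delta> \<epsilon>"]) auto
  next
    case (local y)
    obtain A where A: "open A" "(x, y) \<in> A" "\<And>R. R \<subseteq> A \<Longrightarrow> liftable_on C p h R"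
      using liftable_on_locally[OF cov h] by blast
    obtain X Y where XY: "open X" "x \<in> X" "open Y" "y \<in> Y" "X \<times> Y \<subseteq> A"
      using A(1,2) by (auto elim: open_prod_elim)
    obtain \<delta> \<epsilon> where \<delta>: "0 < \<delta>" "ball x \<delta> \<subseteq> X" and \<epsilon>: "0 < \<epsilon>" "ball y \<epsilon> \<subseteq> Y"
      using XY by (meson open_contains_ball)
    have "liftable_on C p h ({a..b} \<times> {c..d})"
      if "a \<le> x" "x \<le> b" "b - a < \<delta>" "c \<le> y" "y \<le> d" "d - c < \<epsilon>" for a b c d
    proof (rule A(3))
      have "{a..b} \<subseteq> ball x \<delta>" "{c..d} \<subseteq> ball y \<epsilon>"
        using that by (auto simp: dist_real_def)
      then show "{a..b} \<times> {c..d} \<subseteq> A" using \<delta>(2) \<epsilon>(2) XY(5) by blast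
    qed
    then show ?case using \<delta>(1) \<epsilon>(1) by blast
  qed
qed

text \<open>The sides \<open>k (t, 0)\<close> and \<open>k (t, 1)\<close> of the lifted homotopy
  lift constant paths, so they are constant by uniqueness. Hence the lift of \<open>r\<close> keeps
  the end points of \<open>s\<close> and is a loop whenever \<open>s\<close> is one.\<close>

lemma covering_space_lift_homotopic_path:
  fixes p :: "'b::topological_space \<Rightarrow> 'c::topological_space"
  assumes cov: "covering_space C p S" and hom: "homotopic_paths S (p \<circ> s) r"
    and s: "path s" "path_image s \<subseteq> C"
  obtains r' where "homotopic_paths C s r'" "\<And>t. t \<in> {0..1} \<Longrightarrow> p (r' t) = r t"
proof -
  let ?I = "{0..1::real}"
  obtain H where H: "continuous_on (?I \<times> ?I) H" "H \<in> (?I \<times> ?I) \<rightarrow> S"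
    "\<forall>x\<in>?I. H (0, x) = p (s x)" "\<forall>x\<in>?I. H (1, x) = r x"
    "\<forall>t\<in>?I. H (t, 0) = p (s 0)" "\<forall>t\<in>?I. H (t, 1) = p (s 1)"
    using hom by (auto simp: homotopic_paths pathstart_def pathfinish_def)
  \<comment> \<open>Clamping to the unit interval extends the homotopy continuously to the whole
    plane, where \<open>liftable_on_rectangle\<close> expects its map.\<close>
  define cl where "cl x = max 0 (min 1 x)" for x :: real
  define h where "h z = H (cl (fst z), cl (snd z))" for z
  have cl: "cl x \<in> ?I" for x by (auto simp: cl_def)
  have cl_id: "cl x = x" if "x \<in> ?I" for x using that by (auto simp: cl_def)
  have "continuous_on UNIV (\<lambda>z. (cl (fst z), cl (snd z)))"
    unfolding cl_def by (intro continuous_intros)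
  then have h: "continuous_on UNIV h"
    unfolding h_def by (rule continuous_on_compose2[OF H(1)]) (use cl in auto)
  have hS: "range h \<subseteq> S" using H(2) cl by (auto simp: h_def)
  have sC: "s x \<in> C" if "x \<in> ?I" for x using s(2) that by (auto simp: path_image_def)
  have conts: "continuous_on ?I s" using s(1) by (simp add: path_def)
  have "liftable_on C p h (?I \<times> ?I)"
    using liftable_on_rectangle[OF cov h hS] by simp
  moreover have "p (s 0) = h (0, 0)" using H(3) cl_id[of 0] by (simp add: h_def)
  ultimately obtain k where k: "continuous_on (?I \<times> ?I) k" "k ` (?I \<times> ?I) \<subseteq> C"
    "\<forall>w\<in>?I \<times> ?I. p (k w) = h w" "k (0, 0) = s 0"
    using sC[of 0] unfolding liftable_on_def by (metis atLeastAtMost_iff mem_Sigma_iff order_refl zero_le_one)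
  have pk: "p (k (t, x)) = H (t, x)" if "t \<in> ?I" "x \<in> ?I" for t x
    using k(3) that cl_id by (simp add: h_def)
  have cont1: "continuous_on ?I (\<lambda>x. k (t, x))" if "t \<in> ?I" for t
    using that by (intro continuous_on_compose2[OF k(1)] continuous_intros) auto
  have cont2: "continuous_on ?I (\<lambda>t. k (t, x))" if "x \<in> ?I" for x
    using that by (intro continuous_on_compose2[OF k(1)] continuous_intros) auto
  have kC: "k (t, x) \<in> C" if "t \<in> ?I" "x \<in> ?I" for t x
    using that k(2) by blast
  have k0: "k (0, x) = s x" if "x \<in> ?I" for x
    by (rule covering_space_lift_unique_topological[OF cov, where T = ?I and a = 0])
      (use that conts cont1[of 0] sC kC[of 0] pk[of 0] H(3) k(4) in auto)
  have kl: "k (t, 0) = s 0" if "t \<in> ?I" for t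
    by (rule covering_space_lift_unique_topological[OF cov, where T = ?I and a = 0])
      (use that cont2[of 0] sC[of 0] kC[of _ 0] pk[of _ 0] H(5) k(4) in auto)
  have kr: "k (t, 1) = s 1" if "t \<in> ?I" for t
    by (rule covering_space_lift_unique_topological[OF cov, where T = ?I and a = 0])
      (use that cont2[of 1] sC[of 1] kC[of _ 1] pk[of _ 1] H(6) k0[of 1] in auto)
  have "homotopic_paths C s (\<lambda>x. k (1, x))"
    unfolding homotopic_paths
    using k(1,2) k0 kl kr by (intro exI[of _ k]) (auto simp: pathstart_def pathfinish_def)
  moreover have "p (k (1, t)) = r t" if "t \<in> ?I" for t
    using pk[of 1 t] that H(4) by simp
  ultimately show thesis using that by blast
qed

section \<open>Product manifolds\<close>

text \<open>Entries from \<open>m\<close> on are cut to 0, so that the value is a point of the model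
  space of dimension \<open>m\<close>.\<close>

definition fst_coords :: "nat \<Rightarrow> (nat \<Rightarrow> real) \<Rightarrow> nat \<Rightarrow> real" where
  "fst_coords m z = (\<lambda>i. if i < m then z i else 0)"

definition snd_coords :: "nat \<Rightarrow> (nat \<Rightarrow> real) \<Rightarrow> nat \<Rightarrow> real" where
  "snd_coords m z = (\<lambda>i. z (i + m))"

definition prod_chart :: "nat \<Rightarrow> ('a \<Rightarrow> nat \<Rightarrow> real) \<Rightarrow> ('b \<Rightarrow> nat \<Rightarrow> real) \<Rightarrow> 'a \<times> 'b \<Rightarrow> nat \<Rightarrow> real" where
  "prod_chart m \<phi> \<psi> = (\<lambda>(x, y) i. if i < m then \<phi> x i else \<psi> y (i - m))"

lemma continuous_on_coordinate: "continuous_on A (\<lambda>z :: nat \<Rightarrow> real. z i)"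
  by (rule continuous_on_subset[OF continuous_on_product_coordinates]) simp

lemma continuous_on_fst_coords: "continuous_on A (fst_coords m)"
  unfolding fst_coords_def
proof (rule continuous_on_coordinatewise_then_product)
  show "continuous_on A (\<lambda>z :: nat \<Rightarrow> real. if i < m then z i else 0)" for i
    by (cases "i < m") (simp_all add: continuous_on_coordinate)
qed

lemma continuous_on_snd_coords: "continuous_on A (snd_coords m)"
  unfolding snd_coords_def
  by (rule continuous_on_coordinatewise_then_product) (auto intro: continuous_on_coordinate)

lemma coords_image_subset:
  "fst_coords m ` {z. \<forall>i\<ge>m + n. z i = 0} \<subseteq> {z. \<forall>i\<ge>m. z i = 0}"
  "snd_coords m ` {z. \<forall>i\<ge>m + n. z i = 0} \<subseteq> {z. \<forall>i\<ge>n. z i = 0}"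
  by (auto simp: fst_coords_def snd_coords_def)

lemma fst_coords_prod_chart:
  assumes "is_chart m S (U, \<phi>)" "x \<in> U"
  shows "fst_coords m (prod_chart m \<phi> \<psi> (x, y)) = \<phi> x"
proof
  fix i
  show "fst_coords m (prod_chart m \<phi> \<psi> (x, y)) i = \<phi> x i"
    using openin_Euclidean_space_zero[OF is_chartD(2)[OF assms(1)] imageI[OF assms(2)], of i]
    by (simp add: fst_coords_def prod_chart_def)
qed

lemma snd_coords_prod_chart: "snd_coords m (prod_chart m \<phi> \<psi> (x, y)) = \<psi> y"
  by (auto simp: snd_coords_def prod_chart_def fun_eq_iff)

lemma smooth_real_on_compose_fst_coords:
  assumes "openin (Euclidean_space m) V" "openin (Euclidean_space n) U" "fst_coords m ` U \<subseteq> V"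
    "smooth_real_on m V f"
  shows "smooth_real_on n U (\<lambda>z. f (fst_coords m z))"
  by (rule smooth_real_on_compose[OF assms(1-4)]) (simp add: fst_coords_def smooth_real_on_coord)

lemma smooth_real_on_compose_snd_coords:
  assumes "openin (Euclidean_space k) V" "openin (Euclidean_space n) U" "snd_coords m ` U \<subseteq> V"
    "smooth_real_on k V f"
  shows "smooth_real_on n U (\<lambda>z. f (snd_coords m z))"
  by (rule smooth_real_on_compose[OF assms(1-4)]) (simp add: snd_coords_def smooth_real_on_coord)

lemma is_chart_prod:
  assumes c: "is_chart m S (U, \<phi>)" and d: "is_chart n T (V, \<psi>)"
  shows "is_chart (m + n) (S \<times> T) (U \<times> V, prod_chart m \<phi> \<psi>)"
proof (rule is_chartI)
  show "openin (top_of_set (S \<times> T)) (U \<times> V)"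
    using is_chartD(1)[OF c] is_chartD(1)[OF d] by (rule openin_Times)
  let ?E = "\<lambda>n. {z :: nat \<Rightarrow> real. \<forall>i\<ge>n. z i = 0}"
  \<comment> \<open>Writing the image as an intersection of preimages under the two coordinate
    projections turns its openness into continuity of these projections.\<close>
  have im: "prod_chart m \<phi> \<psi> ` (U \<times> V) =
      (?E (m + n) \<inter> fst_coords m -` (\<phi> ` U)) \<inter> (?E (m + n) \<inter> snd_coords m -` (\<psi> ` V))"
    (is "?L = ?R")
  proof
    show "?L \<subseteq> ?R"
    proof clarify
      fix x y assume xy: "x \<in> U" "y \<in> V"
      have "prod_chart m \<phi> \<psi> (x, y) i = 0" if "m + n \<le> i" for i
        using openin_Euclidean_space_zero[OF is_chartD(2)[OF d], of "\<psi> y" "i - m"] xy that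
        by (auto simp: prod_chart_def)
      then show "prod_chart m \<phi> \<psi> (x, y) \<in> ?R"
        using xy by (simp add: fst_coords_prod_chart[OF c] snd_coords_prod_chart)
    qed
    show "?R \<subseteq> ?L"
    proof
      fix z assume "z \<in> ?R"
      then obtain x y where xy: "x \<in> U" "fst_coords m z = \<phi> x" "y \<in> V" "snd_coords m z = \<psi> y"
        by blast
      then have "prod_chart m \<phi> \<psi> (x, y) = prod_chart m (\<lambda>_. fst_coords m z) (\<lambda>_. snd_coords m z) (x, y)"
        by (simp add: prod_chart_def)
      also have "\<dots> = z"
        by (auto simp: prod_chart_def fst_coords_def snd_coords_def fun_eq_iff)
      finally show "z \<in> ?L" using xy(1,3) by (metis image_eqI mem_Sigma_iff)
    qed
  qed
  show "openin (Euclidean_space (m + n)) (prod_chart m \<phi> \<psi> ` (U \<times> V))"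
    unfolding im Euclidean_space_eq_top_of_set
    using is_chartD(2)[OF c] is_chartD(2)[OF d] unfolding Euclidean_space_eq_top_of_set
    by (intro openin_Int openin_preimage[OF _ continuous_on_fst_coords coords_image_subset(1)]
        openin_preimage[OF _ continuous_on_snd_coords coords_image_subset(2)]) auto
  show "continuous_on (U \<times> V) (prod_chart m \<phi> \<psi>)"
  proof (rule continuous_on_coordinatewise_then_product)
    fix i
    have 1: "continuous_on (U \<times> V) (\<lambda>z. \<phi> (fst z))"
      by (rule continuous_on_compose2[OF is_chartD(4)[OF c]]) (auto intro: continuous_intros)
    have 2: "continuous_on (U \<times> V) (\<lambda>z. \<psi> (snd z))"
      by (rule continuous_on_compose2[OF is_chartD(4)[OF d]]) (auto intro: continuous_intros)
    show "continuous_on (U \<times> V) (\<lambda>z. prod_chart m \<phi> \<psi> z i)"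
      using continuous_on_product_then_coordinatewise[OF 1, of i]
        continuous_on_product_then_coordinatewise[OF 2, of "i - m"]
      by (cases "i < m") (simp_all add: prod_chart_def case_prod_unfold)
  qed
  show "continuous_on (prod_chart m \<phi> \<psi> ` (U \<times> V))
      (\<lambda>z. (inv_into U \<phi> (fst_coords m z), inv_into V \<psi> (snd_coords m z)))"
    using im
    by (intro continuous_on_Pair continuous_on_compose2[OF is_chartD(5)[OF c] continuous_on_fst_coords]
        continuous_on_compose2[OF is_chartD(5)[OF d] continuous_on_snd_coords]) auto
  show "(inv_into U \<phi> (fst_coords m (prod_chart m \<phi> \<psi> z)),
      inv_into V \<psi> (snd_coords m (prod_chart m \<phi> \<psi> z))) = z" if "z \<in> U \<times> V" for z
    using that is_chartD(3)[OF c] is_chartD(3)[OF d]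
    by (cases z) (simp add: fst_coords_prod_chart[OF c] snd_coords_prod_chart)
qed

lemma prod_manifold_simps:
  "pts (prod_manifold M N) = pts M \<times> pts N" "mdim (prod_manifold M N) = mdim M + mdim N"
  by (simp_all add: prod_manifold_def)

lemma atlas_prod_manifold:
  "c \<in> atlas (prod_manifold M N) \<longleftrightarrow> (\<exists>U \<phi> V \<psi>. c = (U \<times> V, prod_chart (mdim M) \<phi> \<psi>) \<and>
     (U, \<phi>) \<in> atlas M \<and> (V, \<psi>) \<in> atlas N)"
  by (auto simp: prod_manifold_def prod_chart_def)

lemma charted_prod_manifold:
  assumes M: "charted M" and N: "charted N"
  shows "charted (prod_manifold M N)"
proof -
  have chart: "is_chart (mdim M + mdim N) (pts M \<times> pts N) c" if "c \<in> atlas (prod_manifold M N)" for c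
    using that chartedD[OF M] chartedD[OF N] by (auto simp: atlas_prod_manifold intro: is_chart_prod)
  then have "fst c \<subseteq> pts M \<times> pts N" if "c \<in> atlas (prod_manifold M N)" for c
    using that openin_imp_subset[OF is_chartD(1)] by (metis prod.collapse)
  moreover have "\<exists>c\<in>atlas (prod_manifold M N). (x, y) \<in> fst c" if xy: "x \<in> pts M" "y \<in> pts N" for x y
  proof -
    obtain U \<phi> V \<psi> where "(U, \<phi>) \<in> atlas M" "x \<in> U" "(V, \<psi>) \<in> atlas N" "y \<in> V"
      using charted_coverE[OF M xy(1)] charted_coverE[OF N xy(2)] by metis
    then have "(U \<times> V, prod_chart (mdim M) \<phi> \<psi>) \<in> atlas (prod_manifold M N)" "(x, y) \<in> U \<times> V"
      by (auto simp: atlas_prod_manifold)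
    then show ?thesis by (metis fst_conv)
  qed
  ultimately show ?thesis
    using chart unfolding charted_def prod_manifold_simps by fastforce
qed

text \<open>In product charts the projections become \<open>fst_coords\<close> and
  \<open>snd_coords\<close>, so their coordinate expressions are transition maps of a factor
  composed with one of these.\<close>

lemma smooth_fst_snd:
  assumes M: "smooth_manifold M" and N: "smooth_manifold N"
  shows "smooth_map (prod_manifold M N) M fst" "smooth_map (prod_manifold M N) N snd"
proof -
  note cM = smooth_manifold_imp_charted[OF M] and cN = smooth_manifold_imp_charted[OF N]
  have *: "smooth_real_on (mdim M + mdim N) (prod_chart (mdim M) \<phi> \<psi> ` ((U \<times> V) \<inter> fst -` U'))
        (\<lambda>y. \<phi>' (fst (inv_into (U \<times> V) (prod_chart (mdim M) \<phi> \<psi>) y)) j)"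
    if U: "(U, \<phi>) \<in> atlas M" and V: "(V, \<psi>) \<in> atlas N" and U': "(U', \<phi>') \<in> atlas M" and j: "j < mdim M"
    for U \<phi> V \<psi> U' \<phi>' j
  proof -
    note c = chartedD[OF cM U] and c' = chartedD[OF cM U'] and d = chartedD[OF cN V]
    note cd = is_chart_prod[OF c d]
    let ?A = "(U \<times> V) \<inter> fst -` U'"
    have A: "openin (top_of_set (pts M \<times> pts N)) ?A"
    proof -
      have "openin (top_of_set (pts M \<times> pts N)) ((U \<inter> U') \<times> V)"
        using is_chartD(1)[OF c] is_chartD(1)[OF c'] is_chartD(1)[OF d] by (intro openin_Times openin_Int)
      moreover have "(U \<inter> U') \<times> V = ?A" by auto
      ultimately show ?thesis by simp
    qed
    have UU': "openin (top_of_set (pts M)) (U \<inter> U')"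
      using is_chartD(1)[OF c] is_chartD(1)[OF c'] by (rule openin_Int)
    have oA: "openin (Euclidean_space (mdim M + mdim N)) (prod_chart (mdim M) \<phi> \<psi> ` ?A)"
      by (rule is_chart_open_image[OF cd A]) auto
    have sm: "smooth_real_on (mdim M + mdim N) (prod_chart (mdim M) \<phi> \<psi> ` ?A)
        (\<lambda>y. \<phi>' (inv_into U \<phi> (fst_coords (mdim M) y)) j)"
    proof (rule smooth_real_on_compose_fst_coords[where f = "\<lambda>z. \<phi>' (inv_into U \<phi> z) j"])
      show "smooth_real_on (mdim M) (\<phi> ` (U \<inter> U')) (\<lambda>z. \<phi>' (inv_into U \<phi> z) j)"
        by (rule smooth_fun_onD[OF smooth_fun_on_chart_coord[OF M U' j] U])
      show "openin (Euclidean_space (mdim M)) (\<phi> ` (U \<inter> U'))"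
        by (rule is_chart_open_image[OF c UU']) auto
    qed (use oA in \<open>auto simp: fst_coords_prod_chart[OF c]\<close>)
    have eq: "inv_into U \<phi> (fst_coords (mdim M) y) = fst (inv_into (U \<times> V) (prod_chart (mdim M) \<phi> \<psi>) y)"
      if "y \<in> prod_chart (mdim M) \<phi> \<psi> ` ?A" for y
    proof -
      obtain a b where ab: "a \<in> U" "b \<in> V" "y = prod_chart (mdim M) \<phi> \<psi> (a, b)" using \<open>y \<in> _\<close> by blast
      then show ?thesis
        using inv_into_f_f[OF is_chartD(3)[OF cd], of "(a, b)"] inv_into_f_f[OF is_chartD(3)[OF c], of a]
        by (simp add: fst_coords_prod_chart[OF c])
    qed
    show ?thesis
      by (rule smooth_real_on_eq[OF sm oA]) (simp only: eq)
  qed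
  have **: "smooth_real_on (mdim M + mdim N) (prod_chart (mdim M) \<phi> \<psi> ` ((U \<times> V) \<inter> snd -` V'))
        (\<lambda>y. \<psi>' (snd (inv_into (U \<times> V) (prod_chart (mdim M) \<phi> \<psi>) y)) j)"
    if U: "(U, \<phi>) \<in> atlas M" and V: "(V, \<psi>) \<in> atlas N" and V': "(V', \<psi>') \<in> atlas N" and j: "j < mdim N"
    for U \<phi> V \<psi> V' \<psi>' j
  proof -
    note c = chartedD[OF cM U] and d' = chartedD[OF cN V'] and d = chartedD[OF cN V]
    note cd = is_chart_prod[OF c d]
    let ?A = "(U \<times> V) \<inter> snd -` V'"
    have A: "openin (top_of_set (pts M \<times> pts N)) ?A"
    proof -
      have "openin (top_of_set (pts M \<times> pts N)) (U \<times> (V \<inter> V'))"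
        using is_chartD(1)[OF c] is_chartD(1)[OF d'] is_chartD(1)[OF d] by (intro openin_Times openin_Int)
      moreover have "U \<times> (V \<inter> V') = ?A" by auto
      ultimately show ?thesis by simp
    qed
    have VV': "openin (top_of_set (pts N)) (V \<inter> V')"
      using is_chartD(1)[OF d] is_chartD(1)[OF d'] by (rule openin_Int)
    have oA: "openin (Euclidean_space (mdim M + mdim N)) (prod_chart (mdim M) \<phi> \<psi> ` ?A)"
      by (rule is_chart_open_image[OF cd A]) auto
    have sm: "smooth_real_on (mdim M + mdim N) (prod_chart (mdim M) \<phi> \<psi> ` ?A)
        (\<lambda>y. \<psi>' (inv_into V \<psi> (snd_coords (mdim M) y)) j)"
    proof (rule smooth_real_on_compose_snd_coords[where f = "\<lambda>z. \<psi>' (inv_into V \<psi> z) j"])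
      show "smooth_real_on (mdim N) (\<psi> ` (V \<inter> V')) (\<lambda>z. \<psi>' (inv_into V \<psi> z) j)"
        by (rule smooth_fun_onD[OF smooth_fun_on_chart_coord[OF N V' j] V])
      show "openin (Euclidean_space (mdim N)) (\<psi> ` (V \<inter> V'))"
        by (rule is_chart_open_image[OF d VV']) auto
    qed (use oA in \<open>auto simp: snd_coords_prod_chart\<close>)
    have eq: "inv_into V \<psi> (snd_coords (mdim M) y) = snd (inv_into (U \<times> V) (prod_chart (mdim M) \<phi> \<psi>) y)"
      if "y \<in> prod_chart (mdim M) \<phi> \<psi> ` ?A" for y
    proof -
      obtain a b where ab: "a \<in> U" "b \<in> V" "y = prod_chart (mdim M) \<phi> \<psi> (a, b)" using \<open>y \<in> _\<close> by blast
      then show ?thesis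
        using inv_into_f_f[OF is_chartD(3)[OF cd], of "(a, b)"] inv_into_f_f[OF is_chartD(3)[OF d], of b]
        by (simp add: snd_coords_prod_chart)
    qed
    show ?thesis
      by (rule smooth_real_on_eq[OF sm oA]) (simp only: eq)
  qed
  have sub: "U \<times> V \<subseteq> pts M \<times> pts N" if "(U, \<phi>) \<in> atlas M" "(V, \<psi>) \<in> atlas N" for U \<phi> V \<psi>
    using openin_imp_subset[OF is_chartD(1)[OF chartedD[OF cM that(1)]]]
      openin_imp_subset[OF is_chartD(1)[OF chartedD[OF cN that(2)]]] by blast
  show "smooth_map (prod_manifold M N) M fst"
    unfolding smooth_map_on_def prod_manifold_simps
  proof (intro conjI ballI, goal_cases)
    case (4 c)
    then obtain U \<phi> V \<psi> where c: "c = (U \<times> V, prod_chart (mdim M) \<phi> \<psi>)"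
      and U: "(U, \<phi>) \<in> atlas M" and V: "(V, \<psi>) \<in> atlas N"
      by (auto simp: atlas_prod_manifold)
    show ?case
      unfolding c prod.case
    proof (clarify)
      fix U' \<phi>' j assume U': "(U', \<phi>') \<in> atlas M" "j < mdim M"
      have eq: "U \<times> V \<inter> pts M \<times> pts N = U \<times> V" using sub[OF U V] by (simp add: Int_absorb2)
      show "smooth_real_on (mdim M + mdim N)
          (prod_chart (mdim M) \<phi> \<psi> ` (U \<times> V \<inter> pts M \<times> pts N \<inter> fst -` U'))
          (\<lambda>y. \<phi>' (fst (inv_into (U \<times> V) (prod_chart (mdim M) \<phi> \<psi>) y)) j)"
        unfolding eq by (rule *[OF U V U'])
    qed
  qed (auto intro: continuous_intros)
  show "smooth_map (prod_manifold M N) N snd"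
    unfolding smooth_map_on_def prod_manifold_simps
  proof (intro conjI ballI, goal_cases)
    case (4 c)
    then obtain U \<phi> V \<psi> where c: "c = (U \<times> V, prod_chart (mdim M) \<phi> \<psi>)"
      and U: "(U, \<phi>) \<in> atlas M" and V: "(V, \<psi>) \<in> atlas N"
      by (auto simp: atlas_prod_manifold)
    show ?case
      unfolding c prod.case
    proof (clarify)
      fix V' \<psi>' j assume V': "(V', \<psi>') \<in> atlas N" "j < mdim N"
      have eq: "U \<times> V \<inter> pts M \<times> pts N = U \<times> V" using sub[OF U V] by (simp add: Int_absorb2)
      show "smooth_real_on (mdim M + mdim N)
          (prod_chart (mdim M) \<phi> \<psi> ` (U \<times> V \<inter> pts M \<times> pts N \<inter> snd -` V'))
          (\<lambda>y. \<psi>' (snd (inv_into (U \<times> V) (prod_chart (mdim M) \<phi> \<psi>) y)) j)"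
        unfolding eq by (rule **[OF U V V'])
    qed
  qed (auto intro: continuous_intros)
qed

lemma smooth_fun_on_fst:
  assumes "smooth_manifold M" "smooth_manifold N" "openin (top_of_set (pts M)) D" "smooth_fun_on M D h"
  shows "smooth_fun_on (prod_manifold M N) (D \<times> pts N) (\<lambda>z. h (fst z))"
proof -
  have "smooth_fun_on (prod_manifold M N) (pts (prod_manifold M N) \<inter> fst -` D) (\<lambda>z. h (fst z))"
    using assms smooth_manifold_imp_charted[OF assms(1)] smooth_manifold_imp_charted[OF assms(2)]
    by (intro smooth_fun_on_compose[OF _ _ smooth_fst_snd(1)] charted_prod_manifold)
  then show ?thesis
    by (rule smooth_fun_on_subset)
      (use openin_imp_subset[OF assms(3)] in \<open>auto simp: prod_manifold_simps\<close>)
qed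

lemma smooth_fun_on_snd:
  assumes "smooth_manifold M" "smooth_manifold N" "openin (top_of_set (pts N)) D" "smooth_fun_on N D h"
  shows "smooth_fun_on (prod_manifold M N) (pts M \<times> D) (\<lambda>z. h (snd z))"
proof -
  have "smooth_fun_on (prod_manifold M N) (pts (prod_manifold M N) \<inter> snd -` D) (\<lambda>z. h (snd z))"
    using assms smooth_manifold_imp_charted[OF assms(1)] smooth_manifold_imp_charted[OF assms(2)]
    by (intro smooth_fun_on_compose[OF _ _ smooth_fst_snd(2)] charted_prod_manifold)
  then show ?thesis
    by (rule smooth_fun_on_subset)
      (use openin_imp_subset[OF assms(3)] in \<open>auto simp: prod_manifold_simps\<close>)
qed

section \<open>Fibre products as submanifolds\<close>

text \<open>
  The coordinates of \<open>y\<close> come first, so that the graph \<open>\<phi> x = g y\<close> is the vanishing set of the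
  coordinates of index \<open>\<ge> d\<close>, as slice charts require.
\<close>

definition shear_chart ::
  "nat \<Rightarrow> ('a \<Rightarrow> nat \<Rightarrow> real) \<Rightarrow> ('b \<Rightarrow> nat \<Rightarrow> real) \<Rightarrow> ('b \<Rightarrow> nat \<Rightarrow> real) \<Rightarrow> 'a \<times> 'b \<Rightarrow> nat \<Rightarrow> real" where
  "shear_chart d \<phi> \<psi> g = (\<lambda>(x, y) i. if i < d then \<psi> y i else \<phi> x (i - d) - g y (i - d))"

text \<open>The part of the inverse of \<open>shear_chart\<close> that recovers the coordinates of
  \<open>x\<close>: the first \<open>d\<close> entries determine the point of \<open>V\<close>, and
  the value of \<open>g\<close> there is added back.\<close>

definition unshear ::
  "nat \<Rightarrow> ('b \<Rightarrow> nat \<Rightarrow> real) \<Rightarrow> 'b set \<Rightarrow> ('b \<Rightarrow> nat \<Rightarrow> real) \<Rightarrow> (nat \<Rightarrow> real) \<Rightarrow> nat \<Rightarrow> real" where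
  "unshear d \<psi> V g z = (\<lambda>i. snd_coords d z i + g (inv_into V \<psi> (fst_coords d z)) i)"

lemma fst_coords_shear_chart:
  assumes "is_chart d T (V, \<psi>)" "y \<in> V"
  shows "fst_coords d (shear_chart d \<phi> \<psi> g (x, y)) = \<psi> y"
proof
  fix i
  show "fst_coords d (shear_chart d \<phi> \<psi> g (x, y)) i = \<psi> y i"
    using openin_Euclidean_space_zero[OF is_chartD(2)[OF assms(1)] imageI[OF assms(2)], of i]
    by (simp add: fst_coords_def shear_chart_def)
qed

lemma unshear_shear_chart:
  assumes "is_chart d T (V, \<psi>)" "y \<in> V"
  shows "unshear d \<psi> V g (shear_chart d \<phi> \<psi> g (x, y)) = \<phi> x"
  unfolding unshear_def fst_coords_shear_chart[OF assms] inv_into_f_f[OF is_chartD(3)[OF assms(1)] assms(2)]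
  by (simp add: snd_coords_def shear_chart_def)

text \<open>A shear by a continuous \<open>g\<close> is invertible: the first block recovers
  \<open>y\<close>, after which \<open>g y\<close> is known and can be added back to recover
  \<open>\<phi> x\<close>. The entries of \<open>g y\<close> from \<open>m\<close> on vanish, which
  keeps the differences in the model space.\<close>

lemma is_chart_shear:
  assumes c: "is_chart m S (U, \<phi>)" and d: "is_chart d T (V, \<psi>)"
    and U0: "openin (top_of_set S) U0" "U0 \<subseteq> U" and V0: "openin (top_of_set T) V0" "V0 \<subseteq> V"
    and g: "continuous_on V0 g" "\<And>y i. y \<in> V0 \<Longrightarrow> m \<le> i \<Longrightarrow> g y i = 0"
  shows "is_chart (m + d) (S \<times> T) (U0 \<times> V0, shear_chart d \<phi> \<psi> g)"
proof (rule is_chartI)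
  show "openin (top_of_set (S \<times> T)) (U0 \<times> V0)"
    using U0(1) V0(1) by (rule openin_Times)
  let ?E = "\<lambda>n. {z :: nat \<Rightarrow> real. \<forall>i\<ge>n. z i = 0}"
  define A where "A = ?E (m + d) \<inter> fst_coords d -` (\<psi> ` V0)"
  have inv: "inv_into V \<psi> (fst_coords d z) \<in> V0" if "z \<in> A" for z
    using that V0(2) is_chartD(3)[OF d] by (auto simp: A_def)
  have "openin (Euclidean_space d) (\<psi> ` V0)"
    by (rule is_chart_open_image[OF d V0])
  then have A: "openin (Euclidean_space (m + d)) A"
    unfolding A_def Euclidean_space_eq_top_of_set
    using coords_image_subset(1)[of d m]
    by (intro openin_preimage[OF _ continuous_on_fst_coords]) (auto simp: add.commute)
  have cont_inv: "continuous_on A (\<lambda>z. inv_into V \<psi> (fst_coords d z))"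
    by (rule continuous_on_compose2[OF is_chartD(5)[OF d] continuous_on_fst_coords])
      (use V0(2) in \<open>auto simp: A_def\<close>)
  have "continuous_on A (\<lambda>z. g (inv_into V \<psi> (fst_coords d z)))"
    by (rule continuous_on_compose2[OF g(1) cont_inv]) (use inv in auto)
  then have contG: "continuous_on A (unshear d \<psi> V g)"
    unfolding unshear_def
    by (intro continuous_on_coordinatewise_then_product continuous_on_add)
      (auto simp: snd_coords_def continuous_on_coordinate dest: continuous_on_product_then_coordinatewise)
  have EG: "unshear d \<psi> V g ` A \<subseteq> ?E m"
  proof clarify
    fix z i assume z: "z \<in> A" and "m \<le> i"
    then show "unshear d \<psi> V g z i = 0"
      using g(2)[OF inv[OF z], of i] by (simp add: unshear_def snd_coords_def A_def)
  qed
  have im: "shear_chart d \<phi> \<psi> g ` (U0 \<times> V0) = A \<inter> unshear d \<psi> V g -` (\<phi> ` U0)"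
  proof
    show "shear_chart d \<phi> \<psi> g ` (U0 \<times> V0) \<subseteq> A \<inter> unshear d \<psi> V g -` (\<phi> ` U0)"
    proof clarify
      fix x y assume xy: "x \<in> U0" "y \<in> V0"
      then have xy': "x \<in> U" "y \<in> V" using U0(2) V0(2) by auto
      have "shear_chart d \<phi> \<psi> g (x, y) i = 0" if "m + d \<le> i" for i
        using openin_Euclidean_space_zero[OF is_chartD(2)[OF c] imageI[OF xy'(1)], of "i - d"]
          g(2)[OF xy(2), of "i - d"] that
        by (auto simp: shear_chart_def)
      then show "shear_chart d \<phi> \<psi> g (x, y) \<in> A \<inter> unshear d \<psi> V g -` (\<phi> ` U0)"
        using xy by (simp add: A_def fst_coords_shear_chart[OF d xy'(2)] unshear_shear_chart[OF d xy'(2)])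
    qed
    show "A \<inter> unshear d \<psi> V g -` (\<phi> ` U0) \<subseteq> shear_chart d \<phi> \<psi> g ` (U0 \<times> V0)"
    proof clarify
      fix z x assume z: "z \<in> A" "unshear d \<psi> V g z = \<phi> x" "x \<in> U0"
      then obtain y where y: "y \<in> V0" "fst_coords d z = \<psi> y" by (auto simp: A_def)
      have "inv_into V \<psi> (\<psi> y) = y"
        using y(1) V0(2) is_chartD(3)[OF d] by auto
      then have G: "\<phi> x i - g y i = z (i + d)" for i
        using fun_cong[OF z(2), of i] y(2) by (simp add: unshear_def snd_coords_def)
      have "\<psi> y i = z i" if "i < d" for i
        using fun_cong[OF y(2), of i] that by (simp add: fst_coords_def)
      then have "shear_chart d \<phi> \<psi> g (x, y) = z"
        using G by (auto simp: shear_chart_def fun_eq_iff)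
      then show "z \<in> shear_chart d \<phi> \<psi> g ` (U0 \<times> V0)"
        using y(1) z(3) by (metis image_eqI mem_Sigma_iff)
    qed
  qed
  have "openin (Euclidean_space m) (\<phi> ` U0)"
    by (rule is_chart_open_image[OF c U0])
  then show "openin (Euclidean_space (m + d)) (shear_chart d \<phi> \<psi> g ` (U0 \<times> V0))"
    unfolding im Euclidean_space_eq_top_of_set
    using A contG EG unfolding Euclidean_space_eq_top_of_set by (intro openin_preimage)
  show "continuous_on (U0 \<times> V0) (shear_chart d \<phi> \<psi> g)"
  proof (rule continuous_on_coordinatewise_then_product)
    fix i
    have 1: "continuous_on (U0 \<times> V0) (\<lambda>z. \<phi> (fst z))"
      by (rule continuous_on_compose2[OF is_chartD(4)[OF c]]) (use U0(2) in \<open>auto intro: continuous_intros\<close>)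
    have 2: "continuous_on (U0 \<times> V0) (\<lambda>z. \<psi> (snd z))"
      by (rule continuous_on_compose2[OF is_chartD(4)[OF d]]) (use V0(2) in \<open>auto intro: continuous_intros\<close>)
    have 3: "continuous_on (U0 \<times> V0) (\<lambda>z. g (snd z))"
      by (rule continuous_on_compose2[OF g(1)]) (auto intro: continuous_intros)
    show "continuous_on (U0 \<times> V0) (\<lambda>z. shear_chart d \<phi> \<psi> g z i)"
      using continuous_on_product_then_coordinatewise[OF 1, of "i - d"]
        continuous_on_product_then_coordinatewise[OF 2, of i]
        continuous_on_product_then_coordinatewise[OF 3, of "i - d"]
      by (cases "i < d") (simp_all add: shear_chart_def case_prod_unfold continuous_on_diff)
  qed
  show "continuous_on (shear_chart d \<phi> \<psi> g ` (U0 \<times> V0))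
      (\<lambda>z. (inv_into U \<phi> (unshear d \<psi> V g z), inv_into V \<psi> (fst_coords d z)))"
    unfolding im
    by (intro continuous_on_Pair continuous_on_compose2[OF is_chartD(5)[OF c], of _ "unshear d \<psi> V g"]
        continuous_on_subset[OF contG] continuous_on_subset[OF cont_inv]) (use U0(2) in auto)
  show "(inv_into U \<phi> (unshear d \<psi> V g (shear_chart d \<phi> \<psi> g z)),
      inv_into V \<psi> (fst_coords d (shear_chart d \<phi> \<psi> g z))) = z" if z: "z \<in> U0 \<times> V0" for z
  proof (cases z)
    case (Pair x y)
    then have xy: "x \<in> U" "y \<in> V" using z U0(2) V0(2) by auto
    show ?thesis
      unfolding Pair fst_coords_shear_chart[OF d xy(2)] unshear_shear_chart[OF d xy(2)]
      using xy inv_into_f_f[OF is_chartD(3)[OF c]] inv_into_f_f[OF is_chartD(3)[OF d]] by simp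
  qed
qed

text \<open>Transitions into the shear chart are smooth because the sheared coordinates are smooth
  functions on the product. For transitions out of it the inverse is explicit, with
  \<open>inv_into U \<phi>\<close> after \<open>unshear\<close> and \<open>inv_into V \<psi>\<close>
  after \<open>fst_coords\<close>.\<close>

lemma shear_chart_in_maximal_atlas:
  assumes N: "smooth_manifold N" and P: "smooth_manifold P"
    and U: "(U, \<phi>) \<in> atlas N" and V: "(V, \<psi>) \<in> atlas P"
    and U0: "openin (top_of_set (pts N)) U0" "U0 \<subseteq> U" and V0: "openin (top_of_set (pts P)) V0" "V0 \<subseteq> V"
    and g: "continuous_on V0 g" "\<And>y i. y \<in> V0 \<Longrightarrow> mdim N \<le> i \<Longrightarrow> g y i = 0"
      "\<And>i. i < mdim N \<Longrightarrow> smooth_fun_on P V0 (\<lambda>y. g y i)"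
  shows "(U0 \<times> V0, shear_chart (mdim P) \<phi> \<psi> g) \<in> maximal_atlas (prod_manifold N P)"
proof -
  define m where "m = mdim N"
  define d where "d = mdim P"
  let ?\<Phi> = "shear_chart d \<phi> \<psi> g" and ?G = "unshear d \<psi> V g"
  note cN = smooth_manifold_imp_charted[OF N] and cP = smooth_manifold_imp_charted[OF P]
  note c = chartedD[OF cN U, folded m_def] and e = chartedD[OF cP V, folded d_def]
  have shear: "is_chart (m + d) (pts N \<times> pts P) (U0 \<times> V0, ?\<Phi>)"
    using is_chart_shear[OF c e U0 V0 g(1)] g(2) by (simp add: m_def)
  have smooth: "smooth_fun_on (prod_manifold N P) (U0 \<times> V0) (\<lambda>z. ?\<Phi> z i)" if i: "i < m + d" for i
  proof (cases "i < d")
    case True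
    have "smooth_fun_on P V0 (\<lambda>y. \<psi> y i)"
      using smooth_fun_on_subset[OF smooth_fun_on_chart_coord[OF P V]] True V0(2) by (simp add: d_def)
    from smooth_fun_on_snd[OF N P V0(1) this]
    have "smooth_fun_on (prod_manifold N P) (U0 \<times> V0) (\<lambda>z. \<psi> (snd z) i)"
      by (rule smooth_fun_on_subset) (use openin_imp_subset[OF U0(1)] in blast)
    then show ?thesis using True by (simp add: shear_chart_def case_prod_unfold)
  next
    case False
    then have j: "i - d < mdim N" using i by (simp add: m_def)
    have "smooth_fun_on N U0 (\<lambda>x. \<phi> x (i - d))"
      using smooth_fun_on_subset[OF smooth_fun_on_chart_coord[OF N U j]] U0(2) by simp
    from smooth_fun_on_fst[OF N P U0(1) this]
    have 1: "smooth_fun_on (prod_manifold N P) (U0 \<times> V0) (\<lambda>z. \<phi> (fst z) (i - d))"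
      by (rule smooth_fun_on_subset) (use openin_imp_subset[OF V0(1)] in blast)
    from smooth_fun_on_snd[OF N P V0(1) g(3)[OF j]]
    have 2: "smooth_fun_on (prod_manifold N P) (U0 \<times> V0) (\<lambda>z. g (snd z) (i - d))"
      by (rule smooth_fun_on_subset) (use openin_imp_subset[OF U0(1)] in blast)
    show ?thesis
      using False smooth_fun_on_diff[OF 1 2] by (simp add: shear_chart_def case_prod_unfold)
  qed
  have trans: "smooth_transition (m + d) (U0 \<times> V0, ?\<Phi>) b \<and> smooth_transition (m + d) b (U0 \<times> V0, ?\<Phi>)"
    if b: "b \<in> atlas (prod_manifold N P)" for b
  proof -
    obtain U1 \<phi>1 V1 \<psi>1 where b_eq: "b = (U1 \<times> V1, prod_chart m \<phi>1 \<psi>1)"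
      and U1: "(U1, \<phi>1) \<in> atlas N" and V1: "(V1, \<psi>1) \<in> atlas P"
      using b by (auto simp: atlas_prod_manifold m_def)
    note c1 = chartedD[OF cN U1] and e1 = chartedD[OF cP V1]
    have 2: "smooth_transition (m + d) b (U0 \<times> V0, ?\<Phi>)"
      unfolding b_eq smooth_transition_def prod.case
    proof (intro allI impI)
      fix i assume "i < m + d"
      from smooth_fun_onD[OF smooth[OF this] b[unfolded b_eq]]
      show "smooth_real_on (m + d) (prod_chart m \<phi>1 \<psi>1 ` (U1 \<times> V1 \<inter> U0 \<times> V0))
          (\<lambda>y. ?\<Phi> (inv_into (U1 \<times> V1) (prod_chart m \<phi>1 \<psi>1) y) i)"
        by (simp add: prod_manifold_simps m_def d_def)
    qed
    define A where "A = U0 \<times> V0 \<inter> U1 \<times> V1"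
    have "openin (top_of_set (pts N \<times> pts P)) A"
      unfolding A_def using U0(1) V0(1) is_chartD(1)[OF c1] is_chartD(1)[OF e1]
      by (intro openin_Int openin_Times)
    then have oA: "openin (Euclidean_space (m + d)) (?\<Phi> ` A)"
      by (rule is_chart_open_image[OF shear]) (auto simp: A_def)
    have inv: "inv_into (U0 \<times> V0) ?\<Phi> y = (inv_into U \<phi> (?G y), inv_into V \<psi> (fst_coords d y))"
      if y: "y \<in> ?\<Phi> ` A" for y
    proof -
      obtain a b where ab: "a \<in> U0" "b \<in> V0" "y = ?\<Phi> (a, b)" using y by (auto simp: A_def)
      then have ab': "a \<in> U" "b \<in> V" using U0(2) V0(2) by auto
      show ?thesis
        unfolding ab(3) fst_coords_shear_chart[OF e ab'(2)] unshear_shear_chart[OF e ab'(2)]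
        using inv_into_f_f[OF is_chartD(3)[OF shear], of "(a, b)"] ab(1,2)
          inv_into_f_f[OF is_chartD(3)[OF c] ab'(1)] inv_into_f_f[OF is_chartD(3)[OF e] ab'(2)] by simp
    qed
    have im1: "fst_coords d ` ?\<Phi> ` A \<subseteq> \<psi> ` (V0 \<inter> V1)"
    proof clarify
      fix x y assume "(x, y) \<in> A"
      then show "fst_coords d (?\<Phi> (x, y)) \<in> \<psi> ` (V0 \<inter> V1)"
        using V0(2) by (subst fst_coords_shear_chart[OF e]) (auto simp: A_def)
    qed
    have im2: "?G ` ?\<Phi> ` A \<subseteq> \<phi> ` (U0 \<inter> U1)"
    proof clarify
      fix x y assume "(x, y) \<in> A"
      then show "?G (?\<Phi> (x, y)) \<in> \<phi> ` (U0 \<inter> U1)"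
        using V0(2) by (subst unshear_shear_chart[OF e]) (auto simp: A_def)
    qed
    have oV: "openin (Euclidean_space d) (\<psi> ` (V0 \<inter> V1))"
      using V0 is_chartD(1)[OF e1] by (intro is_chart_open_image[OF e] openin_Int) auto
    have oV0: "openin (Euclidean_space d) (\<psi> ` V0)"
      by (rule is_chart_open_image[OF e V0])
    have oU: "openin (Euclidean_space m) (\<phi> ` (U0 \<inter> U1))"
      using U0 is_chartD(1)[OF c1] by (intro is_chart_open_image[OF c] openin_Int) auto
    have "smooth_real_on (m + d) (?\<Phi> ` A)
        (\<lambda>y. prod_chart m \<phi>1 \<psi>1 (inv_into U \<phi> (?G y), inv_into V \<psi> (fst_coords d y)) i)"
      if i: "i < m + d" for i
    proof (cases "i < m")
      case True
      have f: "smooth_real_on m (\<phi> ` (U0 \<inter> U1)) (\<lambda>w. \<phi>1 (inv_into U \<phi> w) i)"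
        using smooth_fun_onD[OF smooth_fun_on_chart_coord[OF N U1 True[unfolded m_def]] U]
        unfolding m_def by (rule smooth_real_on_mono) (use U0(2) in auto)
      have "smooth_real_on (m + d) (?\<Phi> ` A) (\<lambda>y. ?G y j)" if j: "j < m" for j
        unfolding unshear_def
      proof (rule smooth_real_on_add)
        show "smooth_real_on (m + d) (?\<Phi> ` A) (\<lambda>y. snd_coords d y j)"
          by (simp add: snd_coords_def smooth_real_on_coord)
        have "smooth_real_on d (\<psi> ` V0) (\<lambda>w. g (inv_into V \<psi> w) j)"
          using smooth_fun_onD[OF g(3) V, of j] j V0(2) by (simp add: m_def d_def Int_absorb1)
        then show "smooth_real_on (m + d) (?\<Phi> ` A) (\<lambda>y. g (inv_into V \<psi> (fst_coords d y)) j)"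
          by (rule smooth_real_on_compose_fst_coords[OF oV0 oA, rotated]) (use im1 in blast)
      qed
      then have "smooth_real_on (m + d) (?\<Phi> ` A) (\<lambda>y. \<phi>1 (inv_into U \<phi> (?G y)) i)"
        by (rule smooth_real_on_compose[OF oU oA im2 f])
      then show ?thesis using True by (simp add: prod_chart_def)
    next
      case False
      have "smooth_real_on d (\<psi> ` (V0 \<inter> V1)) (\<lambda>w. \<psi>1 (inv_into V \<psi> w) (i - m))"
      proof -
        have "i - m < mdim P" using False i by (simp add: d_def)
        from smooth_fun_onD[OF smooth_fun_on_chart_coord[OF P V1 this] V]
        show ?thesis
          unfolding d_def by (rule smooth_real_on_mono) (use V0(2) in auto)
      qed
      then have "smooth_real_on (m + d) (?\<Phi> ` A) (\<lambda>y. \<psi>1 (inv_into V \<psi> (fst_coords d y)) (i - m))"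
        by (rule smooth_real_on_compose_fst_coords[OF oV oA im1])
      then show ?thesis using False by (simp add: prod_chart_def)
    qed
    then have "smooth_real_on (m + d) (?\<Phi> ` A)
        (\<lambda>y. prod_chart m \<phi>1 \<psi>1 (inv_into (U0 \<times> V0) ?\<Phi> y) i)" if i: "i < m + d" for i
      by (rule smooth_real_on_eq[OF _ oA]) (simp_all only: i inv)
    then have 1: "smooth_transition (m + d) (U0 \<times> V0, ?\<Phi>) b"
      unfolding b_eq smooth_transition_def prod.case A_def by blast
    show ?thesis using 1 2 by blast
  qed
  show ?thesis
    using shear trans by (simp add: maximal_atlas_def prod_manifold_simps flip: m_def d_def)
qed

section \<open>Invariance of dimension\<close>

text \<open>If \<open>mdim M < mdim N\<close>, then in coordinates \<open>f\<close> is a continuous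
  injection of a nonempty open set of the larger model space into a proper coordinate subspace of
  it. By invariance of domain the image would be open.\<close>

lemma mdim_le_of_injective:
  assumes N: "charted N" and M: "charted M" and f: "smooth_map_on N M W f" "inj_on f W" and n: "n \<in> W"
  shows "mdim N \<le> mdim M"
proof (rule ccontr)
  assume "\<not> mdim N \<le> mdim M"
  then have less: "mdim M < mdim N" by simp
  have W: "openin (top_of_set (pts N)) W" "continuous_on W f" "f ` W \<subseteq> pts M"
    using f(1) by (auto simp: smooth_map_on_def)
  obtain U \<phi> where U: "(U, \<phi>) \<in> atlas N" "n \<in> U"
    using charted_coverE[OF N] openin_imp_subset[OF W(1)] n by blast
  obtain V \<psi> where V: "(V, \<psi>) \<in> atlas M" "f n \<in> V"
    using charted_coverE[OF M] W(3) n by blast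
  note c = chartedD[OF N U(1)] and d = chartedD[OF M V(1)]
  define A where "A = U \<inter> (W \<inter> f -` V)"
  have A: "openin (top_of_set (pts N)) A"
    unfolding A_def using is_chartD(1)[OF c] openin_preimage[OF W is_chartD(1)[OF d]] by (rule openin_Int)
  have A': "openin (Euclidean_space (mdim N)) (\<phi> ` A)"
    by (rule is_chart_open_image[OF c A]) (simp add: A_def)
  define F where "F y = \<psi> (f (inv_into U \<phi> y))" for y
  have inv: "inv_into U \<phi> y \<in> A" if "y \<in> \<phi> ` A" for y
    using that is_chartD(3)[OF c] by (auto simp: A_def)
  have "continuous_on (\<phi> ` A) (inv_into U \<phi>)"
    using is_chartD(5)[OF c] by (rule continuous_on_subset) (auto simp: A_def)
  then have "continuous_on (\<phi> ` A) (\<lambda>y. f (inv_into U \<phi> y))"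
    by (rule continuous_on_compose2[OF W(2)]) (use inv in \<open>auto simp: A_def\<close>)
  then have cont: "continuous_on (\<phi> ` A) F"
    unfolding F_def
    by (rule continuous_on_compose2[OF is_chartD(4)[OF d]]) (use inv in \<open>auto simp: A_def\<close>)
  have FM: "F y i = 0" if "y \<in> \<phi> ` A" "mdim M \<le> i" for y i
    unfolding F_def
    by (rule openin_Euclidean_space_zero[OF is_chartD(2)[OF d] _ that(2)])
      (use inv[OF that(1)] in \<open>auto simp: A_def\<close>)
  have "inj_on F (\<phi> ` A)"
  proof (rule inj_onI)
    fix y z assume yz: "y \<in> \<phi> ` A" "z \<in> \<phi> ` A" "F y = F z"
    then have "inv_into U \<phi> y = inv_into U \<phi> z"
      using inv[OF yz(1)] inv[OF yz(2)] inj_onD[OF is_chartD(3)[OF d]] inj_onD[OF f(2)]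
      unfolding F_def A_def by (metis IntD1 IntD2 vimageD)
    moreover have "\<phi> ` A \<subseteq> \<phi> ` U" by (auto simp: A_def)
    ultimately show "y = z"
      using yz(1,2) inv_into_injective by (metis subsetD)
  qed
  moreover have "continuous_map (subtopology (Euclidean_space (mdim N)) (\<phi> ` A)) (Euclidean_space (mdim N)) F"
  proof -
    have "\<phi> ` A \<subseteq> topspace (Euclidean_space (mdim N))"
      using A' by (rule openin_subset)
    then have "topspace (subtopology (Euclidean_space (mdim N)) (\<phi> ` A)) = \<phi> ` A"
      by auto
    then show ?thesis
      using cont FM less
      by (simp add: cm_Euclidean_space_iff_continuous_on topspace_Euclidean_space Pi_iff)
  qed
  ultimately have open_image: "openin (Euclidean_space (mdim N)) (F ` \<phi> ` A)"
    using A' by (intro invariance_of_domain_Euclidean_space)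
  define y where "y = F (\<phi> n)"
  have y: "y \<in> F ` \<phi> ` A" using U(2) V(2) n by (auto simp: y_def A_def)
  obtain e where e: "0 < e"
    "\<forall>z. (\<forall>i\<ge>mdim N. z i = 0) \<longrightarrow> (\<forall>i<mdim N. \<bar>z i - y i\<bar> < e) \<longrightarrow> z \<in> F ` \<phi> ` A"
    using openin_Euclidean_space_box[OF open_image y] .
  have "y i = 0" if "mdim M \<le> i" for i
    using y FM that by auto
  \<comment> \<open>Within the open image the coordinate of index \<open>mdim M\<close> can be moved
    off 0, although \<open>F\<close> takes only values where this coordinate is 0.\<close>
  then have "y(mdim M := e / 2) \<in> F ` \<phi> ` A"
    using e less by (intro e(2)[rule_format]) auto
  then obtain z where "z \<in> \<phi> ` A" "F z = y(mdim M := e / 2)" by force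
  then show False using FM[of z "mdim M"] e(1) by simp
qed

lemma mdim_diffeo:
  assumes "charted N" "charted M" "diffeo_on N M W f" "n \<in> W"
  shows "mdim N = mdim M"
proof (rule antisym)
  show "mdim N \<le> mdim M"
    using assms mdim_le_of_injective[of N M W f n] by (simp add: diffeo_on_def)
  show "mdim M \<le> mdim N"
    using assms mdim_le_of_injective[of M N "f ` W" "inv_into W f" "f n"]
    by (simp add: diffeo_on_def inj_on_inv_into)
qed

section \<open>Slice charts of the fibre product\<close>

lemma diffeo_on_inverse:
  assumes "diffeo_on N M W f"
  shows "openin (top_of_set (pts N)) W" "openin (top_of_set (pts M)) (f ` W)"
    "continuous_on W f" "continuous_on (f ` W) (inv_into W f)" "inj_on f W"
    "smooth_map_on M N (f ` W) (inv_into W f)"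
  using assms by (auto simp: diffeo_on_def smooth_map_on_def)

definition fibre_product ::
  "'n::topological_space manifold \<Rightarrow> ('n \<Rightarrow> 'm) \<Rightarrow> 'p::topological_space manifold \<Rightarrow> ('p \<Rightarrow> 'm) \<Rightarrow> ('n \<times> 'p) set" where
  "fibre_product N q P p = {(n, x). n \<in> pts N \<and> x \<in> pts P \<and> q n = p x}"

definition slice_chart :: "'a::topological_space manifold \<Rightarrow> 'a set \<Rightarrow> nat \<Rightarrow> 'a chart \<Rightarrow> bool" where
  "slice_chart M S k c \<longleftrightarrow> c \<in> maximal_atlas M \<and>
     snd c ` (fst c \<inter> S) = snd c ` fst c \<inter> topspace (Euclidean_space k)"

lemma atlas_submanifold:
  "c \<in> atlas (submanifold M S k) \<longleftrightarrow> (\<exists>U \<phi>. c = (U \<inter> S, \<phi>) \<and> slice_chart M S k (U, \<phi>))"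
  by (auto simp: submanifold_def slice_chart_def)

lemma submanifold_simps: "pts (submanifold M S k) = S" "mdim (submanifold M S k) = k"
  by (simp_all add: submanifold_def)

text \<open>
  Near a point of the fibre product, \<open>q n = p x\<close> reads \<open>n = \<sigma> (p x)\<close> for a local inverse \<open>\<sigma>\<close> of \<open>q\<close>.
\<close>

lemma fibre_product_slice_chart:
  assumes N: "smooth_manifold N" and P: "smooth_manifold P" and M: "charted M"
    and p: "smooth_map P M p" and q: "diffeo_on N M W q"
    and n: "n \<in> W" and x: "x \<in> pts P" and nx: "q n = p x"
  shows "\<exists>U \<phi>. slice_chart (prod_manifold N P) (fibre_product N q P p) (mdim P) (U, \<phi>) \<and> (n, x) \<in> U"
proof -
  note cN = smooth_manifold_imp_charted[OF N] and cP = smooth_manifold_imp_charted[OF P]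
  note qW = diffeo_on_inverse[OF q]
  define \<sigma> where "\<sigma> = inv_into W q"
  have \<sigma>: "smooth_map_on M N (q ` W) \<sigma>" "continuous_on (q ` W) \<sigma>" "\<sigma> ` q ` W \<subseteq> W"
    using qW inv_into_into[of _ q W] by (auto simp: \<sigma>_def)
  have \<sigma>q: "\<sigma> (q a) = a" if "a \<in> W" for a
    using that qW(5) by (simp add: \<sigma>_def)
  have q\<sigma>: "q (\<sigma> b) = b" if "b \<in> q ` W" for b
    using that by (simp add: \<sigma>_def f_inv_into_f)
  have p': "continuous_on (pts P) p" "p ` pts P \<subseteq> pts M"
    using p by (auto simp: smooth_map_on_def)
  obtain U \<phi> where U: "(U, \<phi>) \<in> atlas N" "n \<in> U"
    using charted_coverE[OF cN] openin_imp_subset[OF qW(1)] n by blast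
  obtain V \<psi> where V: "(V, \<psi>) \<in> atlas P" "x \<in> V"
    using charted_coverE[OF cP x] .
  note c = chartedD[OF cN U(1)] and d = chartedD[OF cP V(1)]
  define U0 where "U0 = U \<inter> W"
  \<comment> \<open>\<open>D\<close> consists of the points that the local inverse
    \<open>\<sigma>\<close> sends into the chart domain \<open>U\<close>, so on \<open>V0\<close>
    the composition \<open>\<sigma> \<circ> p\<close> can be expressed in the coordinates
    \<open>\<phi>\<close>.\<close>
  define D where "D = q ` W \<inter> \<sigma> -` U"
  define V0 where "V0 = V \<inter> (pts P \<inter> p -` D)"
  have U0: "openin (top_of_set (pts N)) U0" "U0 \<subseteq> U"
    unfolding U0_def using is_chartD(1)[OF c] qW(1) by (auto intro: openin_Int)
  have D: "openin (top_of_set (pts M)) D"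
    unfolding D_def using \<sigma> openin_imp_subset[OF qW(1)]
    by (intro openin_preimage[OF qW(2) _ _ is_chartD(1)[OF c]]) auto
  have "openin (top_of_set (pts P)) (pts P \<inter> p -` D)"
    by (rule openin_preimage[OF _ p' D]) simp
  then have V0: "openin (top_of_set (pts P)) V0" "V0 \<subseteq> V"
    unfolding V0_def using is_chartD(1)[OF d] by (auto intro: openin_Int)
  \<comment> \<open>With this \<open>g\<close> the sheared coordinates of index at least
    \<open>mdim P\<close> measure how far the point of \<open>N\<close> is from
    \<open>\<sigma> (p y)\<close>; they all vanish exactly on the fibre product.\<close>
  define g where "g y = \<phi> (\<sigma> (p y))" for y
  have \<sigma>p: "\<sigma> (p y) \<in> U0" if "y \<in> V0" for y
    using that \<sigma>(3) by (auto simp: V0_def D_def U0_def)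
  have cg: "continuous_on V0 g"
  proof -
    have "continuous_on V0 p"
      using p'(1) by (rule continuous_on_subset) (auto simp: V0_def)
    then have "continuous_on V0 (\<lambda>y. \<sigma> (p y))"
      by (rule continuous_on_compose2[OF \<sigma>(2)]) (auto simp: V0_def D_def)
    then show ?thesis
      unfolding g_def
      by (rule continuous_on_compose2[OF is_chartD(4)[OF c]]) (use \<sigma>p U0(2) in auto)
  qed
  have g0: "g y i = 0" if "y \<in> V0" "mdim N \<le> i" for y i
    unfolding g_def
    by (rule openin_Euclidean_space_zero[OF is_chartD(2)[OF c] _ that(2)])
      (use \<sigma>p[OF that(1)] U0(2) in auto)
  have sg: "smooth_fun_on P V0 (\<lambda>y. g y i)" if "i < mdim N" for i
  proof -
    have "smooth_fun_on M D (\<lambda>z. \<phi> (\<sigma> z) i)"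
      unfolding D_def by (rule smooth_fun_on_map_coord[OF \<sigma>(1) U(1) that])
    from smooth_fun_on_compose[OF cP M p D this]
    show ?thesis
      unfolding g_def by (rule smooth_fun_on_subset) (auto simp: V0_def)
  qed
  let ?\<Phi> = "shear_chart (mdim P) \<phi> \<psi> g" and ?S = "fibre_product N q P p"
  have "(U0 \<times> V0, ?\<Phi>) \<in> maximal_atlas (prod_manifold N P)"
    by (rule shear_chart_in_maximal_atlas[OF N P U(1) V(1) U0 V0 cg g0 sg])
  moreover have "z \<in> ?S \<longleftrightarrow> ?\<Phi> z \<in> topspace (Euclidean_space (mdim P))" if z: "z \<in> U0 \<times> V0" for z
  proof (cases z)
    case (Pair a y)
    then have a: "a \<in> U" "a \<in> W" "y \<in> V0" "p y \<in> q ` W"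
      using z by (auto simp: U0_def V0_def D_def)
    have "?\<Phi> z \<in> topspace (Euclidean_space (mdim P)) \<longleftrightarrow> (\<forall>i\<ge>mdim P. \<phi> a (i - mdim P) - g y (i - mdim P) = 0)"
      by (auto simp: topspace_Euclidean_space shear_chart_def Pair)
    also have "\<dots> \<longleftrightarrow> (\<forall>i. \<phi> a i = g y i)"
      by (metis diff_add_inverse2 eq_iff_diff_eq_0 le_add2)
    also have "\<dots> \<longleftrightarrow> \<phi> a = \<phi> (\<sigma> (p y))"
      by (auto simp: g_def)
    also have "\<dots> \<longleftrightarrow> a = \<sigma> (p y)"
      using \<sigma>p[OF a(3)] U0(2) a(1) is_chartD(3)[OF c] by (auto dest: inj_onD)
    also have "\<dots> \<longleftrightarrow> q a = p y"
      using \<sigma>q[OF a(2)] q\<sigma>[OF a(4)] by auto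
    also have "\<dots> \<longleftrightarrow> z \<in> ?S"
      using a openin_imp_subset[OF qW(1)] openin_imp_subset[OF V0(1)] by (auto simp: Pair fibre_product_def)
    finally show ?thesis by simp
  qed
  then have "?\<Phi> ` (U0 \<times> V0 \<inter> ?S) = ?\<Phi> ` (U0 \<times> V0) \<inter> topspace (Euclidean_space (mdim P))"
    by blast
  ultimately have "slice_chart (prod_manifold N P) ?S (mdim P) (U0 \<times> V0, ?\<Phi>)"
    by (simp add: slice_chart_def)
  moreover have "(n, x) \<in> U0 \<times> V0"
    using U(2) V(2) n x \<sigma>q[OF n] by (auto simp: U0_def V0_def D_def simp flip: nx)
  ultimately show ?thesis by blast
qed

section \<open>Charts, functions and curves on submanifolds\<close>

lemma is_chart_slice:
  assumes S: "S \<subseteq> pts M" and k: "k \<le> mdim M" and c: "slice_chart M S k (U, \<phi>)"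
  shows "is_chart k S (U \<inter> S, \<phi>)"
proof (rule is_chartI)
  have U: "is_chart (mdim M) (pts M) (U, \<phi>)"
    using c by (simp add: slice_chart_def maximal_atlas_def)
  show "openin (top_of_set S) (U \<inter> S)"
    using is_chartD(1)[OF U] S by (auto simp: openin_open)
  have "{z :: nat \<Rightarrow> real. \<forall>i\<ge>k. z i = 0} \<subseteq> {z. \<forall>i\<ge>mdim M. z i = 0}"
    using k by auto
  moreover obtain X where X: "open X" "\<phi> ` U = {z. \<forall>i\<ge>mdim M. z i = 0} \<inter> X"
    using is_chartD(2)[OF U] by (auto simp: Euclidean_space_eq_top_of_set openin_open)
  ultimately have "\<phi> ` (U \<inter> S) = {z. \<forall>i\<ge>k. z i = 0} \<inter> X"
    using c by (auto simp: slice_chart_def topspace_Euclidean_space)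
  then show "openin (Euclidean_space k) (\<phi> ` (U \<inter> S))"
    using X(1) by (auto simp: Euclidean_space_eq_top_of_set openin_open)
  show "continuous_on (U \<inter> S) \<phi>" "continuous_on (\<phi> ` (U \<inter> S)) (inv_into U \<phi>)"
    using is_chartD(4,5)[OF U] by (auto intro: continuous_on_subset)
  show "inv_into U \<phi> (\<phi> x) = x" if "x \<in> U \<inter> S" for x
    using that is_chartD(3)[OF U] by simp
qed

text \<open>The atlas of \<open>submanifold\<close> contains only those slice charts that exist, so
  that they cover \<open>S\<close> is a genuine hypothesis.\<close>

lemma charted_submanifold:
  assumes S: "S \<subseteq> pts M" and k: "k \<le> mdim M"
    and cover: "\<And>x. x \<in> S \<Longrightarrow> \<exists>U \<phi>. slice_chart M S k (U, \<phi>) \<and> x \<in> U"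
  shows "charted (submanifold M S k)"
  unfolding charted_def submanifold_simps
proof (intro conjI ballI)
  show "is_chart k S c" if "c \<in> atlas (submanifold M S k)" for c
    using that is_chart_slice[OF S k] by (auto simp: atlas_submanifold)
  show "(\<Union>c\<in>atlas (submanifold M S k). fst c) = S"
  proof
    show "(\<Union>c\<in>atlas (submanifold M S k). fst c) \<subseteq> S"
      by (auto simp: atlas_submanifold)
    show "S \<subseteq> (\<Union>c\<in>atlas (submanifold M S k). fst c)"
    proof
      fix x assume x: "x \<in> S"
      then obtain U \<phi> where "slice_chart M S k (U, \<phi>)" "x \<in> U" using cover by blast
      then have "(U \<inter> S, \<phi>) \<in> atlas (submanifold M S k)" "x \<in> fst (U \<inter> S, \<phi>)"
        using x by (auto simp: atlas_submanifold)
      then show "x \<in> (\<Union>c\<in>atlas (submanifold M S k). fst c)" by blast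
    qed
  qed
qed

text \<open>The model space of dimension \<open>k\<close> is a subset of the one of dimension
  \<open>mdim M\<close>, with the first \<open>k\<close> of its partial derivatives. Restricting to
  a slice therefore only shrinks the domain and the list of directions, as in
  \<open>smooth_real_on_mono\<close>.\<close>

lemma smooth_fun_on_submanifold:
  assumes M: "charted M" and S: "S \<subseteq> pts M" and k: "k \<le> mdim M"
    and D: "openin (top_of_set (pts M)) D" and h: "smooth_fun_on M D h"
  shows "smooth_fun_on (submanifold M S k) (S \<inter> D) h"
  unfolding smooth_fun_on_def submanifold_simps
proof clarify
  fix U' \<phi> assume "(U', \<phi>) \<in> atlas (submanifold M S k)"
  then obtain U where U': "U' = U \<inter> S" and c: "slice_chart M S k (U, \<phi>)"
    by (auto simp: atlas_submanifold)
  have max: "(U, \<phi>) \<in> maximal_atlas M" using c by (simp add: slice_chart_def)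
  then have U: "is_chart (mdim M) (pts M) (U, \<phi>)" by (simp add: maximal_atlas_def)
  note slice = is_chart_slice[OF S k c]
  have "openin (top_of_set S) (S \<inter> D)"
    using D S by (auto simp: openin_open)
  then have "openin (top_of_set S) (U' \<inter> (S \<inter> D))"
    unfolding U' by (rule openin_Int[OF is_chartD(1)[OF slice]])
  then have o: "openin (Euclidean_space k) (\<phi> ` (U' \<inter> (S \<inter> D)))"
    by (rule is_chart_open_image[OF slice]) (auto simp: U')
  have "smooth_real_on k (\<phi> ` (U' \<inter> (S \<inter> D))) (\<lambda>y. h (inv_into U \<phi> y))"
    using smooth_fun_on_maximal_atlas[OF M max D h] by (rule smooth_real_on_mono) (use k in \<open>auto simp: U'\<close>)
  then show "smooth_real_on k (\<phi> ` (U' \<inter> (S \<inter> D))) (\<lambda>y. h (inv_into U' \<phi> y))"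
  proof (rule smooth_real_on_eq[OF _ o])
    fix y assume "y \<in> \<phi> ` (U' \<inter> (S \<inter> D))"
    then obtain a where a: "a \<in> U'" "y = \<phi> a" by blast
    then have "inv_into U' \<phi> y = a" "inv_into U \<phi> y = a"
      using is_chartD(3)[OF slice] is_chartD(3)[OF U] by (auto simp: U')
    then show "h (inv_into U \<phi> y) = h (inv_into U' \<phi> y)" by simp
  qed
qed

text \<open>A chart of the submanifold restricts a chart of the maximal atlas of \<open>M\<close>,
  whose coordinates are smooth functions on an open set of \<open>M\<close>;
  \<open>C1_curve_compose\<close> evaluates them along the curve.\<close>

lemma C1_curve_submanifold:
  assumes M: "charted M" and k: "k \<le> mdim M" and "a < b"
    and \<gamma>: "C1_curve_on M \<gamma> a b" "\<gamma> ` {a..b} \<subseteq> S"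
  shows "C1_curve_on (submanifold M S k) \<gamma> a b"
  unfolding C1_curve_on_alt submanifold_simps
proof (intro conjI)
  show "continuous_on {a..b} \<gamma>" "\<gamma> ` {a..b} \<subseteq> S"
    using \<gamma> by (auto simp: C1_curve_on_def)
  show "\<forall>(U, \<phi>)\<in>atlas (submanifold M S k). \<forall>i<k.
      C1_fun_on a b ({a..b} \<inter> \<gamma> -` U) (\<lambda>s. \<phi> (\<gamma> s) i)"
  proof clarify
    fix U' \<phi> i assume "(U', \<phi>) \<in> atlas (submanifold M S k)" and i: "i < k"
    then obtain U where U': "U' = U \<inter> S" and c: "(U, \<phi>) \<in> maximal_atlas M"
      by (auto simp: atlas_submanifold slice_chart_def)
    have U: "openin (top_of_set (pts M)) U"
      using c is_chartD(1) by (auto simp: maximal_atlas_def)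
    have "smooth_fun_on M U (\<lambda>x. \<phi> x i)"
      unfolding smooth_fun_on_def
    proof clarify
      fix V \<psi> assume "(V, \<psi>) \<in> atlas M"
      then have "smooth_transition (mdim M) (V, \<psi>) (U, \<phi>)"
        using c by (auto simp: maximal_atlas_def)
      then show "smooth_real_on (mdim M) (\<psi> ` (V \<inter> U)) (\<lambda>y. \<phi> (inv_into V \<psi> y) i)"
        using i k by (simp add: smooth_transition_def)
    qed
    from C1_curve_compose[OF M \<open>a < b\<close> \<gamma>(1) U this]
    show "C1_fun_on a b ({a..b} \<inter> \<gamma> -` U') (\<lambda>s. \<phi> (\<gamma> s) i)"
      by (rule C1_fun_on_subset) (auto simp: U')
  qed
qed

section \<open>Curves in products and along local diffeomorphisms\<close>

lemma C1_curve_Pair: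
  assumes "C1_curve_on M \<alpha> a b" "C1_curve_on N \<beta> a b"
  shows "C1_curve_on (prod_manifold M N) (\<lambda>t. (\<alpha> t, \<beta> t)) a b"
  unfolding C1_curve_on_alt prod_manifold_simps
proof (intro conjI)
  show "continuous_on {a..b} (\<lambda>t. (\<alpha> t, \<beta> t))" "(\<lambda>t. (\<alpha> t, \<beta> t)) ` {a..b} \<subseteq> pts M \<times> pts N"
    using assms by (auto simp: C1_curve_on_def intro: continuous_on_Pair)
  show "\<forall>(U, \<phi>)\<in>atlas (prod_manifold M N). \<forall>i<mdim M + mdim N.
      C1_fun_on a b ({a..b} \<inter> (\<lambda>t. (\<alpha> t, \<beta> t)) -` U) (\<lambda>s. \<phi> (\<alpha> s, \<beta> s) i)"
  proof clarify
    fix A \<kappa> i assume "(A, \<kappa>) \<in> atlas (prod_manifold M N)" and i: "i < mdim M + mdim N"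
    then obtain U \<phi> V \<psi> where A: "A = U \<times> V" "\<kappa> = prod_chart (mdim M) \<phi> \<psi>"
      and U: "(U, \<phi>) \<in> atlas M" and V: "(V, \<psi>) \<in> atlas N"
      by (auto simp: atlas_prod_manifold)
    show "C1_fun_on a b ({a..b} \<inter> (\<lambda>t. (\<alpha> t, \<beta> t)) -` A) (\<lambda>s. \<kappa> (\<alpha> s, \<beta> s) i)"
    proof (cases "i < mdim M")
      case True
      then have "C1_fun_on a b ({a..b} \<inter> \<alpha> -` U) (\<lambda>s. \<phi> (\<alpha> s) i)"
        using assms(1) U unfolding C1_curve_on_alt by blast
      then have "C1_fun_on a b ({a..b} \<inter> (\<lambda>t. (\<alpha> t, \<beta> t)) -` A) (\<lambda>s. \<phi> (\<alpha> s) i)"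
        by (rule C1_fun_on_subset) (auto simp: A)
      then show ?thesis using True by (simp add: A prod_chart_def)
    next
      case False
      then have "i - mdim M < mdim N" using i by simp
      then have "C1_fun_on a b ({a..b} \<inter> \<beta> -` V) (\<lambda>s. \<psi> (\<beta> s) (i - mdim M))"
        using assms(2) V unfolding C1_curve_on_alt by blast
      then have "C1_fun_on a b ({a..b} \<inter> (\<lambda>t. (\<alpha> t, \<beta> t)) -` A) (\<lambda>s. \<psi> (\<beta> s) (i - mdim M))"
        by (rule C1_fun_on_subset) (auto simp: A)
      then show ?thesis using False by (simp add: A prod_chart_def)
    qed
  qed
qed

text \<open>Near each parameter \<open>r = \<sigma> \<circ> p \<circ> \<gamma>\<close> for a local
  inverse \<open>\<sigma>\<close> of \<open>q\<close>, because continuity keeps \<open>r\<close> in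
  the set on which \<open>\<sigma>\<close> inverts \<open>q\<close>. Differentiability is thus
  inherited from \<open>\<gamma>\<close>.\<close>

lemma C1_curve_lift:
  assumes N: "smooth_manifold N" and P: "charted P" and M: "charted M"
    and p: "smooth_map P M p" and q: "local_diffeo N M q" and "a < b"
    and \<gamma>: "C1_curve_on P \<gamma> a b" and r: "continuous_on {a..b} r" "r ` {a..b} \<subseteq> pts N"
    and eq: "\<And>t. t \<in> {a..b} \<Longrightarrow> q (r t) = p (\<gamma> t)"
  shows "C1_curve_on N r a b"
  unfolding C1_curve_on_alt
proof (intro conjI r)
  note cN = smooth_manifold_imp_charted[OF N]
  have p': "continuous_on (pts P) p" "p ` pts P \<subseteq> pts M"
    using p by (auto simp: smooth_map_on_def)
  show "\<forall>(U, \<phi>)\<in>atlas N. \<forall>i<mdim N. C1_fun_on a b ({a..b} \<inter> r -` U) (\<lambda>s. \<phi> (r s) i)"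
  proof clarify
    fix U \<phi> i assume U: "(U, \<phi>) \<in> atlas N" and i: "i < mdim N"
    note c = chartedD[OF cN U]
    show "C1_fun_on a b ({a..b} \<inter> r -` U) (\<lambda>s. \<phi> (r s) i)"
    proof (rule C1_fun_on_locally[OF \<open>a < b\<close>])
      fix t assume t: "t \<in> {a..b} \<inter> r -` U"
      obtain W where W: "r t \<in> W" "diffeo_on N M W q"
        using q r(2) t unfolding local_diffeo_def by blast
      note qW = diffeo_on_inverse[OF W(2)]
      define \<sigma> where "\<sigma> = inv_into W q"
      define D where "D = q ` W \<inter> \<sigma> -` U"
      define A where "A = {a..b} \<inter> r -` (U \<inter> W)"
      have A: "openin (top_of_set {a..b}) A"
        unfolding A_def using is_chartD(1)[OF c] qW(1)
        by (intro openin_preimage[OF _ r] openin_Int) auto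
      have "\<sigma> ` q ` W \<subseteq> pts N"
        using openin_imp_subset[OF qW(1)] qW(5) by (auto simp: \<sigma>_def)
      then have D: "openin (top_of_set (pts M)) D"
        unfolding D_def using qW(4) by (intro openin_preimage[OF qW(2) _ _ is_chartD(1)[OF c]]) (simp_all add: \<sigma>_def)
      have \<sigma>: "p (\<gamma> s) \<in> D" "\<sigma> (p (\<gamma> s)) = r s" if "s \<in> A" for s
        using that eq[of s] qW(5) by (auto simp: A_def D_def \<sigma>_def simp flip: eq)
      have "smooth_fun_on M D (\<lambda>z. \<phi> (\<sigma> z) i)"
        unfolding D_def using smooth_fun_on_map_coord[OF qW(6) U i] by (simp add: \<sigma>_def)
      from smooth_fun_on_compose[OF P M p D this]
      have h: "smooth_fun_on P (pts P \<inter> p -` D) (\<lambda>x. \<phi> (\<sigma> (p x)) i)" .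
      have "openin (top_of_set (pts P)) (pts P \<inter> p -` D)"
        by (rule openin_preimage[OF _ p' D]) simp
      from C1_curve_compose[OF P \<open>a < b\<close> \<gamma> this h]
      have "C1_fun_on a b A (\<lambda>s. \<phi> (\<sigma> (p (\<gamma> s))) i)"
      proof (rule C1_fun_on_subset)
        show "A \<subseteq> {a..b} \<inter> \<gamma> -` (pts P \<inter> p -` D)"
          using \<sigma>(1) \<gamma> by (auto simp: C1_curve_on_def A_def)
      qed
      then have "C1_fun_on a b A (\<lambda>s. \<phi> (r s) i)"
        by (rule C1_fun_on_cong[OF A, rotated]) (simp add: \<sigma>(2))
      then show "\<exists>A. openin (top_of_set {a..b}) A \<and> t \<in> A \<and> A \<subseteq> {a..b} \<inter> r -` U \<and>
          C1_fun_on a b A (\<lambda>s. \<phi> (r s) i)"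
        using A t W(1) by (intro exI[of _ A]) (auto simp: A_def)
    qed auto
  qed
qed

section \<open>Horizontal lifts to the induced bundle\<close>

lemma partition_cover:
  fixes \<tau> :: "nat \<Rightarrow> real"
  assumes "0 < n" "t \<in> {\<tau> 0..\<tau> n}"
  shows "\<exists>i<n. t \<in> {\<tau> i..\<tau> (Suc i)}"
  using assms
proof (induction n)
  case (Suc n)
  show ?case
  \<comment> \<open>The conjunct \<open>0 < n\<close> sends the partition with a single interval to
    the second case, since the induction hypothesis speaks of at least one interval.\<close>
  proof (cases "t \<le> \<tau> n \<and> 0 < n")
    case True
    then show ?thesis using Suc less_SucI by (metis atLeastAtMost_iff)
  next
    case False
    then have "\<tau> n \<le> t" using Suc.prems by (cases "n = 0") auto
    then show ?thesis using Suc.prems by (intro exI[of _ n]) auto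
  qed
qed simp

lemma partition_subset:
  fixes \<tau> :: "nat \<Rightarrow> real"
  assumes "\<forall>i<n. \<tau> i < \<tau> (Suc i)" "i < n"
  shows "{\<tau> i..\<tau> (Suc i)} \<subseteq> {\<tau> 0..\<tau> n}"
proof -
  have mono: "\<tau> i \<le> \<tau> j" if "i \<le> j" "j \<le> n" for i j
    using that
  proof (induction j rule: dec_induct)
    case (step k)
    then show ?case using assms(1) by (meson Suc_le_lessD Suc_leD less_imp_le order_trans)
  qed simp
  show ?thesis
    using mono[of 0 i] mono[of "Suc i" n] assms(2) by auto
qed

lemma horizontal_path_in_total:
  assumes "horizontal_path B \<omega> \<gamma>" "t \<in> {0..1}"
  shows "\<gamma> t \<in> pts (total B)"
proof -
  obtain n \<tau> where \<tau>: "\<tau> 0 = 0" "\<tau> n = 1"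
    "\<forall>i<n. C1_curve_on (total B) \<gamma> (\<tau> i) (\<tau> (Suc i))"
    using assms(1) unfolding horizontal_path_def by blast
  then have "0 < n" by (cases n) auto
  then obtain i where "i < n" "t \<in> {\<tau> i..\<tau> (Suc i)}"
    using partition_cover[of n t \<tau>] assms(2) \<tau>(1,2) by auto
  then show ?thesis using \<tau>(3) unfolding C1_curve_on_def by blast
qed

text \<open>The common part of the passages down to \<open>P\<close> and up to the fibre product:
  the partition is kept, and only the C^1 condition and the value of the form on velocities are
  compared piece by piece.\<close>

lemma horizontal_path_map:
  assumes \<gamma>: "horizontal_path B \<omega> \<gamma>"
    and C1: "\<And>a b. a < b \<Longrightarrow> {a..b} \<subseteq> {0..1} \<Longrightarrow> C1_curve_on (total B) \<gamma> a b \<Longrightarrow>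
      C1_curve_on (total B') \<gamma>' a b"
    and \<omega>: "\<And>a b t. t \<in> {a..b} \<Longrightarrow> {a..b} \<subseteq> {0..1} \<Longrightarrow>
      \<omega>' (\<gamma>' t) (velocity (total B') \<gamma>' a b t) = \<omega> (\<gamma> t) (velocity (total B) \<gamma> a b t)"
  shows "horizontal_path B' \<omega>' \<gamma>'"
proof -
  obtain n \<tau> where \<tau>: "\<tau> 0 = 0" "\<tau> n = 1" and step: "\<forall>i<n. \<tau> i < \<tau> (Suc i) \<and>
      C1_curve_on (total B) \<gamma> (\<tau> i) (\<tau> (Suc i)) \<and>
      (\<forall>t\<in>{\<tau> i..\<tau> (Suc i)}. \<omega> (\<gamma> t) (velocity (total B) \<gamma> (\<tau> i) (\<tau> (Suc i)) t) = (\<lambda>_. 0))"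
    using \<gamma> unfolding horizontal_path_def by blast
  have sub: "{\<tau> i..\<tau> (Suc i)} \<subseteq> {0..1}" if "i < n" for i
    using partition_subset[of n \<tau> i] step that \<tau> by simp
  have "\<tau> i < \<tau> (Suc i) \<and> C1_curve_on (total B') \<gamma>' (\<tau> i) (\<tau> (Suc i)) \<and>
      (\<forall>t\<in>{\<tau> i..\<tau> (Suc i)}. \<omega>' (\<gamma>' t) (velocity (total B') \<gamma>' (\<tau> i) (\<tau> (Suc i)) t) = (\<lambda>_. 0))"
    if i: "i < n" for i
    using step i C1[OF _ sub[OF i]] \<omega>[OF _ sub[OF i]] by simp
  then show ?thesis
    unfolding horizontal_path_def using \<tau> by blast
qed

section \<open>Total space of the induced bundle\<close>

lemma principal_bundleD:
  assumes "principal_bundle B"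
  shows "smooth_manifold (total B)" "smooth_manifold (base B)" "smooth_map (total B) (base B) (proj B)"
  using assms unfolding principal_bundle_def Let_def by blast+

lemma covering_manifoldD:
  assumes "covering_manifold N q M"
  shows "smooth_manifold N" "covering_space (pts N) q (pts M)" "local_diffeo N M q"
  using assms by (auto simp: covering_manifold_def)

lemma induced_bundle_simps:
  "proj (induced_bundle B N q) = fst" "str_group (induced_bundle B N q) = str_group B"
  "pts (total (induced_bundle B N q)) = fibre_product N q (total B) (proj B)"
  "act (induced_bundle B N q) g y = (fst y, act B g (snd y))"
  by (simp_all add: induced_bundle_def submanifold_def fibre_product_def case_prod_unfold)

text \<open>The declared dimension collapses to \<open>mdim (total B)\<close> because a local
  diffeomorphism preserves dimension; the point \<open>n\<close> is where the dimensions of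
  \<open>N\<close> and the base are compared.\<close>

lemma total_induced_bundle:
  assumes B: "principal_bundle B" and N: "covering_manifold N q (base B)" and "n \<in> pts N"
  shows "total (induced_bundle B N q) =
    submanifold (prod_manifold N (total B)) (fibre_product N q (total B) (proj B)) (mdim (total B))"
proof -
  obtain W where W: "n \<in> W" "diffeo_on N (base B) W q"
    using covering_manifoldD(3)[OF N] assms(3) by (auto simp: local_diffeo_def)
  have "mdim N = mdim (base B)"
    by (rule mdim_diffeo[OF smooth_manifold_imp_charted smooth_manifold_imp_charted W(2,1)])
      (rule covering_manifoldD(1)[OF N] principal_bundleD(2)[OF B])+
  then show ?thesis
    by (simp add: induced_bundle_def fibre_product_def)
qed

lemma fibre_product_subset: "fibre_product N q P p \<subseteq> pts (prod_manifold N P)"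
  by (auto simp: fibre_product_def prod_manifold_simps)

text \<open>The second claim is applied twice: to smooth functions on all of \<open>total B\<close>,
  for velocities, and to chart coordinates of \<open>total B\<close>, for projecting curves.\<close>

lemma
  assumes B: "principal_bundle B" and N: "covering_manifold N q (base B)" and n: "n \<in> pts N"
  shows charted_induced_bundle: "charted (total (induced_bundle B N q))"
    and smooth_fun_on_induced_bundle_snd: "openin (top_of_set (pts (total B))) D \<Longrightarrow> smooth_fun_on (total B) D h \<Longrightarrow>
      smooth_fun_on (total (induced_bundle B N q)) (fibre_product N q (total B) (proj B) \<inter> snd -` D) (\<lambda>z. h (snd z))"
proof -
  note P = principal_bundleD(1)[OF B] and M = principal_bundleD(2)[OF B] and p = principal_bundleD(3)[OF B]
  note N' = covering_manifoldD(1)[OF N]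
  let ?S = "fibre_product N q (total B) (proj B)"
  have k: "mdim (total B) \<le> mdim (prod_manifold N (total B))"
    by (simp add: prod_manifold_simps)
  have charted: "charted (prod_manifold N (total B))"
    using N' P by (intro charted_prod_manifold smooth_manifold_imp_charted)
  show "charted (total (induced_bundle B N q))"
    unfolding total_induced_bundle[OF B N n]
  proof (rule charted_submanifold[OF fibre_product_subset k])
    fix z assume "z \<in> ?S"
    then obtain a x where z: "z = (a, x)" "a \<in> pts N" "x \<in> pts (total B)" "q a = proj B x"
      by (auto simp: fibre_product_def)
    then obtain W where "a \<in> W" "diffeo_on N (base B) W q"
      using covering_manifoldD(3)[OF N] by (auto simp: local_diffeo_def)
    then show "\<exists>U \<phi>. slice_chart (prod_manifold N (total B)) ?S (mdim (total B)) (U, \<phi>) \<and> z \<in> U"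
      unfolding z(1)
      using fibre_product_slice_chart[OF N' P smooth_manifold_imp_charted[OF M] p] z by blast
  qed
  assume D: "openin (top_of_set (pts (total B))) D" and h: "smooth_fun_on (total B) D h"
  have "openin (top_of_set (pts (prod_manifold N (total B)))) (pts N \<times> D)"
    unfolding prod_manifold_simps using D by (intro openin_Times) auto
  from smooth_fun_on_submanifold[OF charted fibre_product_subset k this smooth_fun_on_snd[OF N' P D h]]
  show "smooth_fun_on (total (induced_bundle B N q)) (?S \<inter> snd -` D) (\<lambda>z. h (snd z))"
    unfolding total_induced_bundle[OF B N n]
    by (rule smooth_fun_on_subset) (auto simp: fibre_product_def)
qed

text \<open>On smooth \<open>f\<close> both sides are the vector derivative of
  \<open>f \<circ> snd \<circ> \<gamma>\<close>, once \<open>f \<circ> snd\<close> is known to be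
  smooth on the fibre product; otherwise \<open>velocity\<close> would return its default 0. For all
  other \<open>f\<close> both sides are 0 by definition.\<close>

lemma velocity_snd:
  assumes B: "principal_bundle B" and N: "covering_manifold N q (base B)" and n: "n \<in> pts N"
  shows "pushforward (total B) snd (velocity (total (induced_bundle B N q)) \<gamma> a b t) =
    velocity (total B) (snd \<circ> \<gamma>) a b t"
proof
  fix f
  note P = smooth_manifold_imp_charted[OF principal_bundleD(1)[OF B]]
  have "f \<circ> snd \<in> smooth_fun (total (induced_bundle B N q))" if f: "f \<in> smooth_fun (total B)"
  proof -
    have "smooth_fun_on (total B) (pts (total B)) f"
      using f smooth_fun_eq_smooth_fun_on[OF P] by blast
    from smooth_fun_on_induced_bundle_snd[OF B N n _ this]
    have "smooth_fun_on (total (induced_bundle B N q)) (pts (total (induced_bundle B N q))) (\<lambda>z. f (snd z))"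
      unfolding induced_bundle_simps
      by (elim smooth_fun_on_subset[OF meta_mp]) (auto simp: fibre_product_def)
    then show ?thesis
      unfolding smooth_fun_eq_smooth_fun_on[OF charted_induced_bundle[OF B N n]] comp_def .
  qed
  then show "pushforward (total B) snd (velocity (total (induced_bundle B N q)) \<gamma> a b t) f =
      velocity (total B) (snd \<circ> \<gamma>) a b t f"
    by (simp add: pushforward_def velocity_def comp_assoc)
qed

text \<open>Here the slice charts enter: a curve in the fibre product is known to be C^1 in those
  charts, and the coordinates of \<open>P\<close> composed with \<open>snd\<close> are smooth
  functions there.\<close>

lemma horizontal_path_snd:
  assumes B: "principal_bundle B" and N: "covering_manifold N q (base B)" and n: "n \<in> pts N"
    and \<gamma>: "horizontal_path (induced_bundle B N q) (induced_form B \<omega>) \<gamma>"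
  shows "horizontal_path B \<omega> (snd \<circ> \<gamma>)"
proof (rule horizontal_path_map[OF \<gamma>])
  note P = principal_bundleD(1)[OF B]
  show "\<omega> ((snd \<circ> \<gamma>) t) (velocity (total B) (snd \<circ> \<gamma>) a b t) =
      induced_form B \<omega> (\<gamma> t) (velocity (total (induced_bundle B N q)) \<gamma> a b t)" for a b t
    unfolding induced_form_def velocity_snd[OF B N n] by simp
  fix a b :: real
  assume "a < b" and C1: "C1_curve_on (total (induced_bundle B N q)) \<gamma> a b"
  have cont: "continuous_on {a..b} \<gamma>" and im: "\<gamma> ` {a..b} \<subseteq> fibre_product N q (total B) (proj B)"
    using C1 by (auto simp: C1_curve_on_def induced_bundle_simps)
  show "C1_curve_on (total B) (snd \<circ> \<gamma>) a b"
    unfolding C1_curve_on_alt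
  proof (intro conjI)
    show "continuous_on {a..b} (snd \<circ> \<gamma>)"
      using continuous_on_snd[OF cont] by (simp add: comp_def)
    show "(snd \<circ> \<gamma>) ` {a..b} \<subseteq> pts (total B)"
      using im by (force simp: fibre_product_def)
    show "\<forall>(U, \<phi>)\<in>atlas (total B). \<forall>i<mdim (total B).
        C1_fun_on a b ({a..b} \<inter> (snd \<circ> \<gamma>) -` U) (\<lambda>s. \<phi> ((snd \<circ> \<gamma>) s) i)"
    proof clarify
      fix U \<phi> i assume U: "(U, \<phi>) \<in> atlas (total B)" "i < mdim (total B)"
      have U': "openin (top_of_set (pts (total B))) U"
        using is_chartD(1)[OF chartedD[OF smooth_manifold_imp_charted[OF P] U(1)]] .
      have o: "openin (top_of_set (pts (total (induced_bundle B N q))))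
          (fibre_product N q (total B) (proj B) \<inter> snd -` U)"
        unfolding induced_bundle_simps
        by (rule openin_preimage[OF _ _ _ U']) (auto simp: fibre_product_def intro: continuous_intros)
      from C1_curve_compose[OF charted_induced_bundle[OF B N n] \<open>a < b\<close> C1 o
          smooth_fun_on_induced_bundle_snd[OF B N n U' smooth_fun_on_chart_coord[OF P U]]]
      have "C1_fun_on a b ({a..b} \<inter> \<gamma> -` (fibre_product N q (total B) (proj B) \<inter> snd -` U))
          (\<lambda>s. \<phi> (snd (\<gamma> s)) i)" .
      then show "C1_fun_on a b ({a..b} \<inter> (snd \<circ> \<gamma>) -` U) (\<lambda>s. \<phi> ((snd \<circ> \<gamma>) s) i)"
        unfolding comp_def by (rule C1_fun_on_subset) (use im in auto)
    qed
  qed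
qed

text \<open>The path \<open>r\<close> is merely continuous at first and becomes C^1 where
  \<open>\<gamma>\<close> is, by lying over the projection of \<open>\<gamma>\<close>. The pair is
  then C^1 in the product and takes its values in the fibre product.\<close>

lemma horizontal_path_Pair:
  assumes B: "principal_bundle B" and N: "covering_manifold N q (base B)"
    and \<gamma>: "horizontal_path B \<omega> \<gamma>" and r: "path r" "path_image r \<subseteq> pts N"
    and eq: "\<And>t. t \<in> {0..1} \<Longrightarrow> q (r t) = proj B (\<gamma> t)"
  shows "horizontal_path (induced_bundle B N q) (induced_form B \<omega>) (\<lambda>t. (r t, \<gamma> t))"
proof (rule horizontal_path_map[OF \<gamma>])
  note P = principal_bundleD(1)[OF B] and M = principal_bundleD(2)[OF B]
  note N' = covering_manifoldD(1)[OF N]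
  have rN: "r t \<in> pts N" if "t \<in> {0..1}" for t
    using r(2) that by (auto simp: path_image_def)
  have n: "r 0 \<in> pts N" using rN[of 0] by simp
  show "induced_form B \<omega> (r t, \<gamma> t) (velocity (total (induced_bundle B N q)) (\<lambda>t. (r t, \<gamma> t)) a b t) =
      \<omega> (\<gamma> t) (velocity (total B) \<gamma> a b t)" for a b t
    unfolding induced_form_def velocity_snd[OF B N n] by (simp add: comp_def)
  fix a b :: real
  assume ab: "a < b" "{a..b} \<subseteq> {0..1}" and C1: "C1_curve_on (total B) \<gamma> a b"
  have "continuous_on {a..b} r"
    using continuous_on_subset[OF r(1)[unfolded path_def] ab(2)] .
  moreover have "r ` {a..b} \<subseteq> pts N"
    using rN ab(2) by blast
  ultimately have "C1_curve_on N r a b"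
    using eq ab(2)
    by (intro C1_curve_lift[OF N' smooth_manifold_imp_charted[OF P] smooth_manifold_imp_charted[OF M]
          principal_bundleD(3)[OF B] covering_manifoldD(3)[OF N] ab(1) C1]) auto
  from C1_curve_Pair[OF this C1]
  show "C1_curve_on (total (induced_bundle B N q)) (\<lambda>t. (r t, \<gamma> t)) a b"
    unfolding total_induced_bundle[OF B N n]
  proof (rule C1_curve_submanifold[rotated 3])
    show "charted (prod_manifold N (total B))"
      using N' P by (intro charted_prod_manifold smooth_manifold_imp_charted)
    show "(\<lambda>t. (r t, \<gamma> t)) ` {a..b} \<subseteq> fibre_product N q (total B) (proj B)"
      using rN eq ab(2) C1 by (auto simp: fibre_product_def C1_curve_on_def subset_iff)
  qed (simp_all add: prod_manifold_simps ab(1))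
qed

text \<open>
  The defining conditions of the two holonomy elements are equivalent, so that neither the uniqueness
  of the element nor the existence of a horizontal lift enters.
\<close>

lemma holonomy_induced_bundle:
  assumes B: "principal_bundle B" and N: "covering_manifold N q (base B)"
    and y: "y \<in> pts (total (induced_bundle B N q))"
    and c: "c \<in> carrier (fundamental_group (pts N) (fst y))"
  shows "holonomy (induced_bundle B N q) (induced_form B \<omega>) y c =
    holonomy B \<omega> (snd y) (induced_hom (pts (base B)) q c)"
proof -
  let ?B = "induced_bundle B N q" and ?\<omega> = "induced_form B \<omega>" and ?M = "pts (base B)"
  note cov = covering_manifoldD(2)[OF N]
  have n: "fst y \<in> pts N"
    using y by (auto simp: induced_bundle_simps fibre_product_def)
  obtain u where u: "c = path_class (pts N) u" "path u" "path_image u \<subseteq> pts N"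
      "pathstart u = fst y" "pathfinish u = fst y"
    using c by (auto simp: fundamental_group_def)
  have loop: "path s" "path_image s \<subseteq> pts N" "s 0 = fst y" "s 1 = fst y" if "s \<in> c" for s
  proof -
    have us: "homotopic_paths (pts N) u s" using that by (simp add: u(1) path_class_def)
    show "path s" "path_image s \<subseteq> pts N"
      using homotopic_paths_imp_path[OF us] homotopic_paths_imp_subset[OF us] by auto
    show "s 0 = fst y" "s 1 = fst y"
      using homotopic_paths_imp_pathstart[OF us] homotopic_paths_imp_pathfinish[OF us] u(4,5)
      by (simp_all add: pathstart_def pathfinish_def)
  qed
  have "(\<exists>r\<in>c. \<exists>\<gamma>. horizontal_lift ?B ?\<omega> y r \<gamma> \<and> \<gamma> 1 = act ?B g y) \<longleftrightarrow>
      (\<exists>r\<in>induced_hom ?M q c. \<exists>\<gamma>. horizontal_lift B \<omega> (snd y) r \<gamma> \<and> \<gamma> 1 = act B g (snd y))" for g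
  proof
    assume "\<exists>r\<in>c. \<exists>\<gamma>. horizontal_lift ?B ?\<omega> y r \<gamma> \<and> \<gamma> 1 = act ?B g y"
    then obtain r \<gamma> where r: "r \<in> c" and \<gamma>: "horizontal_path ?B ?\<omega> \<gamma>" "\<gamma> 0 = y"
        "\<forall>t\<in>{0..1}. fst (\<gamma> t) = r t" "\<gamma> 1 = act ?B g y"
      by (auto simp: horizontal_lift_def induced_bundle_simps)
    have "path (q \<circ> r)" "path_image (q \<circ> r) \<subseteq> ?M"
      using loop(1,2)[OF r] covering_space_imp_continuous[OF cov] covering_space_imp_surjective[OF cov]
      by (auto simp: path_image_compose intro: path_continuous_image continuous_on_subset)
    then have "q \<circ> r \<in> path_class ?M (q \<circ> r)"
      by (simp add: path_class_def)
    then have "q \<circ> r \<in> induced_hom ?M q c"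
      using r unfolding induced_hom_def by blast
    moreover have "horizontal_lift B \<omega> (snd y) (q \<circ> r) (snd \<circ> \<gamma>)"
      unfolding horizontal_lift_def
    proof (intro conjI ballI)
      show "horizontal_path B \<omega> (snd \<circ> \<gamma>)"
        by (rule horizontal_path_snd[OF B N n \<gamma>(1)])
      show "(snd \<circ> \<gamma>) 0 = snd y" by (simp add: \<gamma>(2))
      fix t :: real assume t: "t \<in> {0..1}"
      then have "\<gamma> t \<in> fibre_product N q (total B) (proj B)"
        using horizontal_path_in_total[OF \<gamma>(1)] by (simp add: induced_bundle_simps)
      then show "proj B ((snd \<circ> \<gamma>) t) = (q \<circ> r) t"
        using \<gamma>(3)[rule_format, OF t] by (auto simp: fibre_product_def)
    qed
    moreover have "(snd \<circ> \<gamma>) 1 = act B g (snd y)"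
      by (simp add: \<gamma>(4) induced_bundle_simps)
    ultimately show "\<exists>r\<in>induced_hom ?M q c. \<exists>\<gamma>. horizontal_lift B \<omega> (snd y) r \<gamma> \<and> \<gamma> 1 = act B g (snd y)"
      by blast
  next
    assume "\<exists>r\<in>induced_hom ?M q c. \<exists>\<gamma>. horizontal_lift B \<omega> (snd y) r \<gamma> \<and> \<gamma> 1 = act B g (snd y)"
    then obtain s r \<gamma> where s: "s \<in> c" "homotopic_paths ?M (q \<circ> s) r"
      and \<gamma>: "horizontal_path B \<omega> \<gamma>" "\<gamma> 0 = snd y" "\<forall>t\<in>{0..1}. proj B (\<gamma> t) = r t" "\<gamma> 1 = act B g (snd y)"
      by (auto simp: horizontal_lift_def induced_hom_def path_class_def)
    \<comment> \<open>\<open>r\<close> is only homotopic to \<open>q \<circ> s\<close>, so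
      \<open>s\<close> is traded for another member of \<open>c\<close> that lies exactly over
      \<open>r\<close>, as the pair with \<open>\<gamma>\<close> requires.\<close>
    obtain r' where r': "homotopic_paths (pts N) s r'" "\<forall>t\<in>{0..1}. q (r' t) = r t"
      by (rule covering_space_lift_homotopic_path[OF cov s(2) loop(1,2)[OF s(1)]]) blast
    have "r' \<in> c"
      using s(1) r'(1) homotopic_paths_trans by (auto simp: u(1) path_class_def)
    moreover have "horizontal_lift ?B ?\<omega> y r' (\<lambda>t. (r' t, \<gamma> t))"
      unfolding horizontal_lift_def induced_bundle_simps
      using horizontal_path_Pair[OF B N \<gamma>(1) loop(1,2)[OF \<open>r' \<in> c\<close>]] r'(2) \<gamma>(2,3) loop(3)[OF \<open>r' \<in> c\<close>]
      by simp
    \<comment> \<open>The group acts on the second component only, so the first one has to return to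
      \<open>fst y\<close>; it does, since \<open>r'\<close> is a loop.\<close>
    moreover have "(r' 1, \<gamma> 1) = act ?B g y"
      by (simp add: induced_bundle_simps \<gamma>(4) loop(4)[OF \<open>r' \<in> c\<close>])
    ultimately show "\<exists>r\<in>c. \<exists>\<gamma>. horizontal_lift ?B ?\<omega> y r \<gamma> \<and> \<gamma> 1 = act ?B g y"
      by blast
  qed
  then show ?thesis
    by (simp add: holonomy_def induced_bundle_simps(2))
qed

theorem theorem0p1:
  fixes B :: "('p::topological_space, 'm::topological_space, 'g::topological_space) bundle_data"
    and \<omega> :: "('p, 'g) lie_form"
    and x0 :: 'p
    and N :: "'n::topological_space manifold"
    and q :: "'n \<Rightarrow> 'm"
    and y0 :: "'n \<times> 'p"
  assumes "principal_bundle B"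
    and "connected (pts (total B))" and "paracompact_space (top_of_set (pts (total B)))"
    and "connected (pts (base B))" and "paracompact_space (top_of_set (pts (base B)))"
    and "flat_connection B \<omega>"
    and "x0 \<in> pts (total B)"
    and "covering_manifold N q (base B)"
    and "y0 \<in> pts (total (induced_bundle B N q))" and "snd y0 = x0"
    and "regular_at N q (base B) (proj (induced_bundle B N q) y0)"
  defines "\<pi>N \<equiv> fundamental_group (pts N) (proj (induced_bundle B N q) y0)"
  shows "(str_group B)\<lparr>carrier :=
            holonomy (induced_bundle B N q) (induced_form B \<omega>) y0 ` carrier \<pi>N\<rparr>
       \<cong> (str_group B)\<lparr>carrier :=
            holonomy B \<omega> x0 ` (induced_hom (pts (base B)) q ` carrier \<pi>N)\<rparr>"
proof -
  have "holonomy (induced_bundle B N q) (induced_form B \<omega>) y0 ` carrier \<pi>N =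
      holonomy B \<omega> x0 ` (induced_hom (pts (base B)) q ` carrier \<pi>N)"
    unfolding image_image \<pi>N_def induced_bundle_simps(1)
    using holonomy_induced_bundle[OF assms(1,8,9)] assms(10) by (intro image_cong) auto
  \<comment> \<open>Equal carriers make the two groups identical, and \<open>\<cong>\<close> is
    reflexive.\<close>
  then show ?thesis by simp
qed

end
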